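(* For any $0<\alpha<\frac{2}{3}$ there is a locally $\alpha$-Hölder map $g\colon (\mathbb{H},d_R)\to(\mathbb{H},d_c)$ which is $\mathbb{H}_{\mathbb{Z}}$-equivariant (that is, $g(h\cdot x)=h\cdot g(x)$ for all $h\in\mathbb{H}_{\mathbb{Z}}$ and $x\in\mathbb{H}$) and equivariantly homotopic to the identity (that is, homotopic to $\mathrm{id}_{\mathbb{H}}$ through $\mathbb{H}_{\mathbb{Z}}$-equivariant continuous maps).
   Context: The first Heisenberg group is $\mathbb{H}=\mathbb{R}^3$ with multiplication $(x,y,z)\cdot(x',y',z')=(x+x',y+y',z+z'+xy')$, and $\mathbb{H}_{\mathbb{Z}}=\mathbb{Z}^3$ is its integer lattice. The left-invariant vector fields $X=\partial_x$, $Y=\partial_y+x\partial_z$, $Z=\partial_z$ give the stratification $V_1\oplus V_2=\mathrm{span}\{X,Y\}\oplus\mathrm{span}\{Z\}$ of the Lie algebra. Let $d_R$ be the distance coming from a left-invariant Riemannian metric on $\mathbb{H}$ for which $V_1$ and $V_2$ are orthogonal at the identity. A $d_R$-absolutely continuous curve is horizontal if its derivative lies almost everywhere in the left-invariant subbundle spanned by $X,Y$. The associated Carnot metric is $d_c(p,q)=\inf\{\ell_R(\gamma):\gamma\text{ a horizontal curve from }p\text{ to }q\}$, where $\ell_R$ is $d_R$-length. A map $\varphi\colon Z\to W$ of metric spaces is $\alpha$-Hölder if there is $\lambda>0$ with $d_W(\varphi(z),\varphi(z'))\le\lambda d_Z(z,z')^\alpha$ for all $z,z'\in Z$; it is locally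 $\alpha$-Hölder if every point of $Z$ has a neighborhood on which $\varphi$ is $\alpha$-Hölder. *)

theory Defs
  imports "HOL-Analysis.Analysis"
begin

section \<open>The first Heisenberg group\<close>

type_synonym heis = "real \<times> real \<times> real"

fun heis_mult :: "heis \<Rightarrow> heis \<Rightarrow> heis"  (infixl "\<odot>" 70) where
  "(x, y, z) \<odot> (x', y', z') = (x + x', y + y', z + z' + x * y')"

definition heis_lattice :: "heis set"  ("\<H>\<^sub>\<int>") where
  "\<H>\<^sub>\<int> = \<int> \<times> \<int> \<times> \<int>"

definition lattice_equivariant :: "(heis \<Rightarrow> heis) \<Rightarrow> bool" where
  "lattice_equivariant f \<longleftrightarrow> (\<forall>h\<in>\<H>\<^sub>\<int>. \<forall>x. f (h \<odot> x) = h \<odot> f x)"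

text \<open>Tangent spaces are identified with the coordinate space, so that the basis
  \<open>\<partial>\<^sub>x, \<partial>\<^sub>y, \<partial>\<^sub>z\<close> becomes the standard basis.\<close>

definition X_field :: "heis \<Rightarrow> heis" where
  "X_field p = (1, 0, 0)"

definition Y_field :: "heis \<Rightarrow> heis" where
  "Y_field p = (0, 1, fst p)"

definition Z_field :: "heis \<Rightarrow> heis" where
  "Z_field p = (0, 0, 1)"


section \<open>Left-invariant Riemannian metrics\<close>

definition inner_product_form :: "('a::real_vector \<Rightarrow> 'a \<Rightarrow> real) \<Rightarrow> bool" where
  "inner_product_form B \<longleftrightarrow>
     bilinear B \<and> (\<forall>u v. B u v = B v u) \<and> (\<forall>u. u \<noteq> 0 \<longrightarrow> B u u > 0)"

text \<open>\<open>G p\<close> is the inner product on the tangent space at \<open>p\<close>. Smoothness in \<open>p\<close> is not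
  required separately: by lemma \<open>left_invariant_riemannian_eq\<close> below, left-invariance makes
  the coefficients of \<open>G\<close> polynomial in \<open>p\<close>.\<close>

definition left_invariant_riemannian :: "(heis \<Rightarrow> heis \<Rightarrow> heis \<Rightarrow> real) \<Rightarrow> bool" where
  "left_invariant_riemannian G \<longleftrightarrow>
     (\<forall>p. inner_product_form (G p)) \<and>
     (\<forall>h p u v. G (h \<odot> p) (frechet_derivative ((\<odot>) h) (at p) u)
                         (frechet_derivative ((\<odot>) h) (at p) v) = G p u v)"

lemma heis_mult_has_derivative:
  "((\<odot>) h has_derivative (\<lambda>u. (fst u, fst (snd u), snd (snd u) + fst h * fst (snd u)))) (at p)"
proof -
  have eq: "(\<odot>) h = (\<lambda>q. (fst h + fst q, fst (snd h) + fst (snd q),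
              snd (snd h) + snd (snd q) + fst h * fst (snd q)))"
    by (cases h) (auto simp: fun_eq_iff)
  show ?thesis
    unfolding eq by (auto intro!: derivative_eq_intros)
qed

lemma left_invariant_riemannian_eq:
  assumes "left_invariant_riemannian G"
  shows "G p u v = G 0 (fst u, fst (snd u), snd (snd u) - fst p * fst (snd u))
                       (fst v, fst (snd v), snd (snd v) - fst p * fst (snd v))"
proof -
  let ?T = "\<lambda>w::heis. (fst w, fst (snd w), snd (snd w) - fst p * fst (snd w))"
  have D: "frechet_derivative ((\<odot>) p) (at 0) =
      (\<lambda>u. (fst u, fst (snd u), snd (snd u) + fst p * fst (snd u)))"
    by (rule frechet_derivative_at[OF heis_mult_has_derivative, symmetric])
  have p: "p \<odot> 0 = p" by (cases p) (simp add: zero_prod_def)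
  have "G (p \<odot> 0) (frechet_derivative ((\<odot>) p) (at 0) (?T u))
                  (frechet_derivative ((\<odot>) p) (at 0) (?T v)) = G 0 (?T u) (?T v)"
    using assms unfolding left_invariant_riemannian_def by blast
  then show ?thesis by (simp add: D p)
qed

definition strata_orthogonal :: "(heis \<Rightarrow> heis \<Rightarrow> heis \<Rightarrow> real) \<Rightarrow> bool" where
  "strata_orthogonal G \<longleftrightarrow>
     (\<forall>u \<in> span {X_field 0, Y_field 0}. \<forall>v \<in> span {Z_field 0}. G 0 u v = 0)"

text \<open>The infimum of the lengths of piecewise \<open>C\<^sup>1\<close> curves. \<open>valid_path\<close> allows the
  derivative to blow up at the finitely many exceptional parameters; stating the length with
  \<open>has_integral\<close> discards the curves of infinite length (whose \<open>integral\<close> would be \<open>0\<close>).\<close>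

definition riemannian_dist :: "(heis \<Rightarrow> heis \<Rightarrow> heis \<Rightarrow> real) \<Rightarrow> heis \<Rightarrow> heis \<Rightarrow> real" where
  "riemannian_dist G p q =
     Inf {L. \<exists>\<gamma>. valid_path \<gamma> \<and> pathstart \<gamma> = p \<and> pathfinish \<gamma> = q \<and>
            ((\<lambda>t. sqrt (G (\<gamma> t) (vector_derivative \<gamma> (at t)) (vector_derivative \<gamma> (at t))))
               has_integral L) {0..1}}"


section \<open>Curves in metric spaces\<close>

text \<open>Curves are parametrized by \<open>{0..1}\<close>.\<close>

definition abs_continuous_curve :: "('a \<Rightarrow> 'a \<Rightarrow> real) \<Rightarrow> (real \<Rightarrow> 'a) \<Rightarrow> bool" where
  "abs_continuous_curve d \<gamma> \<longleftrightarrow>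
     (\<forall>\<epsilon>>0. \<exists>\<delta>>0. \<forall>(n::nat) a b.
        (\<forall>i<n. 0 \<le> a i \<and> a i \<le> b i \<and> b i \<le> 1) \<and>
        disjoint_family_on (\<lambda>i. {a i<..<b i}) {..<n} \<and>
        (\<Sum>i<n. b i - a i) < \<delta> \<longrightarrow>
        (\<Sum>i<n. d (\<gamma> (a i)) (\<gamma> (b i))) < \<epsilon>)"

definition curve_length :: "('a \<Rightarrow> 'a \<Rightarrow> real) \<Rightarrow> (real \<Rightarrow> 'a) \<Rightarrow> ennreal" where
  "curve_length d \<gamma> =
     Sup {ennreal (\<Sum>i<n. d (\<gamma> (t i)) (\<gamma> (t (Suc i)))) | (n::nat) t.
            mono_on {..n} t \<and> t 0 = 0 \<and> t n = 1}"


section \<open>The Carnot metric\<close>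

definition horizontal_curve ::
    "(heis \<Rightarrow> heis \<Rightarrow> heis \<Rightarrow> real) \<Rightarrow> (real \<Rightarrow> heis) \<Rightarrow> bool" where
  "horizontal_curve G \<gamma> \<longleftrightarrow>
     abs_continuous_curve (riemannian_dist G) \<gamma> \<and>
     (AE t in lebesgue_on {0..1}.
        \<exists>v \<in> span {X_field (\<gamma> t), Y_field (\<gamma> t)}.
          (\<gamma> has_vector_derivative v) (at t within {0..1}))"

text \<open>The infimum is finite, since any two points are joined by a horizontal curve of finite
  length; \<open>enn2real\<close> therefore loses nothing.\<close>

definition carnot_dist :: "(heis \<Rightarrow> heis \<Rightarrow> heis \<Rightarrow> real) \<Rightarrow> heis \<Rightarrow> heis \<Rightarrow> real" where
  "carnot_dist G p q =
     enn2real (INF \<gamma> \<in> {\<gamma>. horizontal_curve G \<gamma> \<and> pathstart \<gamma> = p \<and> pathfinish \<gamma> = q}.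
                 curve_length (riemannian_dist G) \<gamma>)"


section \<open>Hoelder maps\<close>

definition holder_on ::
    "'a set \<Rightarrow> ('a \<Rightarrow> 'a \<Rightarrow> real) \<Rightarrow> ('b \<Rightarrow> 'b \<Rightarrow> real) \<Rightarrow> real \<Rightarrow> ('a \<Rightarrow> 'b) \<Rightarrow> bool" where
  "holder_on S dZ dW \<alpha> f \<longleftrightarrow>
     (\<exists>c>0. \<forall>z\<in>S. \<forall>z'\<in>S. dW (f z) (f z') \<le> c * dZ z z' powr \<alpha>)"

definition locally_holder ::
    "('a \<Rightarrow> 'a \<Rightarrow> real) \<Rightarrow> ('b \<Rightarrow> 'b \<Rightarrow> real) \<Rightarrow> real \<Rightarrow> ('a \<Rightarrow> 'b) \<Rightarrow> bool" where
  "locally_holder dZ dW \<alpha> f \<longleftrightarrow> (\<forall>z. \<exists>r>0. holder_on {w. dZ z w < r} dZ dW \<alpha> f)"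

end

theory Submission
  imports Defs
begin

text \<open>
  The Carnot distance between nearby points \<open>p\<close>, \<open>q\<close> is at most a constant times the homogeneous
  norm \<open>max \<bar>x\<bar> \<bar>y\<bar> (sqrt \<bar>z\<bar>)\<close> of the increment \<open>p\<inverse>q = (x, y, z)\<close>
  (\<open>carnot_dist_le\<close>), and for small distances the Riemannian distance controls the increment itself
  linearly (\<open>incr_le_riemannian_dist\<close>).  So the task is to find an equivariant map whose increments over a
  displacement of length \<open>t\<close> have horizontal part of order \<open>t\<^sup>\<alpha>\<close> and vertical part of order
  \<open>t\<^bsup>2\<alpha>\<^esup>\<close>.  The homotopy to the identity is then free: \<open>x\<inverse> g(x)\<close> is lattice invariant, and
  scaling it to \<open>0\<close> is a homotopy through equivariant maps.

  The map is the limit of a convex integration.  Let \<open>F = (f\<^sub>1, f\<^sub>2, f\<^sub>3)\<close> and let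
  \<open>b = df\<^sub>3 - f\<^sub>1 df\<^sub>2\<close> be the pullback of the contact form, whose size is the failure
  of \<open>F\<close> to be horizontal.  Multiplying \<open>F\<close> on the right by \<open>(u, v, w + uv/2)\<close> changes \<open>b\<close> into
  \<open>b + (v du - u dv)/2 + dw + v df\<^sub>1 - u df\<^sub>2\<close>.  A rotating wave
  \<open>u = A sin \<theta>\<close>, \<open>v = A cos \<theta>\<close> contributes \<open>A\<^sup>2 d\<theta> / 2\<close>, so it cancels \<open>b\<close> if
  \<open>d\<theta> = - 2 b / A\<^sup>2\<close>, at the price of a new error of order \<open>A \<bar>dF\<bar>\<close>.

  The form \<open>b\<close> is in general not closed, hence no such phase \<open>\<theta>\<close> exists globally.  One takes a grid of small
  cells, replaces \<open>b\<close> by a constant form on each of them, and glues the waves with cutoffs whose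
  squares sum to one.  Where cells overlap, the product of two waves produces cross terms.  If the
  waves of overlapping cells run at frequencies in different fixed ratios (\<open>s\<^sup>2\<close> for the colours
  \<open>s = 1, \<dots>, 8\<close>), the cross terms oscillate along \<open>b\<close> itself.  They are thus exact up to the error
  already made by freezing \<open>b\<close>, and the function \<open>w\<close> removes them (\<open>wave_cancellation\<close>).  All
  three directions are therefore handled by waves of comparable frequency, and this is what makes the
  exponent \<open>2/3\<close> accessible: if each coordinate direction got a wave of its own, at a frequency well
  above the previous ones, every wave would interact with the earlier ones and the decay would be slower.

  Quantitatively, let \<open>F\<close> have error \<open>e\<close> and horizontal derivative \<open>sqrt (e l)\<close>, with everything
  smooth at scale \<open>1/l\<close>.  Cells of size \<open>1/(M l)\<close> and amplitude \<open>A = sqrt (e / (M\<^sup>2 l))\<close> make the waves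
  oscillate at frequency \<open>M\<^sup>2 l\<close>, and the new error is \<open>O(e/M)\<close>.  The new horizontal derivative is
  of order \<open>A M\<^sup>2 l = sqrt ((e/M) (M\<^sup>3 l))\<close>, so the new map has the same form with \<open>e\<close> replaced by
  \<open>C e/M\<close> and \<open>l\<close> by \<open>M\<^sup>3 l\<close> (\<open>corrugation_stage\<close>).  Iterating gives \<open>e \<approx> l\<^bsup>-s\<^esup>\<close> with \<open>s\<close> as close to
  \<open>1/3\<close> as desired for \<open>M\<close> large.  At scale \<open>t \<approx> 1/l\<close> the homogeneous norm of an increment is of
  order \<open>sqrt (e t) \<approx> t\<^bsup>(1 + s)/2\<^esup>\<close>, which yields every exponent below \<open>2/3\<close>
  (\<open>exists_holder_map_above_half\<close>).

  Equivariance costs nothing: the cell centres form a subset of \<open>\<real>\<^sup>3\<close> that left translation by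
  \<open>\<H>\<^sub>\<int>\<close> permutes, keeping colours and frozen forms, and the waves depend on a point only through its
  increment from the centre.
\<close>

section \<open>Increments and the homogeneous norm\<close>

text \<open>
  Points are handled as vectors with three coordinates; splitting quantifiers over them into
  quantifiers over the coordinates only obscures goals.
\<close>

declare split_paired_All [simp del] split_paired_Ex [simp del]

abbreviation xc :: "heis \<Rightarrow> real" where "xc p \<equiv> fst p"
abbreviation yc :: "heis \<Rightarrow> real" where "yc p \<equiv> fst (snd p)"
abbreviation zc :: "heis \<Rightarrow> real" where "zc p \<equiv> snd (snd p)"

text \<open>The increment is \<open>p\<inverse>q\<close>.\<close>
definition incr :: "heis \<Rightarrow> heis \<Rightarrow> heis" where
  "incr p q = (xc q - xc p, yc q - yc p, zc q - zc p - xc p * (yc q - yc p))"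

lemma mult_coords [simp]:
  "xc (p \<odot> q) = xc p + xc q" "yc (p \<odot> q) = yc p + yc q"
  "zc (p \<odot> q) = zc p + zc q + xc p * yc q"
  by (cases p; cases q; simp)+

lemma incr_coords [simp]:
  "xc (incr p q) = xc q - xc p" "yc (incr p q) = yc q - yc p"
  "zc (incr p q) = zc q - zc p - xc p * (yc q - yc p)"
  by (simp_all add: incr_def)

lemma heis_eqI: "xc p = xc q \<Longrightarrow> yc p = yc q \<Longrightarrow> zc p = zc q \<Longrightarrow> p = q"
  by (cases p; cases q; simp)

lemma mult_assoc: "(p \<odot> q) \<odot> r = p \<odot> (q \<odot> r)"
  by (rule heis_eqI) (simp_all add: algebra_simps)

lemma mult_zero [simp]: "p \<odot> 0 = p" "0 \<odot> p = p"
  by (rule heis_eqI; simp)+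

lemma mult_incr [simp]: "p \<odot> incr p q = q"
  by (rule heis_eqI) simp_all

lemma incr_mult [simp]: "incr p (p \<odot> u) = u"
  by (rule heis_eqI) simp_all

lemma incr_left_invariant [simp]: "incr (h \<odot> p) (h \<odot> q) = incr p q"
  by (rule heis_eqI) (simp_all add: algebra_simps)

lemma incr_self [simp]: "incr p p = 0"
  by (rule heis_eqI) simp_all

lemma incr_trans: "incr p r = incr p q \<odot> incr q r"
  by (rule heis_eqI) (simp_all add: algebra_simps)

text \<open>
  Unlike the Euclidean norm of the increment, this one scales linearly under the dilations
  \<open>(x, y, z) \<mapsto> (r x, r y, r\<^sup>2 z)\<close> and is therefore comparable to the Carnot distance.
\<close>
definition hom_norm :: "heis \<Rightarrow> real" where
  "hom_norm u = max (max \<bar>xc u\<bar> \<bar>yc u\<bar>) (sqrt \<bar>zc u\<bar>)"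

lemma hom_norm_nonneg [simp]: "0 \<le> hom_norm u"
  by (simp add: hom_norm_def)

lemma hom_norm_le_iff:
  assumes "0 \<le> r"
  shows "hom_norm u \<le> r \<longleftrightarrow> \<bar>xc u\<bar> \<le> r \<and> \<bar>yc u\<bar> \<le> r \<and> \<bar>zc u\<bar> \<le> r\<^sup>2"
proof -
  have "sqrt \<bar>zc u\<bar> \<le> r \<longleftrightarrow> \<bar>zc u\<bar> \<le> r\<^sup>2"
    using assms by (metis real_le_lsqrt sqrt_le_D)
  then show ?thesis by (auto simp: hom_norm_def)
qed

lemma hom_norm_bounds: "\<bar>xc u\<bar> \<le> hom_norm u" "\<bar>yc u\<bar> \<le> hom_norm u" "\<bar>zc u\<bar> \<le> (hom_norm u)\<^sup>2"
  using hom_norm_le_iff[of "hom_norm u" u] by auto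

lemma hom_norm_zero [simp]: "hom_norm 0 = 0"
  by (simp add: hom_norm_def)

text \<open>
  The mixed term of the group law satisfies \<open>\<bar>x y'\<bar> \<le> a b\<close>, and
  \<open>a\<^sup>2 + b\<^sup>2 + a b \<le> (a + b)\<^sup>2\<close>, so the triangle inequality holds without a constant.  This matters when
  infinitely many small corrections are added up.
\<close>
lemma hom_norm_mult_le: "hom_norm (u \<odot> v) \<le> hom_norm u + hom_norm v"
proof -
  let ?a = "hom_norm u" and ?b = "hom_norm v"
  have "\<bar>xc u * yc v\<bar> \<le> ?a * ?b"
    unfolding abs_mult using hom_norm_bounds by (intro mult_mono) auto
  then have "\<bar>zc (u \<odot> v)\<bar> \<le> ?a\<^sup>2 + ?b\<^sup>2 + ?a * ?b"
    using hom_norm_bounds(3)[of u] hom_norm_bounds(3)[of v] by simp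
  also have "\<dots> \<le> (?a + ?b)\<^sup>2"
    by (simp add: power2_sum)
  finally show ?thesis
    using hom_norm_bounds(1,2)[of u] hom_norm_bounds(1,2)[of v]
    by (subst hom_norm_le_iff) auto
qed

lemma hom_norm_incr_triangle:
  "hom_norm (incr p r) \<le> hom_norm (incr p q) + hom_norm (incr q r)"
  using hom_norm_mult_le incr_trans by metis

lemma hom_norm_incr_swap: "hom_norm (incr q p) \<le> 2 * hom_norm (incr p q)"
proof -
  let ?a = "hom_norm (incr p q)"
  note b = hom_norm_bounds[of "incr p q", simplified]
  have "\<bar>(xc q - xc p) * (yc q - yc p)\<bar> \<le> ?a * ?a"
    unfolding abs_mult using b by (intro mult_mono) auto
  moreover have "zc (incr q p) = - zc (incr p q) + (xc q - xc p) * (yc q - yc p)"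
    by (simp add: algebra_simps)
  ultimately have "\<bar>zc (incr q p)\<bar> \<le> 2 * ?a\<^sup>2"
    using b(3) by (simp add: power2_eq_square)
  also have "\<dots> \<le> (2 * ?a)\<^sup>2" by (simp add: power_mult_distrib)
  finally show ?thesis
    using b(1,2) hom_norm_nonneg[of "incr p q"] by (subst hom_norm_le_iff) auto
qed

section \<open>Comparison with the Riemannian distance\<close>

text \<open>
  The coordinates of a tangent vector at \<open>p\<close> in the left-invariant frame; the metric depends on
  the vector only through them.
\<close>

definition frame_coords :: "heis \<Rightarrow> heis \<Rightarrow> heis" where
  "frame_coords p u = (xc u, yc u, zc u - xc p * yc u)"

lemma frame_coords_nth [simp]: "xc (frame_coords p u) = xc u" "yc (frame_coords p u) = yc u"
  "zc (frame_coords p u) = zc u - xc p * yc u"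
  by (simp_all add: frame_coords_def)

lemma norm_heis_le: "norm (u::heis) \<le> \<bar>xc u\<bar> + \<bar>yc u\<bar> + \<bar>zc u\<bar>"
proof -
  have "norm u \<le> norm (xc u) + norm (snd u)" by (metis norm_Pair_le prod.collapse)
  also have "norm (snd u) \<le> norm (yc u) + norm (zc u)" by (metis norm_Pair_le prod.collapse)
  finally show ?thesis by simp
qed

lemma coord_le_norm: "\<bar>xc u\<bar> \<le> norm (u::heis)" "\<bar>yc u\<bar> \<le> norm u" "\<bar>zc u\<bar> \<le> norm u"
proof -
  show "\<bar>xc u\<bar> \<le> norm u" using norm_fst_le[of "xc u" "snd u"] by simp
  have "norm (snd u) \<le> norm u" using norm_snd_le[of "snd u" "xc u"] by simp
  then show "\<bar>yc u\<bar> \<le> norm u" "\<bar>zc u\<bar> \<le> norm u"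
    using norm_fst_le[of "yc u" "zc u"] norm_snd_le[of "zc u" "yc u"] by simp_all
qed

lemma inner_product_form_norm_bounds:
  fixes B :: "'a::euclidean_space \<Rightarrow> 'a \<Rightarrow> real"
  assumes "inner_product_form B"
  obtains c C where "0 < c" "0 < C" "\<And>w. c * norm w \<le> sqrt (B w w)" "\<And>w. sqrt (B w w) \<le> C * norm w"
proof -
  interpret B: bounded_bilinear B
    using assms bilinear_conv_bounded_bilinear unfolding inner_product_form_def by blast
  have pos: "u \<noteq> 0 \<Longrightarrow> B u u > 0" for u using assms by (auto simp: inner_product_form_def)
  have nn: "B u u \<ge> 0" for u using pos[of u] B.zero_left by (cases "u = 0") auto
  obtain K where K: "K > 0" "\<And>u v. norm (B u v) \<le> norm u * norm v * K"
    using B.pos_bounded by blast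
  have scale: "B w w = (norm w)\<^sup>2 * B (sgn w) (sgn w)" for w
  proof -
    define s where "s = sgn w"
    have "w = norm w *\<^sub>R s" by (cases "w = 0") (simp_all add: s_def sgn_div_norm)
    then obtain r where r: "r = norm w" "w = r *\<^sub>R s" by blast
    have "B (r *\<^sub>R s) (r *\<^sub>R s) = r\<^sup>2 * B s s"
      by (simp add: B.scaleR_left B.scaleR_right power2_eq_square)
    then show ?thesis unfolding s_def[symmetric] r(1)[symmetric] by (subst (1 2) r(2))
  qed
  have cont: "continuous_on (sphere 0 1) (\<lambda>u. B u u)"
    by (intro B.continuous_on continuous_intros)
  obtain x where x: "x \<in> sphere 0 1" "\<And>y. y \<in> sphere 0 1 \<Longrightarrow> B x x \<le> B y y"
    using continuous_attains_inf[OF _ _ cont] by auto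
  have lo: "sqrt (B x x) * norm w \<le> sqrt (B w w)" for w
  proof (cases "w = 0")
    case False
    then have "B x x \<le> B (sgn w) (sgn w)" using x(2)[of "sgn w"] by (simp add: norm_sgn)
    then have "B x x * (norm w)\<^sup>2 \<le> B w w"
      using scale[of w] by (metis mult.commute mult_left_mono zero_le_power2)
    then have "sqrt (B x x * (norm w)\<^sup>2) \<le> sqrt (B w w)" by simp
    then show ?thesis by (simp add: real_sqrt_mult)
  qed (use nn in simp)
  have hi: "sqrt (B w w) \<le> sqrt K * norm w" for w
  proof -
    have "B w w \<le> K * (norm w)\<^sup>2" using K(2)[of w w] by (simp add: power2_eq_square mult.commute)
    then have "sqrt (B w w) \<le> sqrt (K * (norm w)\<^sup>2)" by simp
    then show ?thesis by (simp add: real_sqrt_mult)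
  qed
  have "x \<noteq> 0" using x(1) by auto
  then show thesis
    by (intro that[of "sqrt (B x x)" "sqrt K"]) (use lo hi K(1) pos[of x] in auto)
qed

locale riemannian =
  fixes G :: "heis \<Rightarrow> heis \<Rightarrow> heis \<Rightarrow> real"
  assumes left_invariant: "left_invariant_riemannian G"
begin

abbreviation speed :: "heis \<Rightarrow> heis \<Rightarrow> real" where
  "speed p u \<equiv> sqrt (G p u u)"

definition frame_norm :: "heis \<Rightarrow> real" where
  "frame_norm w = sqrt (G 0 w w)"

lemma speed_frame: "speed p u = frame_norm (frame_coords p u)"
  using left_invariant_riemannian_eq[OF left_invariant, of p u u]
  by (simp only: frame_coords_def frame_norm_def)

lemma speed_bounds:
  obtains c C where "0 < c" "0 < C"
    "\<And>p u. c * norm (frame_coords p u) \<le> speed p u" "\<And>p u. speed p u \<le> C * norm (frame_coords p u)"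
proof -
  have "inner_product_form (G 0)" using left_invariant unfolding left_invariant_riemannian_def by blast
  then obtain c C where *: "0 < c" "0 < C" "\<And>w. c * norm w \<le> sqrt (G 0 w w)" "\<And>w. sqrt (G 0 w w) \<le> C * norm w"
    using inner_product_form_norm_bounds by blast
  show thesis
    by (rule that[OF *(1,2)]) (unfold speed_frame, unfold frame_norm_def, rule *(3), rule *(4))
qed

lemma speed_nonneg: "0 \<le> speed p u"
proof -
  obtain c C where "0 < c" "0 < C" "\<And>p u. c * norm (frame_coords p u) \<le> speed p u"
    "\<And>p u. speed p u \<le> C * norm (frame_coords p u)"
    by (rule speed_bounds) blast
  then show ?thesis by (meson mult_nonneg_nonneg norm_ge_zero less_imp_le order_trans)
qed

definition admissible :: "heis \<Rightarrow> heis \<Rightarrow> (real \<Rightarrow> heis) \<Rightarrow> real \<Rightarrow> bool" where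
  "admissible p q \<gamma> L \<longleftrightarrow> valid_path \<gamma> \<and> pathstart \<gamma> = p \<and> pathfinish \<gamma> = q \<and>
    ((\<lambda>t. speed (\<gamma> t) (vector_derivative \<gamma> (at t))) has_integral L) {0..1}"

lemma riemannian_dist_eq: "riemannian_dist G p q = Inf {L. \<exists>\<gamma>. admissible p q \<gamma> L}"
  by (simp add: riemannian_dist_def admissible_def)

lemma admissible_nonneg: "admissible p q \<gamma> L \<Longrightarrow> 0 \<le> L"
  unfolding admissible_def using has_integral_nonneg speed_nonneg by blast

text \<open>
  Along the straight segment from \<open>p\<close> to \<open>q\<close> the frame coordinates of the velocity are the
  increment, apart from a drift of the vertical coordinate bounded by \<open>\<bar>\<Delta>x \<Delta>y\<bar>\<close>.
\<close>
lemma straight_path_admissible: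
  obtains C where "0 < C" "\<And>p q. \<exists>\<gamma> L. admissible p q \<gamma> L \<and>
     L \<le> C * (norm (incr p q) + \<bar>xc q - xc p\<bar> * \<bar>yc q - yc p\<bar>)"
proof -
  obtain c C where C: "0 < c" "0 < C" "\<And>p u. c * norm (frame_coords p u) \<le> speed p u"
    "\<And>p u. speed p u \<le> C * norm (frame_coords p u)"
    by (rule speed_bounds) blast
  have "inner_product_form (G 0)" using left_invariant unfolding left_invariant_riemannian_def by blast
  then interpret B: bounded_bilinear "G 0"
    using bilinear_conv_bounded_bilinear unfolding inner_product_form_def by blast
  have "\<exists>\<gamma> L. admissible p q \<gamma> L \<and> L \<le> C * (norm (incr p q) + \<bar>xc q - xc p\<bar> * \<bar>yc q - yc p\<bar>)" for p q
  proof -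
    let ?f = "\<lambda>t. speed (linepath p q t) (q - p)"
    let ?b = "C * (norm (incr p q) + \<bar>xc q - xc p\<bar> * \<bar>yc q - yc p\<bar>)"
    have fc: "frame_coords (linepath p q t) (q - p) = incr p q - (0, 0, t * ((xc q - xc p) * (yc q - yc p)))" for t
      by (rule heis_eqI) (simp_all add: linepath_def algebra_simps)
    have "continuous_on {0..1} ?f"
      unfolding speed_frame fc unfolding frame_norm_def
      by (intro continuous_on_real_sqrt B.continuous_on continuous_intros)
    then have "?f integrable_on {0..1}" by (rule integrable_continuous_interval)
    then have int: "(?f has_integral integral {0..1} ?f) {0..1}" by blast
    have bd: "?f t \<le> ?b" if "t \<in> {0..1}" for t
    proof -
      have "norm (frame_coords (linepath p q t) (q - p)) \<le> norm (incr p q) + norm ((0::real, 0::real, t * ((xc q - xc p) * (yc q - yc p))))"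
        unfolding fc by (rule norm_triangle_ineq4)
      also have "norm ((0::real, 0::real, t * ((xc q - xc p) * (yc q - yc p)))) = t * (\<bar>xc q - xc p\<bar> * \<bar>yc q - yc p\<bar>)"
        using that by (simp add: norm_Pair abs_mult)
      also have "\<dots> \<le> \<bar>xc q - xc p\<bar> * \<bar>yc q - yc p\<bar>"
        using that by (intro mult_left_le_one_le) auto
      finally show ?thesis using C(2) C(4)[of "linepath p q t" "q - p"]
        by (meson add_left_mono mult_left_mono less_imp_le order_trans)
    qed
    have "integral {0..1} ?f \<le> ?b"
      using has_integral_le[OF int has_integral_const_real[of ?b 0 1]] bd by simp
    moreover have "admissible p q (linepath p q) (integral {0..1} ?f)"
      unfolding admissible_def using int by (simp add: valid_path_linepath vector_derivative_linepath_at)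
    ultimately show ?thesis by blast
  qed
  with C(2) show thesis by (rule that)
qed

lemma admissible_ex: "{L. \<exists>\<gamma>. admissible p q \<gamma> L} \<noteq> {}"
proof -
  obtain C where "\<And>p q. \<exists>\<gamma> L. admissible p q \<gamma> L \<and>
     L \<le> C * (norm (incr p q) + \<bar>xc q - xc p\<bar> * \<bar>yc q - yc p\<bar>)"
    by (rule straight_path_admissible) blast
  then show ?thesis by blast
qed

lemma riemannian_dist_nonneg: "0 \<le> riemannian_dist G p q"
  unfolding riemannian_dist_eq
  by (rule cInf_greatest[OF admissible_ex]) (use admissible_nonneg in blast)

lemma riemannian_dist_le:
  obtains C where "0 < C" "\<And>p q. riemannian_dist G p q \<le> C * (norm (incr p q) + \<bar>xc q - xc p\<bar> * \<bar>yc q - yc p\<bar>)"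
proof -
  obtain C where C: "0 < C" "\<And>p q. \<exists>\<gamma> L. admissible p q \<gamma> L \<and>
     L \<le> C * (norm (incr p q) + \<bar>xc q - xc p\<bar> * \<bar>yc q - yc p\<bar>)"
    by (rule straight_path_admissible) blast
  have bdd: "bdd_below {L. \<exists>\<gamma>. admissible p q \<gamma> L}" for p q
    by (intro bdd_belowI[of _ 0]) (use admissible_nonneg in blast)
  show thesis
  proof (rule that[OF C(1)])
    fix p q
    obtain \<gamma> L where "admissible p q \<gamma> L" and L: "L \<le> C * (norm (incr p q) + \<bar>xc q - xc p\<bar> * \<bar>yc q - yc p\<bar>)"
      using C(2) by blast
    then have "riemannian_dist G p q \<le> L"
      unfolding riemannian_dist_eq using bdd by (intro cInf_lower) auto
    with L show "riemannian_dist G p q \<le> C * (norm (incr p q) + \<bar>xc q - xc p\<bar> * \<bar>yc q - yc p\<bar>)" by linarith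
  qed
qed

text \<open>
  A function whose derivative along the path is dominated by the speed changes by at most the
  length.  Paths are only piecewise smooth and their speed may be unbounded, so the fundamental
  theorem of calculus is used in the form that ignores finitely many parameters.
\<close>
lemma admissible_real_bound:
  fixes \<phi> :: "real \<Rightarrow> real"
  assumes adm: "admissible p q \<gamma> L" and s: "s \<in> {0..1}"
    and cont: "continuous_on {0..1} \<phi>" and K: "0 \<le> K"
    and der: "\<And>t. t \<in> {0<..<1} \<Longrightarrow> \<gamma> differentiable (at t) \<Longrightarrow>
        \<exists>d. (\<phi> has_vector_derivative d) (at t) \<and> \<bar>d\<bar> \<le> K * speed (\<gamma> t) (vector_derivative \<gamma> (at t))"
  shows "\<bar>\<phi> s - \<phi> 0\<bar> \<le> K * L"
proof -
  let ?v = "\<lambda>t. speed (\<gamma> t) (vector_derivative \<gamma> (at t))"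
  have vI: "(?v has_integral L) {0..1}" and vp: "valid_path \<gamma>" using adm by (auto simp: admissible_def)
  then have vs: "?v integrable_on {0..s}"
    using s by (meson integrable_on_subinterval has_integral_integrable atLeastatMost_subset_iff atLeastAtMost_iff order_refl)
  have "integral {0..s} ?v \<le> integral {0..1} ?v"
    using s vs vI speed_nonneg by (intro integral_subset_le) auto
  then have Ls: "integral {0..s} ?v \<le> L" using vI by (simp add: integral_unique)
  obtain S where S: "finite S" "\<And>t. t \<in> {0..1} - S \<Longrightarrow> \<gamma> differentiable (at t)"
    using vp unfolding valid_path_def piecewise_C1_differentiable_on_def C1_differentiable_on_eq by auto
  obtain d where d: "\<And>t. t \<in> {0<..<1} - S \<Longrightarrow> (\<phi> has_vector_derivative d t) (at t) \<and> \<bar>d t\<bar> \<le> K * ?v t"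
  proof -
    have "\<exists>d. (\<phi> has_vector_derivative d) (at t) \<and> \<bar>d\<bar> \<le> K * ?v t" if "t \<in> {0<..<1} - S" for t
      by (rule der) (use that S(2)[of t] in auto)
    then show thesis using that by metis
  qed
  define d' where "d' t = (if t \<in> {0<..<1} - S then d t else 0)" for t
  have "(d' has_integral (\<phi> s - \<phi> 0)) {0..s}"
    by (rule fundamental_theorem_of_calculus_interior_strong[OF S(1)])
       (use s d cont continuous_on_subset[OF cont] in \<open>auto simp: d'_def\<close>)
  moreover have "((\<lambda>t. K * ?v t) has_integral (K * integral {0..s} ?v)) {0..s}"
    using vs by (intro has_integral_mult_right) blast
  moreover have "norm (d' t) \<le> K * ?v t" for t
    using d[of t] K speed_nonneg by (auto simp: d'_def)
  ultimately have "norm (\<phi> s - \<phi> 0) \<le> K * integral {0..s} ?v"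
    using has_integral_norm_bound_integral_component[where k="1::real", of d' _ _ "\<lambda>t. K * ?v t"] by simp
  also have "\<dots> \<le> K * L" using Ls K by (rule mult_left_mono)
  finally show ?thesis by simp
qed

text \<open>
  The bound is applied first to the horizontal coordinates at all times, since the drift
  \<open>(x - x\<^sub>0) dy\<close> of the vertical coordinate is controlled only once \<open>x\<close> is known to stay close to its
  initial value.  The quadratic term reflects this drift.
\<close>
lemma admissible_incr_le:
  obtains C where "0 < C" "\<And>p q \<gamma> L. admissible p q \<gamma> L \<Longrightarrow> norm (incr p q) \<le> C * (L + L\<^sup>2)"
proof -
  obtain c C where C: "0 < c" "0 < C" "\<And>p u. c * norm (frame_coords p u) \<le> speed p u"
    "\<And>p u. speed p u \<le> C * norm (frame_coords p u)"
    by (rule speed_bounds) blast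
  define K where "K = 1 / c"
  have K: "0 < K" using C(1) by (simp add: K_def)
  have fK: "norm (frame_coords p u) \<le> K * speed p u" for p u
    using C(1) C(3)[of p u] by (simp add: K_def field_simps)
  have "norm (incr p q) \<le> (3 * K + K\<^sup>2) * (L + L\<^sup>2)" if adm: "admissible p q \<gamma> L" for p q \<gamma> L
  proof -
    have L0: "0 \<le> L" using adm by (rule admissible_nonneg)
    have g: "\<gamma> 0 = p" "\<gamma> 1 = q" "continuous_on {0..1} \<gamma>"
      using adm valid_path_imp_path by (auto simp: admissible_def pathstart_def pathfinish_def path_def)
    define v where "v t = vector_derivative \<gamma> (at t)" for t
    have vd: "((\<lambda>t. xc (\<gamma> t)) has_vector_derivative xc (v t)) (at t)"
        "((\<lambda>t. yc (\<gamma> t)) has_vector_derivative yc (v t)) (at t)"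
        "((\<lambda>t. zc (\<gamma> t)) has_vector_derivative zc (v t)) (at t)" if "\<gamma> differentiable (at t)" for t
    proof -
      have "(\<gamma> has_vector_derivative v t) (at t)"
        using that vector_derivative_works v_def by metis
      then show "((\<lambda>t. xc (\<gamma> t)) has_vector_derivative xc (v t)) (at t)"
        "((\<lambda>t. yc (\<gamma> t)) has_vector_derivative yc (v t)) (at t)"
        "((\<lambda>t. zc (\<gamma> t)) has_vector_derivative zc (v t)) (at t)"
        by (auto intro!: bounded_linear.has_vector_derivative[OF bounded_linear_fst]
              bounded_linear.has_vector_derivative[OF bounded_linear_snd])
    qed
    have fv: "\<bar>xc (v t)\<bar> \<le> K * speed (\<gamma> t) (v t)" "\<bar>yc (v t)\<bar> \<le> K * speed (\<gamma> t) (v t)"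
       "\<bar>zc (v t) - xc (\<gamma> t) * yc (v t)\<bar> \<le> K * speed (\<gamma> t) (v t)" for t
      using coord_le_norm[of "frame_coords (\<gamma> t) (v t)"] fK[of "\<gamma> t" "v t"] by simp_all
    have X: "\<bar>xc (\<gamma> s) - xc p\<bar> \<le> K * L" if "s \<in> {0..1}" for s
    proof -
      have "\<bar>xc (\<gamma> s) - xc (\<gamma> 0)\<bar> \<le> K * L"
      proof (rule admissible_real_bound[OF adm that])
        show "continuous_on {0..1} (\<lambda>t. xc (\<gamma> t))" using g(3) by (intro continuous_intros)
        show "\<exists>d. ((\<lambda>t. xc (\<gamma> t)) has_vector_derivative d) (at t) \<and>
            \<bar>d\<bar> \<le> K * speed (\<gamma> t) (vector_derivative \<gamma> (at t))" if "\<gamma> differentiable at t" for t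
          using vd(1)[OF that] fv(1)[of t] unfolding v_def by blast
      qed (use K in simp)
      then show ?thesis using g by simp
    qed
    have "\<bar>yc (\<gamma> 1) - yc (\<gamma> 0)\<bar> \<le> K * L"
    proof (rule admissible_real_bound[OF adm])
      show "continuous_on {0..1} (\<lambda>t. yc (\<gamma> t))" using g(3) by (intro continuous_intros)
      show "\<exists>d. ((\<lambda>t. yc (\<gamma> t)) has_vector_derivative d) (at t) \<and>
          \<bar>d\<bar> \<le> K * speed (\<gamma> t) (vector_derivative \<gamma> (at t))" if "\<gamma> differentiable at t" for t
        using vd(2)[OF that] fv(2)[of t] unfolding v_def by blast
    qed (use K in simp_all)
    then have Y: "\<bar>yc q - yc p\<bar> \<le> K * L" using g by simp
    have "\<bar>(zc (\<gamma> 1) - xc p * yc (\<gamma> 1)) - (zc (\<gamma> 0) - xc p * yc (\<gamma> 0))\<bar> \<le> (K + K * L * K) * L"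
    proof (rule admissible_real_bound[OF adm])
      fix t :: real assume t: "t \<in> {0<..<1}" and df: "\<gamma> differentiable (at t)"
      let ?d = "zc (v t) - xc p * yc (v t)"
      let ?s = "speed (\<gamma> t) (v t)"
      have "((\<lambda>t. zc (\<gamma> t) - xc p * yc (\<gamma> t)) has_vector_derivative ?d) (at t)"
        using vd[OF df] by (auto intro!: derivative_eq_intros)
      moreover have "\<bar>?d\<bar> \<le> (K + K * L * K) * ?s"
      proof -
        have "\<bar>(xc (\<gamma> t) - xc p) * yc (v t)\<bar> \<le> (K * L) * (K * ?s)"
          unfolding abs_mult using X[of t] t fv(2) K L0 by (intro mult_mono) auto
        moreover have "?d = (zc (v t) - xc (\<gamma> t) * yc (v t)) + (xc (\<gamma> t) - xc p) * yc (v t)"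
          by (simp add: algebra_simps)
        ultimately have "\<bar>?d\<bar> \<le> K * ?s + (K * L) * (K * ?s)"
          using fv(3)[of t] by linarith
        then show ?thesis by (simp add: algebra_simps)
      qed
      ultimately show "\<exists>d. ((\<lambda>t. zc (\<gamma> t) - xc p * yc (\<gamma> t)) has_vector_derivative d) (at t) \<and>
          \<bar>d\<bar> \<le> (K + K * L * K) * speed (\<gamma> t) (vector_derivative \<gamma> (at t))"
        unfolding v_def by blast
    next
      show "continuous_on {0..1} (\<lambda>t. zc (\<gamma> t) - xc p * yc (\<gamma> t))" using g(3) by (intro continuous_intros)
    qed (use K L0 in simp_all)
    then have Z: "\<bar>zc (incr p q)\<bar> \<le> (K + K * L * K) * L"
      using g by (simp add: algebra_simps)
    have "norm (incr p q) \<le> K * L + K * L + (K + K * L * K) * L"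
      using norm_heis_le[of "incr p q"] X[of 1] Y Z g by simp
    also have "\<dots> \<le> (3 * K + K\<^sup>2) * (L + L\<^sup>2)"
      using K L0 by (simp add: algebra_simps power2_eq_square)
    finally show ?thesis .
  qed
  moreover have "0 < 3 * K + K\<^sup>2" using K by (simp add: add_pos_pos)
  ultimately show thesis using that by blast
qed

text \<open>
  The infimum need not be attained, so the estimate for paths is applied to paths of length
  \<open>d + h\<close>, and \<open>h\<close> tends to \<open>0\<close>.
\<close>
lemma incr_le_riemannian_dist:
  obtains C where "0 < C"
    "\<And>p q. norm (incr p q) \<le> C * (riemannian_dist G p q + (riemannian_dist G p q)\<^sup>2)"
proof -
  obtain C where C: "0 < C" "\<And>p q \<gamma> L. admissible p q \<gamma> L \<Longrightarrow> norm (incr p q) \<le> C * (L + L\<^sup>2)"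
    by (rule admissible_incr_le) blast
  have "norm (incr p q) \<le> C * (riemannian_dist G p q + (riemannian_dist G p q)\<^sup>2)" for p q
  proof (rule tendsto_lowerbound)
    let ?d = "riemannian_dist G p q"
    show "((\<lambda>h. C * ((?d + h) + (?d + h)\<^sup>2)) \<longlongrightarrow> C * (?d + ?d\<^sup>2)) (at_right 0)"
      by (auto intro!: tendsto_eq_intros)
    show "\<forall>\<^sub>F h in at_right 0. norm (incr p q) \<le> C * ((?d + h) + (?d + h)\<^sup>2)"
      using eventually_at_right_less[of 0]
    proof eventually_elim
      case (elim h)
      then have "Inf {L. \<exists>\<gamma>. admissible p q \<gamma> L} < ?d + h" by (simp add: riemannian_dist_eq)
      then obtain L \<gamma> where L: "admissible p q \<gamma> L" "L < ?d + h"
        using cInf_lessD[OF admissible_ex] by blast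
      have "L\<^sup>2 \<le> (?d + h)\<^sup>2" using L admissible_nonneg by (intro power_mono) auto
      then have "C * (L + L\<^sup>2) \<le> C * ((?d + h) + (?d + h)\<^sup>2)" using L C(1) by simp
      then show ?case using C(2)[OF L(1)] by linarith
    qed
  qed simp
  with C(1) show thesis by (rule that)
qed

end

section \<open>Upper bound for the Carnot distance\<close>

lemma abs_continuous_curve_lipschitz:
  assumes K: "0 \<le> K" and lip: "\<And>s t. 0 \<le> s \<Longrightarrow> s \<le> t \<Longrightarrow> t \<le> 1 \<Longrightarrow> d (\<gamma> s) (\<gamma> t) \<le> K * (t - s)"
  shows "abs_continuous_curve d \<gamma>"
  unfolding abs_continuous_curve_def
proof (intro allI impI)
  fix \<epsilon> :: real assume \<epsilon>: "\<epsilon> > 0"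
  show "\<exists>\<delta>>0. \<forall>(n::nat) a b. (\<forall>i<n. 0 \<le> a i \<and> a i \<le> b i \<and> b i \<le> 1) \<and>
      disjoint_family_on (\<lambda>i. {a i<..<b i}) {..<n} \<and> (\<Sum>i<n. b i - a i) < \<delta> \<longrightarrow>
      (\<Sum>i<n. d (\<gamma> (a i)) (\<gamma> (b i))) < \<epsilon>"
  proof (intro exI[of _ "\<epsilon> / (K + 1)"] conjI allI impI)
    show "\<epsilon> / (K + 1) > 0" using \<epsilon> K by simp
    fix n :: nat and a b :: "nat \<Rightarrow> real"
    assume *: "(\<forall>i<n. 0 \<le> a i \<and> a i \<le> b i \<and> b i \<le> 1) \<and>
      disjoint_family_on (\<lambda>i. {a i<..<b i}) {..<n} \<and> (\<Sum>i<n. b i - a i) < \<epsilon> / (K + 1)"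
    have "(\<Sum>i<n. d (\<gamma> (a i)) (\<gamma> (b i))) \<le> (\<Sum>i<n. K * (b i - a i))"
      by (intro sum_mono lip) (use * in auto)
    also have "\<dots> \<le> (K + 1) * (\<Sum>i<n. b i - a i)"
      unfolding sum_distrib_left by (intro sum_mono mult_right_mono) (use * in auto)
    also have "\<dots> < (K + 1) * (\<epsilon> / (K + 1))"
      using * K by (intro mult_strict_left_mono) auto
    finally show "(\<Sum>i<n. d (\<gamma> (a i)) (\<gamma> (b i))) < \<epsilon>" using K by simp
  qed
qed

lemma curve_length_lipschitz:
  assumes lip: "\<And>s t. 0 \<le> s \<Longrightarrow> s \<le> t \<Longrightarrow> t \<le> 1 \<Longrightarrow> d (\<gamma> s) (\<gamma> t) \<le> K * (t - s)"
  shows "curve_length d \<gamma> \<le> ennreal K"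
  unfolding curve_length_def
proof (rule Sup_least, clarify)
  fix n :: nat and t :: "nat \<Rightarrow> real"
  assume t: "mono_on {..n} t" "t 0 = 0" "t n = 1"
  have m: "t i \<le> t j" if "i \<le> j" "j \<le> n" for i j
    using mono_onD[OF t(1), of i j] that by auto
  have "(\<Sum>i<n. d (\<gamma> (t i)) (\<gamma> (t (Suc i)))) \<le> (\<Sum>i<n. K * (t (Suc i) - t i))"
  proof (intro sum_mono lip)
    fix i assume "i \<in> {..<n}"
    then show "0 \<le> t i" "t i \<le> t (Suc i)" "t (Suc i) \<le> 1"
      using m[of 0 i] m[of i "Suc i"] m[of "Suc i" n] t by auto
  qed
  also have "\<dots> = K"
    using t by (simp add: sum_distrib_left[symmetric] sum_lessThan_telescope)
  finally show "ennreal (\<Sum>i<n. d (\<gamma> (t i)) (\<gamma> (t (Suc i)))) \<le> ennreal K"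
    by (rule ennreal_leI)
qed

text \<open>
  A polynomial horizontal arc from the origin.  The three functions are the coordinates \<open>x\<close>, \<open>y\<close>
  and \<open>z = \<integral> x dy\<close>; the last one is integrated explicitly.
\<close>
definition arc_x :: "real \<Rightarrow> real \<Rightarrow> real \<Rightarrow> real" where
  "arc_x a P t = P * t - a * t\<^sup>2"
definition arc_y :: "real \<Rightarrow> real \<Rightarrow> real \<Rightarrow> real" where
  "arc_y b Q t = Q * t - 3 * b * t\<^sup>2 + 2 * b * t ^ 3"
definition arc_z :: "real \<Rightarrow> real \<Rightarrow> real \<Rightarrow> real \<Rightarrow> real \<Rightarrow> real" where
  "arc_z a b P Q t = P * Q * t\<^sup>2 / 2 - 2 * P * b * t ^ 3 + 3 / 2 * P * b * t ^ 4
      - a * Q * t ^ 3 / 3 + 3 / 2 * a * b * t ^ 4 - 6 / 5 * a * b * t ^ 5"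

lemma arc_derivatives:
  "(arc_x a P has_real_derivative P - 2 * a * t) (at t within S)"
  "(arc_y b Q has_real_derivative Q - 6 * b * t + 6 * b * t\<^sup>2) (at t within S)"
  "(arc_z a b P Q has_real_derivative arc_x a P t * (Q - 6 * b * t + 6 * b * t\<^sup>2)) (at t within S)"
  unfolding arc_x_def[abs_def] arc_y_def[abs_def] arc_z_def[abs_def]
  by (rule derivative_eq_intros refl | simp add: field_simps power2_eq_square power3_eq_cube power4_eq_xxxx eval_nat_numeral)+

lemma arc_increments:
  assumes H: "0 \<le> H" "\<bar>P\<bar> + 2 * \<bar>a\<bar> \<le> H" "\<bar>Q\<bar> + 12 * \<bar>b\<bar> \<le> H"
    and st: "0 \<le> s" "s \<le> t" "t \<le> 1"
  shows "\<bar>arc_x a P t - arc_x a P s\<bar> \<le> H * (t - s)"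
    "\<bar>arc_y b Q t - arc_y b Q s\<bar> \<le> H * (t - s)"
    "\<bar>arc_z a b P Q t - arc_z a b P Q s - arc_x a P s * (arc_y b Q t - arc_y b Q s)\<bar> \<le> H\<^sup>2 * (t - s)"
proof -
  let ?I = "{s..t}"
  have dx: "\<bar>P - 2 * a * r\<bar> \<le> H" if "r \<in> ?I" for r
  proof -
    have "\<bar>a * r\<bar> \<le> \<bar>a\<bar>" unfolding abs_mult using that st by (intro mult_left_le) auto
    then show ?thesis using H(2) by linarith
  qed
  have dy: "\<bar>Q - 6 * b * r + 6 * b * r\<^sup>2\<bar> \<le> H" if "r \<in> ?I" for r
  proof -
    have "\<bar>b * r\<bar> \<le> \<bar>b\<bar>" "\<bar>b * r\<^sup>2\<bar> \<le> \<bar>b\<bar>"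
      unfolding abs_mult using that st by (auto intro!: mult_left_le simp: power_le_one)
    then show ?thesis using H(3) by linarith
  qed
  have bnd: "\<bar>f t - f s\<bar> \<le> B * (t - s)"
    if "\<And>r. r \<in> ?I \<Longrightarrow> (f has_real_derivative f' r) (at r within ?I)" "\<And>r. r \<in> ?I \<Longrightarrow> \<bar>f' r\<bar> \<le> B"
    for f f' :: "real \<Rightarrow> real" and B
    using field_differentiable_bound[of ?I f f' B t s] that st by simp
  show X: "\<bar>arc_x a P t - arc_x a P s\<bar> \<le> H * (t - s)"
    by (rule bnd[OF arc_derivatives(1) dx])
  show "\<bar>arc_y b Q t - arc_y b Q s\<bar> \<le> H * (t - s)"
    by (rule bnd[OF arc_derivatives(2) dy])
  have Xr: "\<bar>arc_x a P r - arc_x a P s\<bar> \<le> H" if "r \<in> ?I" for r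
  proof -
    have "\<bar>arc_x a P r - arc_x a P s\<bar> \<le> H * (r - s)"
      using field_differentiable_bound[of ?I "arc_x a P" "\<lambda>r. P - 2 * a * r" H r s] arc_derivatives(1) dx that st
      by auto
    also have "\<dots> \<le> H" using that st H(1) by (intro mult_left_le) auto
    finally show ?thesis .
  qed
  have "\<bar>(arc_z a b P Q t - arc_x a P s * arc_y b Q t) - (arc_z a b P Q s - arc_x a P s * arc_y b Q s)\<bar> \<le> H\<^sup>2 * (t - s)"
  proof (rule bnd)
    fix r assume r: "r \<in> ?I"
    show "((\<lambda>r. arc_z a b P Q r - arc_x a P s * arc_y b Q r) has_real_derivative
      (arc_x a P r - arc_x a P s) * (Q - 6 * b * r + 6 * b * r\<^sup>2)) (at r within ?I)"
      by (auto intro!: derivative_eq_intros arc_derivatives simp: algebra_simps)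
    show "\<bar>(arc_x a P r - arc_x a P s) * (Q - 6 * b * r + 6 * b * r\<^sup>2)\<bar> \<le> H\<^sup>2"
      unfolding abs_mult power2_eq_square[of H] using Xr[OF r] dy[OF r] H(1) by (intro mult_mono) auto
  qed
  then show "\<bar>arc_z a b P Q t - arc_z a b P Q s - arc_x a P s * (arc_y b Q t - arc_y b Q s)\<bar> \<le> H\<^sup>2 * (t - s)"
    by (simp add: algebra_simps)
qed

text \<open>
  With \<open>P = x + a\<close> and \<open>Q = y + b\<close> the arc ends at horizontal coordinates \<open>(x, y)\<close> for all \<open>a\<close> and
  \<open>b\<close>, and its final height is \<open>x y / 2 + a y / 6 - a b / 30\<close>.  Putting \<open>b = 5 y \<pm> a\<close> reduces the
  last two terms to \<open>\<mp> a\<^sup>2 / 30\<close>, so that \<open>a\<close> is found by a square root, which is where the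
  homogeneous norm enters.
\<close>
lemma arc_through:
  fixes u :: heis
  obtains a b P Q where "P = xc u + a" "Q = yc u + b"
    "arc_x a P 1 = xc u" "arc_y b Q 1 = yc u" "arc_z a b P Q 1 = zc u"
    "\<bar>P\<bar> + 2 * \<bar>a\<bar> \<le> 200 * hom_norm u" "\<bar>Q\<bar> + 12 * \<bar>b\<bar> \<le> 200 * hom_norm u"
proof -
  define n where "n = hom_norm u"
  note n = hom_norm_bounds[of u, folded n_def] hom_norm_nonneg[of u, folded n_def]
  \<comment> \<open>the height that the arc has to lose against the straight one\<close>
  define \<eta> where "\<eta> = xc u * yc u / 2 - zc u"
  define a where "a = sqrt (30 * \<bar>\<eta>\<bar>)"
  define b where "b = sgn \<eta> * a + 5 * yc u"
  have "\<bar>xc u * yc u\<bar> \<le> n * n" unfolding abs_mult using n by (intro mult_mono) auto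
  then have "\<bar>\<eta>\<bar> \<le> 2 * n\<^sup>2" using n(3) by (simp add: \<eta>_def power2_eq_square)
  then have "30 * \<bar>\<eta>\<bar> \<le> (8 * n)\<^sup>2" by (simp add: power_mult_distrib)
  then have a: "\<bar>a\<bar> \<le> 8 * n" using n(4) by (simp add: a_def real_le_lsqrt)
  have "\<bar>sgn \<eta> * a\<bar> \<le> \<bar>a\<bar>" by (simp add: sgn_if)
  then have b: "\<bar>b\<bar> \<le> 13 * n" using a n(2) by (simp add: b_def)
  have aa: "a * a = 30 * \<bar>\<eta>\<bar>" by (simp add: a_def)
  have "a * (b - 5 * yc u) = sgn \<eta> * (a * a)" by (simp add: b_def)
  also have "\<dots> = 30 * \<eta>" unfolding aa by (simp add: sgn_if)
  finally have ab: "a * b = 30 * \<eta> + 5 * a * yc u" by (simp add: algebra_simps)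
  have z: "arc_z a b (xc u + a) (yc u + b) 1 = zc u"
  proof -
    have "arc_z a b (xc u + a) (yc u + b) 1 = xc u * yc u / 2 + a * yc u / 6 - (a * b) / 30"
      by (simp add: arc_z_def field_simps)
    also have "\<dots> = zc u" unfolding ab by (simp add: \<eta>_def field_simps)
    finally show ?thesis .
  qed
  show thesis
    by (rule that[of "xc u + a" a "yc u + b" b])
       (use z a b n in \<open>auto simp: arc_x_def arc_y_def simp flip: n_def\<close>)
qed

context riemannian
begin

text \<open>
  The bound on the norm is needed since the arc is compared with the Riemannian metric by a
  straight-line estimate, whose vertical error is quadratic in the size of the arc.
\<close>
lemma carnot_dist_le:
  assumes "0 \<le> N0"
  obtains C where "0 < C" "\<And>p q. hom_norm (incr p q) \<le> N0 \<Longrightarrow> carnot_dist G p q \<le> C * hom_norm (incr p q)"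
proof -
  obtain C where C: "0 < C" "\<And>p q. riemannian_dist G p q \<le> C * (norm (incr p q) + \<bar>xc q - xc p\<bar> * \<bar>yc q - yc p\<bar>)"
    by (rule riemannian_dist_le) blast
  have "carnot_dist G p q \<le> (C * 200 * (2 + 400 * N0)) * hom_norm (incr p q)"
    if N: "hom_norm (incr p q) \<le> N0" for p q
  proof -
    define u where "u = incr p q"
    define H where "H = 200 * hom_norm u"
    obtain a b P Q where PQ: "P = xc u + a" "Q = yc u + b"
      "arc_x a P 1 = xc u" "arc_y b Q 1 = yc u" "arc_z a b P Q 1 = zc u"
      "\<bar>P\<bar> + 2 * \<bar>a\<bar> \<le> H" "\<bar>Q\<bar> + 12 * \<bar>b\<bar> \<le> H"
      using arc_through[of u] unfolding H_def by metis
    have H0: "0 \<le> H" by (simp add: H_def)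
    define \<gamma> where "\<gamma> t = p \<odot> (arc_x a P t, arc_y b Q t, arc_z a b P Q t)" for t
    define K where "K = C * (2 * H + 2 * H\<^sup>2)"
    have K0: "0 \<le> K" using C(1) H0 by (simp add: K_def)
    have lip: "riemannian_dist G (\<gamma> s) (\<gamma> t) \<le> K * (t - s)" if st: "0 \<le> s" "s \<le> t" "t \<le> 1" for s t
    proof -
      note i = arc_increments[OF H0 PQ(6,7) st]
      have inc: "incr (\<gamma> s) (\<gamma> t) = (arc_x a P t - arc_x a P s, arc_y b Q t - arc_y b Q s,
          arc_z a b P Q t - arc_z a b P Q s - arc_x a P s * (arc_y b Q t - arc_y b Q s))"
        unfolding \<gamma>_def incr_left_invariant by (simp add: incr_def)
      have n: "norm (incr (\<gamma> s) (\<gamma> t)) \<le> H * (t - s) + H * (t - s) + H\<^sup>2 * (t - s)"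
        using norm_heis_le[of "incr (\<gamma> s) (\<gamma> t)"] i unfolding inc by simp
      have "\<bar>arc_x a P t - arc_x a P s\<bar> * \<bar>arc_y b Q t - arc_y b Q s\<bar> \<le> (H * (t - s)) * (H * (t - s))"
        using i H0 st by (intro mult_mono) auto
      also have "\<dots> = H\<^sup>2 * ((t - s) * (t - s))" by (simp add: power2_eq_square)
      also have "\<dots> \<le> H\<^sup>2 * (t - s)"
        using st by (intro mult_left_mono mult_left_le) auto
      finally have "norm (incr (\<gamma> s) (\<gamma> t)) + \<bar>xc (\<gamma> t) - xc (\<gamma> s)\<bar> * \<bar>yc (\<gamma> t) - yc (\<gamma> s)\<bar> \<le> (2 * H + 2 * H\<^sup>2) * (t - s)"
        using n by (simp add: \<gamma>_def algebra_simps)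
      then have "C * (norm (incr (\<gamma> s) (\<gamma> t)) + \<bar>xc (\<gamma> t) - xc (\<gamma> s)\<bar> * \<bar>yc (\<gamma> t) - yc (\<gamma> s)\<bar>) \<le> K * (t - s)"
        unfolding K_def mult.assoc using C(1) by (intro mult_left_mono) auto
      then show ?thesis using C(2)[of "\<gamma> s" "\<gamma> t"] by linarith
    qed
    have hor: "horizontal_curve G \<gamma>"
      unfolding horizontal_curve_def
    proof (intro conjI AE_I2)
      show "abs_continuous_curve (riemannian_dist G) \<gamma>"
        by (rule abs_continuous_curve_lipschitz[where d = "riemannian_dist G" and \<gamma> = \<gamma>, OF K0 lip])
      fix t :: real
      let ?x' = "P - 2 * a * t" and ?y' = "Q - 6 * b * t + 6 * b * t\<^sup>2"
      let ?v = "?x' *\<^sub>R X_field (\<gamma> t) + ?y' *\<^sub>R Y_field (\<gamma> t)"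
      have "?v \<in> span {X_field (\<gamma> t), Y_field (\<gamma> t)}"
        by (intro span_add span_scale span_base) auto
      moreover have "(\<gamma> has_vector_derivative ?v) (at t within {0..1})"
      proof -
        have g: "\<gamma> = (\<lambda>t. (xc p + arc_x a P t, yc p + arc_y b Q t, zc p + arc_z a b P Q t + xc p * arc_y b Q t))"
          unfolding \<gamma>_def by (intro ext heis_eqI) simp_all
        have "(\<gamma> has_vector_derivative (?x', ?y', arc_x a P t * ?y' + xc p * ?y')) (at t within {0..1})"
          unfolding g
          by (intro has_vector_derivative_Pair has_real_derivative_iff_has_vector_derivative[THEN iffD1])
             (auto intro!: derivative_eq_intros arc_derivatives simp: algebra_simps)
        moreover have "?v = (?x', ?y', arc_x a P t * ?y' + xc p * ?y')"
          by (simp add: X_field_def Y_field_def \<gamma>_def algebra_simps)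
        ultimately show ?thesis by simp
      qed
      ultimately show "\<exists>v\<in>span {X_field (\<gamma> t), Y_field (\<gamma> t)}. (\<gamma> has_vector_derivative v) (at t within {0..1})"
        by blast
    qed
    have "pathstart \<gamma> = p"
      by (simp add: pathstart_def \<gamma>_def arc_x_def arc_y_def arc_z_def flip: zero_prod_def)
    moreover have "pathfinish \<gamma> = q"
    proof -
      have "pathfinish \<gamma> = p \<odot> u" unfolding pathfinish_def \<gamma>_def PQ(3-5) by simp
      then show ?thesis by (simp add: u_def)
    qed
    ultimately have "(INF \<gamma> \<in> {\<gamma>. horizontal_curve G \<gamma> \<and> pathstart \<gamma> = p \<and> pathfinish \<gamma> = q}.
                 curve_length (riemannian_dist G) \<gamma>) \<le> curve_length (riemannian_dist G) \<gamma>"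
      using hor by (intro INF_lower) auto
    also have "\<dots> \<le> ennreal K" by (rule curve_length_lipschitz[where d = "riemannian_dist G" and \<gamma> = \<gamma>, OF lip])
    finally have "carnot_dist G p q \<le> K"
      unfolding carnot_dist_def by (rule enn2real_leI[OF K0])
    also have "K = C * H * (2 + 2 * H)" by (simp add: K_def power2_eq_square algebra_simps)
    also have "\<dots> \<le> C * H * (2 + 400 * N0)"
      using N C(1) H0 by (intro mult_left_mono) (auto simp: H_def u_def)
    finally show ?thesis by (simp add: H_def u_def algebra_simps)
  qed
  moreover have "0 < C * 200 * (2 + 400 * N0)" using C(1) assms by (simp add: add_pos_nonneg)
  ultimately show thesis using that by blast
qed

end

section \<open>A cutoff whose squared integer translates sum to one\<close>

text \<open>
  Cutting off \<open>sin (\<pi>/2 \<sqdot> cos\<^sup>2 (\<pi> t / 2))\<close> at \<open>\<bar>t\<bar> = 1\<close>, where it has a double zero, keeps a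
  Lipschitz derivative, and translation by one turns the outer sine into a cosine because
  \<open>cos\<^sup>2\<close> becomes \<open>sin\<^sup>2\<close>.
\<close>

definition bump :: "real \<Rightarrow> real" where
  "bump t = (if \<bar>t\<bar> < 1 then sin (pi / 2 * (cos (pi / 2 * t))\<^sup>2) else 0)"

definition bump' :: "real \<Rightarrow> real" where
  "bump' t = (if \<bar>t\<bar> < 1 then - (pi\<^sup>2 / 4) * sin (pi * t) * cos (pi / 2 * (cos (pi / 2 * t))\<^sup>2) else 0)"

lemma bump_outside: "1 \<le> \<bar>t\<bar> \<Longrightarrow> bump t = 0" "1 \<le> \<bar>t\<bar> \<Longrightarrow> bump' t = 0"
  by (simp_all add: bump_def bump'_def)

lemma abs_bump_le: "\<bar>bump t\<bar> \<le> 1"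
  by (simp add: bump_def)

lemma pi_square_quarter: "0 \<le> pi\<^sup>2 / 4" "pi\<^sup>2 / 4 \<le> 4"
proof -
  have "pi\<^sup>2 \<le> 4\<^sup>2" using pi_less_4 pi_gt_zero by (intro power_mono) auto
  then show "0 \<le> pi\<^sup>2 / 4" "pi\<^sup>2 / 4 \<le> 4" by simp_all
qed

lemma abs_bump'_le: "\<bar>bump' t\<bar> \<le> 4"
proof -
  have "\<bar>sin (pi * t)\<bar> * \<bar>cos (pi / 2 * (cos (pi / 2 * t))\<^sup>2)\<bar> \<le> 1 * 1"
    by (intro mult_mono) auto
  then have "pi\<^sup>2 / 4 * (\<bar>sin (pi * t)\<bar> * \<bar>cos (pi / 2 * (cos (pi / 2 * t))\<^sup>2)\<bar>) \<le> 4 * 1"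
    using pi_square_quarter by (intro mult_mono) auto
  then show ?thesis by (simp add: bump'_def abs_mult)
qed

lemma taylor_of_lipschitz_derivative:
  fixes f f' :: "real \<Rightarrow> real"
  assumes der: "\<And>t. (f has_real_derivative f' t) (at t)"
    and lip: "\<And>s t. \<bar>f' s - f' t\<bar> \<le> L * \<bar>s - t\<bar>"
  shows "\<bar>f s - f t - f' t * (s - t)\<bar> \<le> L * (s - t)\<^sup>2"
proof -
  have L: "0 \<le> L" using lip[of 1 0] by simp
  let ?g = "\<lambda>x. f x - f' t * x"
  have "norm (?g s - ?g t) \<le> (L * \<bar>s - t\<bar>) * norm (s - t)"
  proof (rule field_differentiable_bound[where S = "closed_segment s t" and f' = "\<lambda>x. f' x - f' t"])
    fix z assume z: "z \<in> closed_segment s t"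
    show "(?g has_field_derivative f' z - f' t) (at z within closed_segment s t)"
      by (auto intro!: derivative_eq_intros DERIV_subset[OF der])
    have "\<bar>z - t\<bar> \<le> \<bar>s - t\<bar>" using z by (auto simp: closed_segment_eq_real_ivl split: if_splits)
    then show "norm (f' z - f' t) \<le> L * \<bar>s - t\<bar>"
      using lip[of z t] mult_left_mono[OF _ L] by (smt (verit) real_norm_def)
  qed auto
  moreover have "?g s - ?g t = f s - f t - f' t * (s - t)" by (simp add: algebra_simps)
  moreover have "(L * \<bar>s - t\<bar>) * norm (s - t) = L * (s - t)\<^sup>2"
    by (simp add: power2_eq_square mult.assoc)
  ultimately show ?thesis by (simp only: real_norm_def)
qed

text \<open>
  The truncated function is \<open>f \<circ> cl\<close> with \<open>f\<close> smooth and \<open>cl\<close> the clamping to \<open>[-1, 1]\<close>.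
  Clamping is not differentiable at \<open>\<plusminus>1\<close>, but \<open>f'\<close> vanishes there, so the part of the step
  that is clamped away is also weighted by a derivative of order \<open>\<bar>h\<bar>\<close>.
\<close>
lemma bump_taylor: "\<bar>bump (t + h) - bump t - bump' t * h\<bar> \<le> 64 * h\<^sup>2"
proof -
  define f where "f t = sin (pi / 2 * (cos (pi / 2 * t))\<^sup>2)" for t :: real
  define f' where "f' t = - (pi\<^sup>2 / 4) * sin (pi * t) * cos (pi / 2 * (cos (pi / 2 * t))\<^sup>2)" for t :: real
  have s2: "sin (pi * t) = 2 * sin (pi / 2 * t) * cos (pi / 2 * t)" for t :: real
    using sin_double[of "pi / 2 * t"] by simp
  have der: "(f has_real_derivative f' t) (at t)" for t
    unfolding f_def[abs_def] f'_def s2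
    by (auto intro!: derivative_eq_intros simp: power2_eq_square field_simps)
  define f'' where "f'' t = - (pi\<^sup>2 / 4) * (pi * cos (pi * t) * cos (pi / 2 * (cos (pi / 2 * t))\<^sup>2)
      + pi\<^sup>2 / 4 * (sin (pi * t))\<^sup>2 * sin (pi / 2 * (cos (pi / 2 * t))\<^sup>2))" for t
  have der2: "(f' has_real_derivative f'' t) (at t)" for t
    unfolding f'_def[abs_def] f''_def
    by (auto intro!: derivative_eq_intros simp: s2 power2_eq_square field_simps)
  have bd2: "\<bar>f'' t\<bar> \<le> 32" for t
  proof -
    have "\<bar>pi * cos (pi * t) * cos (pi / 2 * (cos (pi / 2 * t))\<^sup>2)\<bar> \<le> 4 * 1 * 1"
      unfolding abs_mult using pi_less_4 by (intro mult_mono) auto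
    moreover have "\<bar>pi\<^sup>2 / 4 * (sin (pi * t))\<^sup>2 * sin (pi / 2 * (cos (pi / 2 * t))\<^sup>2)\<bar> \<le> 4 * 1 * 1"
      unfolding abs_mult using pi_square_quarter by (intro mult_mono) (auto simp: abs_square_le_1)
    ultimately have "\<bar>pi * cos (pi * t) * cos (pi / 2 * (cos (pi / 2 * t))\<^sup>2)
      + pi\<^sup>2 / 4 * (sin (pi * t))\<^sup>2 * sin (pi / 2 * (cos (pi / 2 * t))\<^sup>2)\<bar> \<le> 8" by linarith
    then have "pi\<^sup>2 / 4 * \<bar>pi * cos (pi * t) * cos (pi / 2 * (cos (pi / 2 * t))\<^sup>2)
      + pi\<^sup>2 / 4 * (sin (pi * t))\<^sup>2 * sin (pi / 2 * (cos (pi / 2 * t))\<^sup>2)\<bar> \<le> 4 * 8"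
      using pi_square_quarter by (intro mult_mono) auto
    then show ?thesis by (simp add: f''_def abs_mult)
  qed
  have lip: "\<bar>f' s - f' t\<bar> \<le> 32 * \<bar>s - t\<bar>" for s t
    using field_differentiable_bound[of UNIV f' f'' 32 s t] der2 bd2 by simp
  note ty = taylor_of_lipschitz_derivative[OF der lip]
  define cl where "cl t = max (-1) (min 1 t)" for t :: real
  have end0: "f 1 = 0" "f (-1) = 0" "f' 1 = 0" "f' (-1) = 0" by (simp_all add: f_def f'_def)
  have cl: "bump t = f (cl t)" "bump' t = f' (cl t)" for t
    using end0 by (auto simp: bump_def bump'_def f_def f'_def cl_def max_def min_def abs_if)
  let ?s = "cl t" and ?r = "cl (t + h)"
  have d: "\<bar>?r - ?s\<bar> \<le> \<bar>h\<bar>" "\<bar>h - (?r - ?s)\<bar> \<le> \<bar>h\<bar>" by (auto simp: cl_def)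
  have "(?r - ?s)\<^sup>2 \<le> h\<^sup>2" using d(1) by (simp add: abs_le_square_iff)
  then have 1: "\<bar>f ?r - f ?s - f' ?s * (?r - ?s)\<bar> \<le> 32 * h\<^sup>2" using ty[of ?r ?s] by linarith
  have "\<bar>f' ?s * (h - (?r - ?s))\<bar> \<le> 32 * h\<^sup>2"
  proof -
    consider "1 \<le> \<bar>t\<bar>" | "\<bar>t\<bar> < 1" "\<bar>t + h\<bar> < 1" | "\<bar>t\<bar> < 1" "1 \<le> \<bar>t + h\<bar>" by linarith
    then show ?thesis
    proof cases
      case 1
      then have "f' ?s = 0" using cl(2)[of t] bump_outside(2)[of t] by simp
      then show ?thesis by simp
    next
      case 2
      then have "h - (?r - ?s) = 0" by (auto simp: cl_def)
      then show ?thesis by simp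
    next
      case 3
      then have "f' ?r = 0" using cl(2)[of "t + h"] bump_outside(2)[of "t + h"] by simp
      then have "\<bar>f' ?s\<bar> \<le> 32 * \<bar>?r - ?s\<bar>" using lip[of ?r ?s] by simp
      also have "\<dots> \<le> 32 * \<bar>h\<bar>" using d(1) by simp
      finally have "\<bar>f' ?s\<bar> * \<bar>h - (?r - ?s)\<bar> \<le> (32 * \<bar>h\<bar>) * \<bar>h\<bar>" using d(2) by (intro mult_mono) auto
      then show ?thesis by (simp add: abs_mult power2_eq_square)
    qed
  qed
  moreover have "bump (t + h) - bump t - bump' t * h = (f ?r - f ?s - f' ?s * (?r - ?s)) - f' ?s * (h - (?r - ?s))"
    by (simp add: cl algebra_simps)
  ultimately show ?thesis using 1 by linarith
qed

text \<open>
  Only the translates by \<open>0\<close> and \<open>1\<close> of the fractional part contribute.  The two extra terms of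
  the range leave room for moving \<open>t\<close> a little without changing the range.
\<close>
lemma bump_partition: "(\<Sum>l\<in>{-1..2::int}. (bump (t - of_int (\<lfloor>t\<rfloor> + l)))\<^sup>2) = 1"
proof -
  define f where "f = t - of_int \<lfloor>t\<rfloor>"
  have f: "0 \<le> f" "f < 1" by (auto simp: f_def) linarith
  have "{-1..2::int} = {-1, 0, 1, 2}" by auto
  then have sum: "(\<Sum>l\<in>{-1..2::int}. (bump (t - of_int (\<lfloor>t\<rfloor> + l)))\<^sup>2)
      = (bump (f + 1))\<^sup>2 + (bump f)\<^sup>2 + (bump (f - 1))\<^sup>2 + (bump (f - 2))\<^sup>2"
    by (simp add: f_def algebra_simps)
  have out: "bump (f + 1) = 0" "bump (f - 2) = 0" using f by (auto intro!: bump_outside)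
  have b0: "bump f = sin (pi / 2 * (cos (pi / 2 * f))\<^sup>2)" using f by (simp add: bump_def)
  have b1: "bump (f - 1) = cos (pi / 2 * (cos (pi / 2 * f))\<^sup>2)"
  proof (cases "f = 0")
    case False
    have "cos (pi / 2 * (f - 1)) = sin (pi / 2 * f)"
      by (simp add: right_diff_distrib cos_diff)
    then have "bump (f - 1) = sin (pi / 2 * (sin (pi / 2 * f))\<^sup>2)" using f False by (simp add: bump_def)
    also have "pi / 2 * (sin (pi / 2 * f))\<^sup>2 = pi / 2 - pi / 2 * (cos (pi / 2 * f))\<^sup>2"
      by (simp add: sin_squared_eq right_diff_distrib)
    finally show ?thesis by (simp add: sin_diff)
  qed (simp add: bump_def)
  show ?thesis unfolding sum out b0 b1 by simp
qed

lemma sin_taylor: "\<bar>sin (t + h) - sin t - cos t * h\<bar> \<le> h\<^sup>2" for t h :: real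
proof -
  have "\<bar>cos x - cos y\<bar> \<le> 1 * \<bar>x - y\<bar>" for x y :: real
    using field_differentiable_bound[of UNIV cos "\<lambda>x. - sin x" 1 x y] by simp
  from taylor_of_lipschitz_derivative[OF DERIV_sin this, of "t + h" t] show ?thesis by simp
qed

lemma cos_taylor: "\<bar>cos (t + h) - cos t - (- sin t) * h\<bar> \<le> h\<^sup>2" for t h :: real
proof -
  have "\<bar>(- sin x) - (- sin y)\<bar> \<le> 1 * \<bar>x - y\<bar>" for x y :: real
    using field_differentiable_bound[of UNIV sin cos 1 y x] by (simp add: abs_minus_commute)
  from taylor_of_lipschitz_derivative[OF DERIV_cos this, of "t + h" t] show ?thesis by simp
qed

section \<open>First-order jets at a fixed frequency\<close>

text \<open>
  \<open>R\<close> is the highest frequency that occurs in a stage and \<open>\<delta>\<close> the range in which linear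
  approximations are tested.  As \<open>R \<delta>\<close> is small, quadratic remainders are dominated by linear terms.
\<close>

locale jet_scale =
  fixes R \<delta> :: real
  assumes R_pos: "0 < R" and \<delta>_pos: "0 < \<delta>" and R\<delta>: "8 * (R * \<delta>) \<le> 1"
begin

text \<open>
  \<open>jet p f g K\<close> says that \<open>f\<close> has size \<open>K\<close> and frequency \<open>R\<close> near \<open>p\<close>, with differential \<open>g\<close> in
  left-invariant coordinates.  Asking for a quadratic remainder instead of second derivatives turns
  the calculus of all later estimates into algebra.
\<close>
definition jet :: "heis \<Rightarrow> (heis \<Rightarrow> real) \<Rightarrow> heis \<Rightarrow> real \<Rightarrow> bool" where
  "jet p f g K \<longleftrightarrow> \<bar>f p\<bar> \<le> K \<and> norm g \<le> K * R \<and>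
     (\<forall>u. norm u \<le> \<delta> \<longrightarrow> \<bar>f (p \<odot> u) - f p - g \<bullet> u\<bar> \<le> K * R\<^sup>2 * (norm u)\<^sup>2)"

lemma jetD:
  assumes "jet p f g K"
  shows "\<bar>f p\<bar> \<le> K" "norm g \<le> K * R" "norm u \<le> \<delta> \<Longrightarrow> \<bar>f (p \<odot> u) - f p - g \<bullet> u\<bar> \<le> K * R\<^sup>2 * (norm u)\<^sup>2" "0 \<le> K"
  using assms by (auto simp: jet_def)

lemma jet_mono: "jet p f g K \<Longrightarrow> K \<le> K' \<Longrightarrow> jet p f g K'"
  unfolding jet_def using R_pos
  by (smt (verit) mult_right_mono zero_le_power2)

lemma jet_cong:
  assumes "jet p f g K" and eq: "\<And>u. norm u \<le> \<delta> \<Longrightarrow> f' (p \<odot> u) = f (p \<odot> u)"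
  shows "jet p f' g K"
proof -
  have "f' p = f p" using eq[of 0] \<delta>_pos by simp
  then show ?thesis using assms(1) eq by (simp add: jet_def)
qed

lemma jet_increment:
  assumes "jet p f g K" "norm u \<le> \<delta>"
  shows "\<bar>f (p \<odot> u) - f p\<bar> \<le> 2 * K * R * norm u"
proof -
  note j = jetD[OF assms(1)]
  have "\<bar>g \<bullet> u\<bar> \<le> norm g * norm u" by (rule Cauchy_Schwarz_ineq2)
  also have "\<dots> \<le> K * R * norm u" by (intro mult_right_mono j) auto
  finally have 1: "\<bar>g \<bullet> u\<bar> \<le> K * R * norm u" .
  have "R * norm u \<le> R * \<delta>" using assms(2) R_pos by simp
  then have "R * norm u \<le> 1" using R\<delta> by simp
  then have "(K * R * norm u) * (R * norm u) \<le> (K * R * norm u) * 1"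
    using j(4) R_pos by (intro mult_left_mono) auto
  then have "K * R\<^sup>2 * (norm u)\<^sup>2 \<le> K * R * norm u" by (simp add: power2_eq_square algebra_simps)
  then show ?thesis using 1 j(3)[OF assms(2)] by linarith
qed

lemma jet_add:
  assumes "jet p f g K" "jet p f' g' K'"
  shows "jet p (\<lambda>x. f x + f' x) (g + g') (K + K')"
  unfolding jet_def
proof (intro conjI allI impI)
  note j = jetD[OF assms(1)] and j' = jetD[OF assms(2)]
  show "\<bar>f p + f' p\<bar> \<le> K + K'" using j(1) j'(1) by linarith
  show "norm (g + g') \<le> (K + K') * R"
    using norm_triangle_ineq[of g g'] j(2) j'(2) by (simp add: algebra_simps)
  fix u :: heis assume u: "norm u \<le> \<delta>"
  have "f (p \<odot> u) + f' (p \<odot> u) - (f p + f' p) - (g + g') \<bullet> u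
      = (f (p \<odot> u) - f p - g \<bullet> u) + (f' (p \<odot> u) - f' p - g' \<bullet> u)" by (simp add: inner_add_left)
  then show "\<bar>f (p \<odot> u) + f' (p \<odot> u) - (f p + f' p) - (g + g') \<bullet> u\<bar> \<le> (K + K') * R\<^sup>2 * (norm u)\<^sup>2"
    using j(3)[OF u] j'(3)[OF u] by (simp add: distrib_right)
qed

lemma jet_zero: "jet p (\<lambda>x. 0) 0 0"
  by (simp add: jet_def)

lemma jet_sum:
  fixes K :: real
  assumes "finite S" "\<And>c. c \<in> S \<Longrightarrow> jet p (f c) (g c) K"
  shows "jet p (\<lambda>x. \<Sum>c\<in>S. f c x) (\<Sum>c\<in>S. g c) (card S * K)"
  using assms
proof (induction S rule: finite_induct)
  case (insert a S)
  then have "jet p (\<lambda>x. f a x + (\<Sum>c\<in>S. f c x)) (g a + (\<Sum>c\<in>S. g c)) (K + card S * K)"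
    by (intro jet_add) auto
  then show ?case using insert by (simp add: algebra_simps)
qed (simp add: jet_zero)

lemma jet_cmult:
  assumes "jet p f g K"
  shows "jet p (\<lambda>x. a * f x) (a *\<^sub>R g) (\<bar>a\<bar> * K)"
  unfolding jet_def
proof (intro conjI allI impI)
  note j = jetD[OF assms]
  show "\<bar>a * f p\<bar> \<le> \<bar>a\<bar> * K" using j(1) by (simp add: abs_mult mult_left_mono)
  show "norm (a *\<^sub>R g) \<le> \<bar>a\<bar> * K * R" using j(2) by (simp add: mult.assoc mult_left_mono)
  fix u :: heis assume u: "norm u \<le> \<delta>"
  have "a * f (p \<odot> u) - a * f p - (a *\<^sub>R g) \<bullet> u = a * (f (p \<odot> u) - f p - g \<bullet> u)"
    by (simp add: algebra_simps)
  then show "\<bar>a * f (p \<odot> u) - a * f p - (a *\<^sub>R g) \<bullet> u\<bar> \<le> \<bar>a\<bar> * K * R\<^sup>2 * (norm u)\<^sup>2"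
    using j(3)[OF u] by (simp add: abs_mult mult.assoc mult_left_mono)
qed

lemma jet_mult:
  assumes "jet p f g K" "jet p f' g' K'"
  shows "jet p (\<lambda>x. f x * f' x) (f' p *\<^sub>R g + f p *\<^sub>R g') (6 * K * K')"
  unfolding jet_def
proof (intro conjI allI impI)
  note j = jetD[OF assms(1)] and j' = jetD[OF assms(2)]
  have KK: "0 \<le> K * K'" using j(4) j'(4) by simp
  have "\<bar>f p * f' p\<bar> \<le> K * K'" unfolding abs_mult using j j' by (intro mult_mono) auto
  then show "\<bar>f p * f' p\<bar> \<le> 6 * K * K'" using KK by linarith
  have "norm (f' p *\<^sub>R g + f p *\<^sub>R g') \<le> \<bar>f' p\<bar> * norm g + \<bar>f p\<bar> * norm g'"
    by (metis norm_triangle_ineq norm_scaleR)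
  also have "\<dots> \<le> K' * (K * R) + K * (K' * R)" using j j' by (intro add_mono mult_mono) auto
  also have "\<dots> = 2 * (K * K' * R)" by simp
  also have "\<dots> \<le> 6 * (K * K' * R)" using KK R_pos by (intro mult_right_mono) auto
  also have "\<dots> = 6 * K * K' * R" by simp
  finally show "norm (f' p *\<^sub>R g + f p *\<^sub>R g') \<le> 6 * K * K' * R" .
  fix u :: heis assume u: "norm u \<le> \<delta>"
  let ?d = "f (p \<odot> u) - f p" and ?d' = "f' (p \<odot> u) - f' p"
  let ?N = "R\<^sup>2 * (norm u)\<^sup>2"
  have "\<bar>?d * ?d'\<bar> \<le> (2 * K * R * norm u) * (2 * K' * R * norm u)"
    unfolding abs_mult using jet_increment[OF assms(1) u] jet_increment[OF assms(2) u] j(4) R_pos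
    by (intro mult_mono) auto
  then have 1: "\<bar>?d * ?d'\<bar> \<le> 4 * (K * K' * ?N)" by (simp add: power2_eq_square algebra_simps)
  have 2: "\<bar>f p * (?d' - g' \<bullet> u)\<bar> \<le> K * (K' * R\<^sup>2 * (norm u)\<^sup>2)"
    unfolding abs_mult using j(1) j'(3)[OF u] j(4) by (intro mult_mono) auto
  have 3: "\<bar>f' p * (?d - g \<bullet> u)\<bar> \<le> K' * (K * R\<^sup>2 * (norm u)\<^sup>2)"
    unfolding abs_mult using j'(1) j(3)[OF u] j'(4) by (intro mult_mono) auto
  have "f (p \<odot> u) * f' (p \<odot> u) - f p * f' p - (f' p *\<^sub>R g + f p *\<^sub>R g') \<bullet> u
      = ?d * ?d' + f p * (?d' - g' \<bullet> u) + f' p * (?d - g \<bullet> u)"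
    by (simp add: inner_add_left algebra_simps)
  then show "\<bar>f (p \<odot> u) * f' (p \<odot> u) - f p * f' p - (f' p *\<^sub>R g + f p *\<^sub>R g') \<bullet> u\<bar> \<le> 6 * K * K' * R\<^sup>2 * (norm u)\<^sup>2"
    using 1 2 3 by (simp add: algebra_simps)
qed

lemma jet_compose:
  assumes \<phi>: "\<bar>\<phi> (l p)\<bar> \<le> K" "\<bar>\<phi>'\<bar> \<le> K" "\<And>h. \<bar>\<phi> (l p + h) - \<phi> (l p) - \<phi>' * h\<bar> \<le> K * h\<^sup>2"
    and l: "\<And>u. norm u \<le> \<delta> \<Longrightarrow> l (p \<odot> u) = l p + g \<bullet> u" and g: "norm g \<le> c * R" and c: "1 \<le> c"
  shows "jet p (\<lambda>x. \<phi> (l x)) (\<phi>' *\<^sub>R g) (K * c\<^sup>2)"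
  unfolding jet_def
proof (intro conjI allI impI)
  have K: "0 \<le> K" using \<phi>(1) by linarith
  have c2: "1 \<le> c\<^sup>2" "c \<le> c\<^sup>2" using c self_le_power[of c 2] by (simp_all add: one_le_power)
  show "\<bar>\<phi> (l p)\<bar> \<le> K * c\<^sup>2" using \<phi>(1) mult_left_mono[OF c2(1) K] by linarith
  have "norm (\<phi>' *\<^sub>R g) \<le> K * (c * R)" using \<phi>(2) g K by (auto intro!: mult_mono)
  also have "\<dots> \<le> K * (c\<^sup>2 * R)" using c2 K R_pos by (intro mult_left_mono mult_right_mono) auto
  finally show "norm (\<phi>' *\<^sub>R g) \<le> K * c\<^sup>2 * R" by (simp add: mult.assoc)
  fix u :: heis assume u: "norm u \<le> \<delta>"
  have "\<bar>g \<bullet> u\<bar> \<le> norm g * norm u" by (rule Cauchy_Schwarz_ineq2)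
  also have "\<dots> \<le> c * R * norm u" using g by (intro mult_right_mono) auto
  finally have "(g \<bullet> u)\<^sup>2 \<le> (c * R * norm u)\<^sup>2" using c R_pos by (intro abs_le_square_iff[THEN iffD1]) auto
  then have "K * (g \<bullet> u)\<^sup>2 \<le> K * (c * R * norm u)\<^sup>2" using K by (rule mult_left_mono)
  then show "\<bar>\<phi> (l (p \<odot> u)) - \<phi> (l p) - (\<phi>' *\<^sub>R g) \<bullet> u\<bar> \<le> K * c\<^sup>2 * R\<^sup>2 * (norm u)\<^sup>2"
    using \<phi>(3)[of "g \<bullet> u"] l[OF u] by (simp add: power_mult_distrib mult.assoc)
qed

end

section \<open>A coloured grid of cells\<close>

lemma heis_inner: "a \<bullet> u = xc a * xc u + yc a * yc u + zc a * zc u" for a u :: heis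
  by (simp add: inner_prod_def)

lemma incr_mult_right: "incr c (p \<odot> u) = incr c p \<odot> u"
  by (rule heis_eqI) (simp_all add: algebra_simps)

text \<open>
  \<open>\<beta> c\<close> is the covector frozen on the cell with centre \<open>c\<close>, \<open>A\<close> the amplitude of the waves and
  \<open>1/m\<close> the size of the cells.  The bound on \<open>\<beta>\<close> says that phases with gradient \<open>2 \<beta> / A\<^sup>2\<close> have
  frequency at most \<open>R\<close>.
\<close>
locale wave_cells = jet_scale R \<delta> for R \<delta> :: real +
  fixes m :: nat and A :: real and \<beta> :: "heis \<Rightarrow> heis"
  assumes m_even: "even m" and m_pos: "0 < m" and m_le: "real m \<le> R" and A_pos: "0 < A"
    and \<beta>_le: "norm (\<beta> c) \<le> A\<^sup>2 * R / 2"
begin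

lemma m_ge: "2 \<le> real m"
proof -
  have "2 \<le> m" using m_even m_pos by (cases m; cases "m - 1") auto
  then show ?thesis by linarith
qed

lemma m\<delta>: "8 * (real m * \<delta>) \<le> 1"
  using mult_right_mono[OF m_le less_imp_le[OF \<delta>_pos]] R\<delta> by linarith

text \<open>
  The third condition is adapted to the group: left translation by a lattice element shifts
  \<open>z - x y\<close> of a centre by an integer and an integer multiple
  of \<open>x\<close>, hence \<open>m (z - x y)\<close> by an integer.  The
  factor \<open>2\<close> makes the shift of the index even, so that parities survive.
\<close>
definition grid :: "heis set" where
  "grid = {c. real m * xc c \<in> \<int> \<and> real m * yc c \<in> \<int> \<and> 2 * real m * (zc c - xc c * yc c) \<in> \<int>}"

definition index_x :: "heis \<Rightarrow> int" where "index_x c = \<lfloor>real m * xc c\<rfloor>"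
definition index_y :: "heis \<Rightarrow> int" where "index_y c = \<lfloor>real m * yc c\<rfloor>"
definition index_z :: "heis \<Rightarrow> int" where "index_z c = \<lfloor>2 * real m * (zc c - xc c * yc c)\<rfloor>"

lemma grid_index:
  assumes "c \<in> grid"
  shows "real m * xc c = index_x c" "real m * yc c = index_y c"
    "2 * real m * (zc c - xc c * yc c) = index_z c"
  using assms by (auto simp: grid_def index_x_def index_y_def index_z_def elim!: Ints_cases)

definition center :: "int \<Rightarrow> int \<Rightarrow> int \<Rightarrow> heis" where
  "center i j k = (i / m, j / m, k / (2 * real m) + (i / m) * (j / m))"

lemma center_grid [simp]: "center i j k \<in> grid"
  using m_pos by (simp add: grid_def center_def)

lemma index_center [simp]: "index_x (center i j k) = i" "index_y (center i j k) = j" "index_z (center i j k) = k"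
  using m_pos by (simp_all add: index_x_def index_y_def index_z_def center_def)

lemma center_index: "c \<in> grid \<Longrightarrow> center (index_x c) (index_y c) (index_z c) = c"
proof -
  assume c: "c \<in> grid"
  have "index_x c / m = xc c" "index_y c / m = yc c" "index_z c / (2 * real m) = zc c - xc c * yc c"
    unfolding grid_index[OF c, symmetric] using m_pos by simp_all
  then show ?thesis by (intro heis_eqI) (simp_all add: center_def)
qed

text \<open>Coordinates of \<open>x\<close> in the cell of \<open>c\<close>, scaled so that the cell is the cube \<open>[-1, 1]\<^sup>3\<close>.\<close>
definition pos_x :: "heis \<Rightarrow> heis \<Rightarrow> real" where "pos_x c x = m * xc (incr c x)"
definition pos_y :: "heis \<Rightarrow> heis \<Rightarrow> real" where "pos_y c x = m * yc (incr c x)"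
definition pos_z :: "heis \<Rightarrow> heis \<Rightarrow> real" where "pos_z c x = 2 * real m * zc (incr c x)"

lemma pos_grid:
  assumes "c \<in> grid"
  shows "pos_x c x = m * xc x - index_x c" "pos_y c x = m * yc x - index_y c"
    "pos_z c x = 2 * real m * (zc x - index_x c / m * yc x) - index_z c"
proof -
  have x: "index_x c / m = xc c" using grid_index(1)[OF assms] m_pos by (simp add: field_simps)
  show "pos_x c x = m * xc x - index_x c" "pos_y c x = m * yc x - index_y c"
    "pos_z c x = 2 * real m * (zc x - index_x c / m * yc x) - index_z c"
    unfolding x using grid_index[OF assms, symmetric]
    by (simp_all add: pos_x_def pos_y_def pos_z_def algebra_simps)
qed

lemma pos_mult:
  "pos_x c (p \<odot> u) = pos_x c p + (real m, 0, 0) \<bullet> u"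
  "pos_y c (p \<odot> u) = pos_y c p + (0, real m, 0) \<bullet> u"
  "pos_z c (p \<odot> u) = pos_z c p + (0, 2 * real m * xc (incr c p), 2 * real m) \<bullet> u"
  unfolding pos_x_def pos_y_def pos_z_def incr_mult_right heis_inner
  by (simp_all add: algebra_simps)

definition active :: "heis \<Rightarrow> heis set" where
  "active x = {c \<in> grid. \<bar>pos_x c x\<bar> < 1 \<and> \<bar>pos_y c x\<bar> < 1 \<and> \<bar>pos_z c x\<bar> < 1}"

text \<open>
  The vertical index depends on the first one, since cells with different \<open>x\<close>-index are sheared
  against each other.
\<close>
definition cell_near :: "heis \<Rightarrow> int \<times> int \<times> int \<Rightarrow> heis" where
  "cell_near p = (\<lambda>(i, j, l). let i' = \<lfloor>m * xc p\<rfloor> + i in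
     center i' (\<lfloor>m * yc p\<rfloor> + j) (\<lfloor>2 * real m * (zc p - i' / m * yc p)\<rfloor> + l))"

definition box :: "(int \<times> int \<times> int) set" where "box = {-1..2} \<times> {-1..2} \<times> {-1..2}"

text \<open>
  A finite set of at most \<open>64\<close> cells that contains every cell active within distance \<open>\<delta>\<close> of \<open>p\<close>.
  Sums over active cells become sums over this set, which stays fixed while the point moves.
\<close>
definition near :: "heis \<Rightarrow> heis set" where "near p = cell_near p ` box"

lemma finite_near [simp]: "finite (near p)"
  by (simp add: near_def box_def)

lemma card_near: "card (near p) \<le> 64"
proof -
  have "card (near p) \<le> card box" unfolding near_def by (rule card_image_le) (simp add: box_def)
  then show ?thesis by (simp add: box_def)
qed

lemma near_grid: "c \<in> near p \<Longrightarrow> c \<in> grid"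
  by (auto simp: near_def cell_near_def Let_def)

lemma pos_cell_near:
  "pos_x (cell_near p (i, j, l)) p = m * xc p - of_int (\<lfloor>m * xc p\<rfloor> + i)"
  "pos_y (cell_near p (i, j, l)) p = m * yc p - of_int (\<lfloor>m * yc p\<rfloor> + j)"
  "pos_z (cell_near p (i, j, l)) p = 2 * real m * (zc p - of_int (\<lfloor>m * xc p\<rfloor> + i) / m * yc p)
      - of_int (\<lfloor>2 * real m * (zc p - of_int (\<lfloor>m * xc p\<rfloor> + i) / m * yc p)\<rfloor> + l)"
  unfolding cell_near_def Let_def prod.case by (subst pos_grid; simp)+

lemma near_pos:
  assumes "c \<in> near p"
  shows "\<bar>pos_x c p\<bar> \<le> 2" "\<bar>pos_y c p\<bar> \<le> 2" "\<bar>pos_z c p\<bar> \<le> 2"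
proof -
  have *: "\<bar>t - of_int (\<lfloor>t\<rfloor> + i)\<bar> \<le> 2" if "i \<in> {-1..2}" for t :: real and i :: int
  proof -
    have "-1 \<le> real_of_int i" "real_of_int i \<le> 2" using that by auto
    then show ?thesis using of_int_floor_le[of t] floor_correct[of t] unfolding of_int_add by linarith
  qed
  show "\<bar>pos_x c p\<bar> \<le> 2" "\<bar>pos_y c p\<bar> \<le> 2" "\<bar>pos_z c p\<bar> \<le> 2"
    using assms unfolding near_def box_def by (auto simp only: pos_cell_near intro!: *)
qed

lemma near_x_offset:
  assumes "c \<in> near p"
  shows "\<bar>xc (incr c p)\<bar> \<le> 2 / m" "\<bar>xc (incr c p)\<bar> \<le> 1"
proof -
  have "m * \<bar>xc (incr c p)\<bar> \<le> 2" using near_pos(1)[OF assms] m_pos by (simp add: pos_x_def abs_mult)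
  then show "\<bar>xc (incr c p)\<bar> \<le> 2 / m" using m_pos by (simp add: field_simps)
  also have "2 / m \<le> 1" using m_ge by simp
  finally show "\<bar>xc (incr c p)\<bar> \<le> 1" .
qed

lemma near_incr_norm:
  assumes "c \<in> near p"
  shows "norm (incr c p) \<le> 5 / m"
proof -
  have "real m * \<bar>xc (incr c p)\<bar> \<le> 2" "real m * \<bar>yc (incr c p)\<bar> \<le> 2" "2 * real m * \<bar>zc (incr c p)\<bar> \<le> 2"
    using near_pos[OF assms] unfolding pos_x_def pos_y_def pos_z_def abs_mult by simp_all
  then have "real m * (\<bar>xc (incr c p)\<bar> + \<bar>yc (incr c p)\<bar> + \<bar>zc (incr c p)\<bar>) \<le> 5"
    unfolding distrib_left by linarith
  moreover have "real m * norm (incr c p) \<le> real m * (\<bar>xc (incr c p)\<bar> + \<bar>yc (incr c p)\<bar> + \<bar>zc (incr c p)\<bar>)"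
    by (intro mult_left_mono norm_heis_le) simp
  ultimately show ?thesis using m_pos by (simp add: field_simps)
qed

lemma active_subset_near:
  assumes "norm u \<le> \<delta>"
  shows "active (p \<odot> u) \<subseteq> near p"
proof
  fix c assume c: "c \<in> active (p \<odot> u)"
  then have cg: "c \<in> grid" by (simp add: active_def)
  have u: "\<bar>m * xc u\<bar> \<le> 1 / 8" "\<bar>m * yc u\<bar> \<le> 1 / 8" "\<bar>m * zc u\<bar> \<le> 1 / 8"
  proof -
    have "m * norm u \<le> 1 / 8" using mult_left_mono[OF assms, of "real m"] m\<delta> by simp
    then show "\<bar>m * xc u\<bar> \<le> 1 / 8" "\<bar>m * yc u\<bar> \<le> 1 / 8" "\<bar>m * zc u\<bar> \<le> 1 / 8"
      unfolding abs_mult using coord_le_norm[of u] m_pos mult_left_mono[of _ "norm u" "real m"]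
      by (smt (verit) abs_of_nat of_nat_0_le_iff)+
  qed
  have px: "\<bar>pos_x c p\<bar> < 9 / 8" and py: "\<bar>pos_y c p\<bar> < 9 / 8"
    using c u unfolding active_def pos_mult heis_inner by auto
  have "m * \<bar>xc (incr c p)\<bar> \<le> 9 / 8" using px m_pos by (simp add: pos_x_def abs_mult)
  moreover have "2 * \<bar>xc (incr c p)\<bar> \<le> m * \<bar>xc (incr c p)\<bar>" using m_ge by (intro mult_right_mono) auto
  ultimately have "\<bar>xc (incr c p)\<bar> \<le> 1" by linarith
  then have "\<bar>xc (incr c p) * (m * yc u)\<bar> \<le> 1 * (1 / 8)" unfolding abs_mult[of "xc (incr c p)"] using u(2) by (intro mult_mono) auto
  moreover have "pos_z c (p \<odot> u) = pos_z c p + 2 * (xc (incr c p) * (m * yc u)) + 2 * (m * zc u)"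
    unfolding pos_mult heis_inner by simp
  ultimately have pz: "\<bar>pos_z c p\<bar> < 3 / 2"
    using c u(3) unfolding active_def by auto
  have *: "n - \<lfloor>t\<rfloor> \<in> {-1..2}" if "\<bar>t - of_int n\<bar> < 3 / 2" for t :: real and n :: int
  proof -
    have "of_int (n - \<lfloor>t\<rfloor>) < (3::real)" "of_int (n - \<lfloor>t\<rfloor>) > (-2::real)"
      using that floor_correct[of t] unfolding of_int_diff by linarith+
    then show ?thesis by auto
  qed
  define i j where "i = index_x c - \<lfloor>m * xc p\<rfloor>" and "j = index_y c - \<lfloor>m * yc p\<rfloor>"
  define l where "l = index_z c - \<lfloor>2 * real m * (zc p - index_x c / m * yc p)\<rfloor>"
  have "c = cell_near p (i, j, l)"
    unfolding cell_near_def Let_def prod.case i_def j_def l_def using center_index[OF cg] by simp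
  moreover have "(i, j, l) \<in> box"
    unfolding box_def i_def j_def l_def using px py pz unfolding pos_grid[OF cg]
    by (intro SigmaI *) auto
  ultimately show "c \<in> near p" unfolding near_def by blast
qed

lemma finite_active [simp]: "finite (active x)"
  by (rule finite_subset[OF _ finite_near[of x]]) (use active_subset_near[of 0 x] \<delta>_pos in simp)

definition color_nat :: "heis \<Rightarrow> int" where
  "color_nat c = 1 + index_x c mod 2 + 2 * (index_y c mod 2) + 4 * (index_z c mod 2)"

definition color :: "heis \<Rightarrow> real" where "color c = of_int (color_nat c)"

lemma color_nat_bounds: "1 \<le> color_nat c" "color_nat c \<le> 8"
  by (simp_all add: color_nat_def)

lemma color_bounds: "1 \<le> color c" "color c \<le> 8"
  using color_nat_bounds[of c] by (simp_all add: color_def)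

lemma color_sq_bounds: "1 \<le> (color c)\<^sup>2" "(color c)\<^sup>2 \<le> 64"
  using color_bounds[of c] power_mono[of "color c" 8 2] by (simp_all add: one_le_power)

text \<open>
  Colours enter frequencies by their squares; distinct ones keep the frequency of a cross term
  away from zero.
\<close>
lemma color_gap:
  assumes "color c \<noteq> color d"
  shows "3 \<le> \<bar>(color c)\<^sup>2 - (color d)\<^sup>2\<bar>"
proof -
  have ne: "color_nat c \<noteq> color_nat d" using assms by (simp add: color_def)
  have "3 * 1 \<le> (color_nat c + color_nat d) * \<bar>color_nat c - color_nat d\<bar>"
    using ne color_nat_bounds[of c] color_nat_bounds[of d] by (intro mult_mono) auto
  then have "3 * 1 \<le> (color c + color d) * \<bar>color c - color d\<bar>"
    unfolding color_def by (metis (mono_tags, opaque_lifting) of_int_abs of_int_add of_int_diff of_int_le_iff of_int_mult of_int_numeral of_int_1)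
  also have "\<dots> = \<bar>(color c)\<^sup>2 - (color d)\<^sup>2\<bar>"
  proof -
    have "(color c)\<^sup>2 - (color d)\<^sup>2 = (color c + color d) * (color c - color d)" by (simp add: power2_eq_square algebra_simps)
    then show ?thesis using color_bounds[of c] color_bounds[of d] by (simp add: abs_mult)
  qed
  finally show ?thesis by simp
qed

text \<open>
  Along each axis a point lies in the interior of at most two consecutive cells, and
  consecutive indices have different parity.
\<close>
lemma same_color_active_eq:
  assumes "c \<in> active x" "d \<in> active x" "color c = color d"
  shows "c = d"
proof -
  have g: "c \<in> grid" "d \<in> grid" using assms by (auto simp: active_def)
  have "color_nat c = color_nat d" using assms(3) by (simp add: color_def)
  then have par: "index_x c mod 2 = index_x d mod 2" "index_y c mod 2 = index_y d mod 2" "index_z c mod 2 = index_z d mod 2"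
  proof -
    have bits: "a = a' \<and> b = b' \<and> d = d'"
      if "a + 2 * b + 4 * d = a' + 2 * b' + 4 * d'" "a \<in> {0, 1}" "b \<in> {0, 1}" "d \<in> {0, 1}"
        "a' \<in> {0, 1}" "b' \<in> {0, 1}" "d' \<in> {0, 1}" for a b d a' b' d' :: int
      using that by auto
    have mod2: "i mod 2 \<in> {0, 1}" for i :: int by auto
    show "index_x c mod 2 = index_x d mod 2" "index_y c mod 2 = index_y d mod 2" "index_z c mod 2 = index_z d mod 2"
      using bits[OF _ mod2 mod2 mod2 mod2 mod2 mod2, of "index_x c" "index_y c" "index_z c" "index_x d" "index_y d" "index_z d"]
        \<open>color_nat c = color_nat d\<close> unfolding color_nat_def by simp_all
  qed
  have *: "i = k" if "\<bar>t - of_int i\<bar> < 1" "\<bar>t - of_int k\<bar> < 1" "i mod 2 = k mod 2" for t :: real and i k :: int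
  proof -
    have "\<bar>real_of_int (i - k)\<bar> < 2" using that(1,2) unfolding of_int_diff by linarith
    then have "\<bar>i - k\<bar> < 2" by linarith
    then show ?thesis using that(3) by presburger
  qed
  have x: "index_x c = index_x d" and y: "index_y c = index_y d"
    using assms(1,2) par unfolding active_def pos_grid[OF g(1)] pos_grid[OF g(2)] by (auto simp: pos_grid g intro: *)
  have "index_z c = index_z d"
    using assms(1,2) par x by (auto simp: active_def pos_grid g intro: *)
  with x y show ?thesis using center_index[OF g(1)] center_index[OF g(2)] by metis
qed

definition cut :: "heis \<Rightarrow> heis \<Rightarrow> real" where
  "cut c x = bump (pos_x c x) * bump (pos_y c x) * bump (pos_z c x)"

definition grad_cut :: "heis \<Rightarrow> heis \<Rightarrow> heis" where
  "grad_cut c p = bump (pos_z c p) *\<^sub>R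
       (bump (pos_y c p) *\<^sub>R (bump' (pos_x c p) *\<^sub>R (real m, 0, 0)) + bump (pos_x c p) *\<^sub>R (bump' (pos_y c p) *\<^sub>R (0, real m, 0)))
     + (bump (pos_x c p) * bump (pos_y c p)) *\<^sub>R (bump' (pos_z c p) *\<^sub>R (0, 2 * real m * xc (incr c p), 2 * real m))"

lemma cut_inactive:
  assumes "c \<in> grid" "c \<notin> active x"
  shows "cut c x = 0" "grad_cut c x = 0"
  using assms by (auto simp: active_def cut_def grad_cut_def bump_outside not_less zero_prod_def)

lemma abs_cut_le: "\<bar>cut c x\<bar> \<le> 1"
proof -
  have "\<bar>bump (pos_x c x)\<bar> * \<bar>bump (pos_y c x)\<bar> * \<bar>bump (pos_z c x)\<bar> \<le> 1 * 1 * 1"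
    by (intro mult_mono abs_bump_le) auto
  then show ?thesis by (simp add: cut_def abs_mult)
qed

lemma norm_pos_z_grad:
  assumes "c \<in> near p"
  shows "norm ((0, 2 * real m * xc (incr c p), 2 * real m) :: heis) \<le> 4 * real m"
proof -
  have "2 * real m * \<bar>xc (incr c p)\<bar> \<le> 2 * real m * 1" using near_x_offset(2)[OF assms] by (intro mult_left_mono) auto
  then show ?thesis using norm_heis_le[of "(0, 2 * real m * xc (incr c p), 2 * real m)"] by (simp add: abs_mult)
qed

lemma norm_grad_cut:
  assumes "c \<in> near p"
  shows "norm (grad_cut c p) \<le> 24 * real m"
proof -
  have n1: "norm ((real m, 0, 0) :: heis) = m" "norm ((0, real m, 0) :: heis) = m"
    by (simp_all add: norm_Pair)
  have t: "norm (a *\<^sub>R (b *\<^sub>R (b' *\<^sub>R x) + d *\<^sub>R (d' *\<^sub>R y)) + f *\<^sub>R (g *\<^sub>R z))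
     \<le> \<bar>a\<bar> * (\<bar>b\<bar> * (\<bar>b'\<bar> * norm x) + \<bar>d\<bar> * (\<bar>d'\<bar> * norm y)) + \<bar>f\<bar> * (\<bar>g\<bar> * norm z)"
    for a b b' d d' f g and x y z :: heis
  proof -
    have "norm (b *\<^sub>R (b' *\<^sub>R x) + d *\<^sub>R (d' *\<^sub>R y)) \<le> \<bar>b\<bar> * (\<bar>b'\<bar> * norm x) + \<bar>d\<bar> * (\<bar>d'\<bar> * norm y)"
      using norm_triangle_ineq[of "b *\<^sub>R (b' *\<^sub>R x)" "d *\<^sub>R (d' *\<^sub>R y)"] by (simp only: norm_scaleR)
    then have "norm (a *\<^sub>R (b *\<^sub>R (b' *\<^sub>R x) + d *\<^sub>R (d' *\<^sub>R y))) \<le> \<bar>a\<bar> * (\<bar>b\<bar> * (\<bar>b'\<bar> * norm x) + \<bar>d\<bar> * (\<bar>d'\<bar> * norm y))"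
      unfolding norm_scaleR[of a] by (rule mult_left_mono) simp
    then show ?thesis
      using norm_triangle_ineq[of "a *\<^sub>R (b *\<^sub>R (b' *\<^sub>R x) + d *\<^sub>R (d' *\<^sub>R y))" "f *\<^sub>R (g *\<^sub>R z)"]
      by (simp only: norm_scaleR)
  qed
  have "norm (grad_cut c p) \<le> \<bar>bump (pos_z c p)\<bar> *
       (\<bar>bump (pos_y c p)\<bar> * (\<bar>bump' (pos_x c p)\<bar> * m) + \<bar>bump (pos_x c p)\<bar> * (\<bar>bump' (pos_y c p)\<bar> * m))
     + (\<bar>bump (pos_x c p)\<bar> * \<bar>bump (pos_y c p)\<bar>) * (\<bar>bump' (pos_z c p)\<bar> * norm ((0, 2 * real m * xc (incr c p), 2 * real m) :: heis))"
    unfolding grad_cut_def abs_mult[symmetric, of "bump (pos_x c p)" "bump (pos_y c p)"] by (rule order_trans[OF t]) (simp only: n1 order_refl)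
  also have "\<dots> \<le> 1 * (1 * (4 * real m) + 1 * (4 * real m)) + (1 * 1) * (4 * (4 * real m))"
    by (intro add_mono mult_mono abs_bump_le abs_bump'_le norm_pos_z_grad[OF assms]) auto
  also have "\<dots> = 24 * real m" by simp
  finally show ?thesis .
qed

lemma jet_cut:
  assumes c: "c \<in> near p"
  shows "jet p (cut c) (grad_cut c p) (4 * 10 ^ 8)"
proof -
  have b: "\<bar>bump t\<bar> \<le> 64" "\<bar>bump' t\<bar> \<le> 64" for t using abs_bump_le[of t] abs_bump'_le[of t] by linarith+
  have x: "jet p (\<lambda>x. bump (pos_x c x)) (bump' (pos_x c p) *\<^sub>R (real m, 0, 0)) (64 * 1\<^sup>2)"
    by (rule jet_compose[where l = "pos_x c"]) (use b bump_taylor pos_mult m_le in \<open>simp_all add: norm_Pair\<close>)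
  have y: "jet p (\<lambda>x. bump (pos_y c x)) (bump' (pos_y c p) *\<^sub>R (0, real m, 0)) (64 * 1\<^sup>2)"
    by (rule jet_compose[where l = "pos_y c"]) (use b bump_taylor pos_mult m_le in \<open>simp_all add: norm_Pair\<close>)
  have z: "jet p (\<lambda>x. bump (pos_z c x)) (bump' (pos_z c p) *\<^sub>R (0, 2 * real m * xc (incr c p), 2 * real m)) (64 * 6\<^sup>2)"
    by (rule jet_compose[where l = "pos_z c"])
       (use b bump_taylor pos_mult m_le R_pos norm_pos_z_grad[OF c] in \<open>simp_all\<close>)
  show ?thesis
    using jet_mult[OF jet_mult[OF x y] z] unfolding cut_def[abs_def] grad_cut_def
    by (rule jet_mono) simp
qed

lemma cut_partition: "(\<Sum>c\<in>near p. (cut c p)\<^sup>2) = 1"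
proof -
  have inj: "inj_on (cell_near p) box"
  proof (rule inj_onI)
    fix a b assume ab: "cell_near p a = cell_near p b"
    obtain i j l where a: "a = (i, j, l)" by (cases a)
    obtain i' j' l' where b: "b = (i', j', l')" by (cases b)
    have "index_x (cell_near p (i, j, l)) = index_x (cell_near p (i', j', l'))"
      "index_y (cell_near p (i, j, l)) = index_y (cell_near p (i', j', l'))"
      "index_z (cell_near p (i, j, l)) = index_z (cell_near p (i', j', l'))"
      using ab unfolding a b by simp_all
    then show "a = b" unfolding a b by (simp add: cell_near_def Let_def)
  qed
  let ?X = "\<lambda>i. bump (m * xc p - of_int (\<lfloor>m * xc p\<rfloor> + i))"
  let ?Y = "\<lambda>j. bump (m * yc p - of_int (\<lfloor>m * yc p\<rfloor> + j))"
  let ?t = "\<lambda>i. 2 * real m * (zc p - of_int (\<lfloor>m * xc p\<rfloor> + i) / m * yc p)"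
  let ?Z = "\<lambda>i l. bump (?t i - of_int (\<lfloor>?t i\<rfloor> + l))"
  have "(\<Sum>c\<in>near p. (cut c p)\<^sup>2) = (\<Sum>(i, j, l)\<in>box. (?X i)\<^sup>2 * ((?Y j)\<^sup>2 * (?Z i l)\<^sup>2))"
    unfolding near_def sum.reindex[OF inj]
    by (rule sum.cong) (auto simp only: o_def cut_def pos_cell_near power_mult_distrib mult.assoc split: prod.splits)
  also have "\<dots> = (\<Sum>i\<in>{-1..2}. \<Sum>j\<in>{-1..2}. \<Sum>l\<in>{-1..2}. (?X i)\<^sup>2 * ((?Y j)\<^sup>2 * (?Z i l)\<^sup>2))"
    unfolding box_def by (simp only: sum.cartesian_product)
  also have "\<dots> = (\<Sum>i\<in>{-1..2}. (?X i)\<^sup>2 * (\<Sum>j\<in>{-1..2}. (?Y j)\<^sup>2 * (\<Sum>l\<in>{-1..2}. (?Z i l)\<^sup>2)))"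
    by (simp only: sum_distrib_left)
  also have "\<dots> = 1" by (simp only: bump_partition mult_1_right)
  finally show ?thesis .
qed

end

section \<open>Waves\<close>

text \<open>
  The contribution of a pair of waves to \<open>v du - u dv\<close>, where \<open>q\<close> and \<open>G\<close> are a cutoff and its
  gradient, \<open>T\<close> is the gradient of a phase and \<open>s\<close> a colour.  Amplitude gradients appear only with the
  sine of the phase difference, so they drop out on the diagonal.
\<close>

lemma rotation_pair_identity:
  fixes G T :: "'a::real_vector" and s s' A q q' \<theta> \<theta>' :: real
  assumes "s \<noteq> 0" "s' \<noteq> 0"
  shows "(A / s' * (q' * cos \<theta>')) *\<^sub>R ((A / s) *\<^sub>R (sin \<theta> *\<^sub>R G + q *\<^sub>R (cos \<theta> *\<^sub>R (s\<^sup>2 *\<^sub>R T))))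
     - (A / s' * (q' * sin \<theta>')) *\<^sub>R ((A / s) *\<^sub>R (cos \<theta> *\<^sub>R G + q *\<^sub>R ((- sin \<theta>) *\<^sub>R (s\<^sup>2 *\<^sub>R T))))
     = (A\<^sup>2 / (s * s')) *\<^sub>R ((q' * sin (\<theta> - \<theta>')) *\<^sub>R G + (q * q' * s\<^sup>2 * cos (\<theta> - \<theta>')) *\<^sub>R T)"
proof -
  have lin: "k *\<^sub>R (l *\<^sub>R (a *\<^sub>R G + b *\<^sub>R (c *\<^sub>R (d *\<^sub>R T)))) = (k * l * a) *\<^sub>R G + (k * l * b * c * d) *\<^sub>R T"
    for k l a b c d :: real
    by (simp add: scaleR_add_right mult.assoc)
  have lin': "k *\<^sub>R (a *\<^sub>R G + b *\<^sub>R T) = (k * a) *\<^sub>R G + (k * b) *\<^sub>R T" for k a b :: real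
    by (simp add: scaleR_add_right)
  have dif: "(a *\<^sub>R G + b *\<^sub>R T) - (a' *\<^sub>R G + b' *\<^sub>R T) = (a - a') *\<^sub>R G + (b - b') *\<^sub>R T" for a b a' b' :: real
    by (simp add: scaleR_left_diff_distrib)
  show ?thesis
    unfolding lin lin' dif using assms
    by (intro arg_cong2[of _ _ _ _ "(+)"] arg_cong2[of _ _ _ _ "scaleR"] refl)
       (simp_all add: sin_diff cos_diff field_simps power2_eq_square)
qed

context wave_cells
begin

definition phase :: "heis \<Rightarrow> heis \<Rightarrow> real" where
  "phase c x = - (2 / A\<^sup>2) * (\<beta> c \<bullet> incr c x)"

text \<open>
  The phase is an affine function of the increment from the centre; the second component
  accounts for the drift of the left-invariant frame across the cell.
\<close>
definition grad_phase :: "heis \<Rightarrow> heis \<Rightarrow> heis" where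
  "grad_phase c p = - (2 / A\<^sup>2) *\<^sub>R (\<beta> c + (0, xc (incr c p) * zc (\<beta> c), 0))"

definition angle :: "heis \<Rightarrow> heis \<Rightarrow> real" where "angle c x = (color c)\<^sup>2 * phase c x"

lemma phase_mult: "phase c (p \<odot> u) = phase c p + grad_phase c p \<bullet> u"
  unfolding phase_def grad_phase_def incr_mult_right heis_inner by (simp add: algebra_simps)

lemma norm_shift_le:
  assumes "c \<in> near p"
  shows "norm ((0, xc (incr c p) * zc (\<beta> c), 0) :: heis) \<le> 2 / m * norm (\<beta> c)"
    "norm ((0, xc (incr c p) * zc (\<beta> c), 0) :: heis) \<le> norm (\<beta> c)"
proof -
  have n: "norm ((0, xc (incr c p) * zc (\<beta> c), 0) :: heis) = \<bar>xc (incr c p)\<bar> * \<bar>zc (\<beta> c)\<bar>"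
    by (simp add: norm_Pair abs_mult)
  show "norm ((0, xc (incr c p) * zc (\<beta> c), 0) :: heis) \<le> 2 / m * norm (\<beta> c)"
    unfolding n by (intro mult_mono near_x_offset[OF assms] coord_le_norm) auto
  have "\<bar>xc (incr c p)\<bar> * \<bar>zc (\<beta> c)\<bar> \<le> 1 * norm (\<beta> c)"
    by (intro mult_mono near_x_offset[OF assms] coord_le_norm) auto
  then show "norm ((0, xc (incr c p) * zc (\<beta> c), 0) :: heis) \<le> norm (\<beta> c)" unfolding n by simp
qed

lemma norm_grad_phase:
  assumes "c \<in> near p"
  shows "norm (grad_phase c p) \<le> 2 * R"
proof -
  have "norm (\<beta> c + (0, xc (incr c p) * zc (\<beta> c), 0)) \<le> 2 * norm (\<beta> c)"
    using norm_triangle_ineq[of "\<beta> c" "(0, xc (incr c p) * zc (\<beta> c), 0)"] norm_shift_le(2)[OF assms] by linarith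
  also have "\<dots> \<le> A\<^sup>2 * R" using \<beta>_le[of c] by simp
  finally have "norm (grad_phase c p) \<le> (2 / A\<^sup>2) * (A\<^sup>2 * R)"
    unfolding grad_phase_def norm_scaleR using A_pos by (intro mult_mono) auto
  then show ?thesis using A_pos by simp
qed

lemma angle_mult: "angle c (p \<odot> u) = angle c p + ((color c)\<^sup>2 *\<^sub>R grad_phase c p) \<bullet> u"
  by (simp add: angle_def phase_mult algebra_simps)

lemma norm_grad_angle:
  assumes "c \<in> near p"
  shows "norm ((color c)\<^sup>2 *\<^sub>R grad_phase c p) \<le> 128 * R"
proof -
  have "(color c)\<^sup>2 * norm (grad_phase c p) \<le> 64 * (2 * R)"
    using color_sq_bounds[of c] norm_grad_phase[OF assms] by (intro mult_mono) auto
  then show ?thesis by simp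
qed

text \<open>
  The amplitude is divided by the colour \<open>s\<close> because the angle is multiplied by \<open>s\<^sup>2\<close>: each
  wave then contributes \<open>- \<chi>\<^sup>2 \<beta>\<close> to the rotation \<open>(v du - u dv)/2\<close>, independently of its colour.
\<close>
definition wave_u :: "heis \<Rightarrow> heis \<Rightarrow> real" where
  "wave_u c x = A / color c * (cut c x * sin (angle c x))"
definition wave_v :: "heis \<Rightarrow> heis \<Rightarrow> real" where
  "wave_v c x = A / color c * (cut c x * cos (angle c x))"

definition grad_u :: "heis \<Rightarrow> heis \<Rightarrow> heis" where
  "grad_u c p = (A / color c) *\<^sub>R (sin (angle c p) *\<^sub>R grad_cut c p
     + cut c p *\<^sub>R (cos (angle c p) *\<^sub>R ((color c)\<^sup>2 *\<^sub>R grad_phase c p)))"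
definition grad_v :: "heis \<Rightarrow> heis \<Rightarrow> heis" where
  "grad_v c p = (A / color c) *\<^sub>R (cos (angle c p) *\<^sub>R grad_cut c p
     + cut c p *\<^sub>R ((- sin (angle c p)) *\<^sub>R ((color c)\<^sup>2 *\<^sub>R grad_phase c p)))"

text \<open>
  Chosen so that the differential of \<open>wave_w c d\<close> cancels the leading cross term
  \<open>- (s\<^sub>c/s\<^sub>d) \<chi>\<^sub>c \<chi>\<^sub>d cos(\<theta>\<^sub>c - \<theta>\<^sub>d) \<beta>\<close>.  For equal colours the quotient is zero by convention;
  such pairs never overlap unless \<open>c = d\<close>.
\<close>
definition coupling :: "heis \<Rightarrow> heis \<Rightarrow> real" where
  "coupling c d = - (A\<^sup>2 / 2) * (color c / color d) / ((color c)\<^sup>2 - (color d)\<^sup>2)"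

definition wave_w :: "heis \<Rightarrow> heis \<Rightarrow> heis \<Rightarrow> real" where
  "wave_w c d x = coupling c d * ((cut c x * cut d x) * sin (angle c x - angle d x))"
definition grad_w :: "heis \<Rightarrow> heis \<Rightarrow> heis \<Rightarrow> heis" where
  "grad_w c d p = coupling c d *\<^sub>R (sin (angle c p - angle d p) *\<^sub>R (cut d p *\<^sub>R grad_cut c p + cut c p *\<^sub>R grad_cut d p)
     + (cut c p * cut d p) *\<^sub>R (cos (angle c p - angle d p) *\<^sub>R ((color c)\<^sup>2 *\<^sub>R grad_phase c p - (color d)\<^sup>2 *\<^sub>R grad_phase d p)))"

lemma amplitude_le: "\<bar>A / color c\<bar> \<le> A"
  using A_pos color_bounds[of c] by (simp add: field_simps)

lemma jet_wave_u:
  assumes c: "c \<in> near p"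
  shows "jet p (wave_u c) (grad_u c p) (4 * 10 ^ 13 * A)"
proof -
  have "jet p (\<lambda>x. sin (angle c x)) (cos (angle c p) *\<^sub>R ((color c)\<^sup>2 *\<^sub>R grad_phase c p)) (1 * 128\<^sup>2)"
    by (rule jet_compose[where l = "angle c"]) (use sin_taylor angle_mult norm_grad_angle[OF c] in auto)
  from jet_cmult[OF jet_mult[OF jet_cut[OF c] this], of "A / color c"]
  show ?thesis unfolding wave_u_def[abs_def] grad_u_def
    by (rule jet_mono) (use mult_right_mono[OF amplitude_le[of c], of "6 * (4 * 10 ^ 8) * (1 * 128\<^sup>2)"] A_pos in simp)
qed

lemma jet_wave_v:
  assumes c: "c \<in> near p"
  shows "jet p (wave_v c) (grad_v c p) (4 * 10 ^ 13 * A)"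
proof -
  have "jet p (\<lambda>x. cos (angle c x)) ((- sin (angle c p)) *\<^sub>R ((color c)\<^sup>2 *\<^sub>R grad_phase c p)) (1 * 128\<^sup>2)"
    by (rule jet_compose[where l = "angle c"])
       (use cos_taylor angle_mult norm_grad_angle[OF c] in \<open>auto simp del: minus_mult_left\<close>)
  from jet_cmult[OF jet_mult[OF jet_cut[OF c] this], of "A / color c"]
  show ?thesis unfolding wave_v_def[abs_def] grad_v_def
    by (rule jet_mono) (use mult_right_mono[OF amplitude_le[of c], of "6 * (4 * 10 ^ 8) * (1 * 128\<^sup>2)"] A_pos in simp)
qed

lemma coupling_le: "\<bar>coupling c d\<bar> \<le> 2 * A\<^sup>2"
proof (cases "color c = color d")
  case False
  have "\<bar>color c / color d\<bar> \<le> 8"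
    using color_bounds[of c] color_bounds[of d] by (simp add: field_simps)
  then have "\<bar>color c / color d\<bar> / \<bar>(color c)\<^sup>2 - (color d)\<^sup>2\<bar> \<le> 8 / 3"
    using color_gap[OF False] by (intro frac_le) auto
  then have "A\<^sup>2 / 2 * (\<bar>color c / color d\<bar> / \<bar>(color c)\<^sup>2 - (color d)\<^sup>2\<bar>) \<le> A\<^sup>2 / 2 * (8 / 3)"
    by (intro mult_left_mono) auto
  also have "\<dots> \<le> 2 * A\<^sup>2" by simp
  finally show ?thesis by (simp add: coupling_def abs_mult)
qed (simp add: coupling_def)

lemma jet_wave_w:
  assumes c: "c \<in> near p" and d: "d \<in> near p"
  shows "jet p (wave_w c d) (grad_w c d p) (10 ^ 24 * A\<^sup>2)"
proof -
  have l: "angle c (p \<odot> u) - angle d (p \<odot> u) = angle c p - angle d p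
      + ((color c)\<^sup>2 *\<^sub>R grad_phase c p - (color d)\<^sup>2 *\<^sub>R grad_phase d p) \<bullet> u" for u
    unfolding angle_mult inner_diff_left by simp
  have n: "norm ((color c)\<^sup>2 *\<^sub>R grad_phase c p - (color d)\<^sup>2 *\<^sub>R grad_phase d p) \<le> 256 * R"
    using norm_triangle_ineq4[of "(color c)\<^sup>2 *\<^sub>R grad_phase c p" "(color d)\<^sup>2 *\<^sub>R grad_phase d p"]
      norm_grad_angle[OF c] norm_grad_angle[OF d] by linarith
  have "jet p (\<lambda>x. sin (angle c x - angle d x)) (cos (angle c p - angle d p) *\<^sub>R
      ((color c)\<^sup>2 *\<^sub>R grad_phase c p - (color d)\<^sup>2 *\<^sub>R grad_phase d p)) (1 * 256\<^sup>2)"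
    by (rule jet_compose[where l = "\<lambda>x. angle c x - angle d x"]) (use sin_taylor l n in auto)
  from jet_cmult[OF jet_mult[OF jet_mult[OF jet_cut[OF c] jet_cut[OF d]] this], of "coupling c d"]
  show ?thesis unfolding wave_w_def[abs_def] grad_w_def
    by (rule jet_mono)
       (use mult_right_mono[OF coupling_le[of c d], of "6 * (6 * (4 * 10 ^ 8) * (4 * 10 ^ 8)) * (1 * 256\<^sup>2)"] in simp)
qed

lemma sum_active_near:
  assumes "norm u \<le> \<delta>" "\<And>c. c \<in> grid \<Longrightarrow> c \<notin> active (p \<odot> u) \<Longrightarrow> f c = 0"
  shows "sum f (active (p \<odot> u)) = sum f (near p)"
proof (rule sum.mono_neutral_left)
  show "active (p \<odot> u) \<subseteq> near p" by (rule active_subset_near[OF assms(1)])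
  show "\<forall>c\<in>near p - active (p \<odot> u). f c = 0" using assms(2) near_grid by blast
qed simp

definition total_u :: "heis \<Rightarrow> real" where "total_u x = (\<Sum>c\<in>active x. wave_u c x)"
definition total_v :: "heis \<Rightarrow> real" where "total_v x = (\<Sum>c\<in>active x. wave_v c x)"
definition total_cross :: "heis \<Rightarrow> real" where
  "total_cross x = (\<Sum>c\<in>active x. \<Sum>d\<in>active x. wave_w c d x)"
definition total_w :: "heis \<Rightarrow> real" where
  "total_w x = 1 / 2 * (total_u x * total_v x) + total_cross x"

definition grad_total_u :: "heis \<Rightarrow> heis" where "grad_total_u p = (\<Sum>c\<in>near p. grad_u c p)"
definition grad_total_v :: "heis \<Rightarrow> heis" where "grad_total_v p = (\<Sum>c\<in>near p. grad_v c p)"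
definition grad_total_cross :: "heis \<Rightarrow> heis" where
  "grad_total_cross p = (\<Sum>c\<in>near p. \<Sum>d\<in>near p. grad_w c d p)"
definition grad_total_w :: "heis \<Rightarrow> heis" where
  "grad_total_w p = (1 / 2) *\<^sub>R (total_v p *\<^sub>R grad_total_u p + total_u p *\<^sub>R grad_total_v p) + grad_total_cross p"

lemma wave_inactive:
  assumes "c \<in> grid" "c \<notin> active x"
  shows "wave_u c x = 0" "wave_v c x = 0" "wave_w c d x = 0" "wave_w d c x = 0"
  using cut_inactive[OF assms] by (simp_all add: wave_u_def wave_v_def wave_w_def)

lemma totals_as_sum_near:
  assumes "norm u \<le> \<delta>"
  shows "total_u (p \<odot> u) = (\<Sum>c\<in>near p. wave_u c (p \<odot> u))"
    "total_v (p \<odot> u) = (\<Sum>c\<in>near p. wave_v c (p \<odot> u))"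
    "total_cross (p \<odot> u) = (\<Sum>c\<in>near p. \<Sum>d\<in>near p. wave_w c d (p \<odot> u))"
proof -
  show "total_u (p \<odot> u) = (\<Sum>c\<in>near p. wave_u c (p \<odot> u))"
    "total_v (p \<odot> u) = (\<Sum>c\<in>near p. wave_v c (p \<odot> u))"
    unfolding total_u_def total_v_def by (auto intro: sum_active_near[OF assms] simp: wave_inactive)
  have "(\<Sum>d\<in>active (p \<odot> u). wave_w c d (p \<odot> u)) = (\<Sum>d\<in>near p. wave_w c d (p \<odot> u))" for c
    by (rule sum_active_near[OF assms]) (rule wave_inactive)
  moreover have "(\<Sum>c\<in>active (p \<odot> u). \<Sum>d\<in>near p. wave_w c d (p \<odot> u)) = (\<Sum>c\<in>near p. \<Sum>d\<in>near p. wave_w c d (p \<odot> u))"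
    by (rule sum_active_near[OF assms]) (simp add: wave_inactive)
  ultimately show "total_cross (p \<odot> u) = (\<Sum>c\<in>near p. \<Sum>d\<in>near p. wave_w c d (p \<odot> u))"
    unfolding total_cross_def by simp
qed

lemma card_near_real: "real (card (near p)) \<le> 64"
  using card_near[of p] by linarith

lemma jet_total_u: "jet p total_u (grad_total_u p) (10 ^ 16 * A)"
proof -
  have "jet p total_u (grad_total_u p) (card (near p) * (4 * 10 ^ 13 * A))"
    unfolding grad_total_u_def
    by (rule jet_cong[OF jet_sum[where f = wave_u]]) (use jet_wave_u totals_as_sum_near in auto)
  then show ?thesis
    by (rule jet_mono) (use mult_right_mono[OF card_near_real[of p], of "4 * 10 ^ 13 * A"] A_pos in simp)
qed

lemma jet_total_v: "jet p total_v (grad_total_v p) (10 ^ 16 * A)"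
proof -
  have "jet p total_v (grad_total_v p) (card (near p) * (4 * 10 ^ 13 * A))"
    unfolding grad_total_v_def
    by (rule jet_cong[OF jet_sum[where f = wave_v]]) (use jet_wave_v totals_as_sum_near in auto)
  then show ?thesis
    by (rule jet_mono) (use mult_right_mono[OF card_near_real[of p], of "4 * 10 ^ 13 * A"] A_pos in simp)
qed

lemma jet_total_w: "jet p total_w (grad_total_w p) (10 ^ 33 * A\<^sup>2)"
proof -
  have "jet p (\<lambda>x. \<Sum>d\<in>near p. wave_w c d x) (\<Sum>d\<in>near p. grad_w c d p) (64 * (10 ^ 24 * A\<^sup>2))"
    if c: "c \<in> near p" for c
    by (rule jet_mono[OF jet_sum[where f = "wave_w c"]])
       (use jet_wave_w[OF c] mult_right_mono[OF card_near_real[of p], of "10 ^ 24 * A\<^sup>2"] in auto)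
  then have "jet p total_cross (grad_total_cross p) (card (near p) * (64 * (10 ^ 24 * A\<^sup>2)))"
    unfolding grad_total_cross_def
    by (intro jet_cong[OF jet_sum[where f = "\<lambda>c x. \<Sum>d\<in>near p. wave_w c d x"]]) (use totals_as_sum_near in auto)
  then have cross: "jet p total_cross (grad_total_cross p) (10 ^ 30 * A\<^sup>2)"
  proof (rule jet_mono)
    have "card (near p) * (64 * (10 ^ 24 * A\<^sup>2)) \<le> 64 * (64 * (10 ^ 24 * A\<^sup>2))"
      by (rule mult_right_mono[OF card_near_real]) simp
    also have "\<dots> \<le> 10 ^ 30 * A\<^sup>2" by simp
    finally show "card (near p) * (64 * (10 ^ 24 * A\<^sup>2)) \<le> 10 ^ 30 * A\<^sup>2" .
  qed
  show ?thesis
    using jet_add[OF jet_cmult[OF jet_mult[OF jet_total_u jet_total_v], where a = "1 / 2"] cross]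
    unfolding total_w_def[abs_def] grad_total_w_def
    by (rule jet_mono) (simp add: power2_eq_square)
qed

text \<open>The bracket after \<open>b\<close> is the error of freezing the form on the cell and of the frame drift.\<close>
lemma grad_phase_eq:
  "grad_phase c p = - (2 / A\<^sup>2) *\<^sub>R (b + (\<beta> c - b + (0, xc (incr c p) * zc (\<beta> c), 0)))"
  by (simp add: grad_phase_def)

section \<open>Cancellation of the contact form\<close>

text \<open>
  What remains of the pair \<open>(c, d)\<close>; the summand \<open>\<chi>\<^sup>2 b\<close> distributes the form \<open>b\<close> over the
  diagonal by means of the partition of unity.
\<close>

definition pair_defect :: "heis \<Rightarrow> heis \<Rightarrow> heis \<Rightarrow> heis \<Rightarrow> heis" where
  "pair_defect b p c d = (1 / 2) *\<^sub>R (wave_v d p *\<^sub>R grad_u c p - wave_u d p *\<^sub>R grad_v c p) + grad_w c d p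
     + (if c = d then (cut c p)\<^sup>2 *\<^sub>R b else 0)"

lemma rotation_pair:
  "wave_v d p *\<^sub>R grad_u c p - wave_u d p *\<^sub>R grad_v c p =
    (A\<^sup>2 / (color c * color d)) *\<^sub>R ((cut d p * sin (angle c p - angle d p)) *\<^sub>R grad_cut c p
      + (cut c p * cut d p * (color c)\<^sup>2 * cos (angle c p - angle d p)) *\<^sub>R grad_phase c p)"
  unfolding wave_v_def wave_u_def grad_u_def grad_v_def
  by (rule rotation_pair_identity) (use color_bounds[of c] color_bounds[of d] in auto)

lemma pair_defect_diagonal:
  "pair_defect b p c c = - ((cut c p)\<^sup>2) *\<^sub>R (\<beta> c - b + (0, xc (incr c p) * zc (\<beta> c), 0))"
proof -
  define E where "E = \<beta> c - b + (0, xc (incr c p) * zc (\<beta> c), 0)"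
  have T: "grad_phase c p = - (2 / A\<^sup>2) *\<^sub>R (b + E)" unfolding E_def by (rule grad_phase_eq)
  have w: "grad_w c c p = 0" by (simp add: grad_w_def coupling_def)
  have "(1 / 2) *\<^sub>R (wave_v c p *\<^sub>R grad_u c p - wave_u c p *\<^sub>R grad_v c p)
      = (1 / 2 * (A\<^sup>2 / (color c * color c)) * (cut c p * cut c p * (color c)\<^sup>2) * - (2 / A\<^sup>2)) *\<^sub>R (b + E)"
    unfolding rotation_pair T by simp
  also have "1 / 2 * (A\<^sup>2 / (color c * color c)) * (cut c p * cut c p * (color c)\<^sup>2) * - (2 / A\<^sup>2) = - ((cut c p)\<^sup>2)"
    using A_pos color_bounds[of c] by (simp add: power2_eq_square)
  finally show ?thesis unfolding pair_defect_def w E_def[symmetric] by (simp add: algebra_simps)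
qed

lemma pair_defect_same_color:
  assumes "c \<in> grid" "d \<in> grid" "c \<noteq> d" "color c = color d"
  shows "pair_defect b p c d = 0"
proof -
  have w: "grad_w c d p = 0" using assms(4) by (simp add: grad_w_def coupling_def)
  have "c \<notin> active p \<or> d \<notin> active p" using same_color_active_eq assms(3,4) by blast
  then have "wave_v d p *\<^sub>R grad_u c p - wave_u d p *\<^sub>R grad_v c p = 0"
    using cut_inactive[OF assms(1), of p] cut_inactive[OF assms(2), of p] unfolding rotation_pair by auto
  then show ?thesis unfolding pair_defect_def w using assms(3) by simp
qed

text \<open>
  Writing the phase gradients as \<open>- 2/A\<^sup>2 (b + E)\<close>, the difference of the two angles has gradient
  \<open>- 2/A\<^sup>2 ((s\<^sub>c\<^sup>2 - s\<^sub>d\<^sup>2) b + \<dots>)\<close>, a multiple of \<open>b\<close> up to the freezing errors.  By the choice of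
  the coupling the multiples of \<open>b\<close> cancel, and only gradients of cutoffs and freezing errors are left.
\<close>
lemma pair_defect_colors:
  fixes b p :: heis
  assumes ne: "color c \<noteq> color d"
  defines "Ec \<equiv> \<beta> c - b + (0, xc (incr c p) * zc (\<beta> c), 0)"
    and "Ed \<equiv> \<beta> d - b + (0, xc (incr d p) * zc (\<beta> d), 0)"
    and "D \<equiv> (color c)\<^sup>2 - (color d)\<^sup>2" and "\<Delta> \<equiv> angle c p - angle d p"
  shows "pair_defect b p c d =
      (1 / 2 * (A\<^sup>2 / (color c * color d)) * (cut d p * sin \<Delta>)) *\<^sub>R grad_cut c p
    + (- (cut c p * cut d p * (color c / color d) * cos \<Delta>)) *\<^sub>R Ec
    + (coupling c d * sin \<Delta>) *\<^sub>R (cut d p *\<^sub>R grad_cut c p + cut c p *\<^sub>R grad_cut d p)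
    + (cut c p * cut d p * cos \<Delta> * (color c / color d / D)) *\<^sub>R ((color c)\<^sup>2 *\<^sub>R Ec - (color d)\<^sup>2 *\<^sub>R Ed)"
proof -
  have D: "D \<noteq> 0" using color_gap[OF ne] by (auto simp: D_def)
  have cd: "c \<noteq> d" using ne by auto
  have Tc: "grad_phase c p = - (2 / A\<^sup>2) *\<^sub>R (b + Ec)" unfolding Ec_def by (rule grad_phase_eq)
  have Td: "grad_phase d p = - (2 / A\<^sup>2) *\<^sub>R (b + Ed)" unfolding Ed_def by (rule grad_phase_eq)
  have main: "(1 / 2) *\<^sub>R ((A\<^sup>2 / (color c * color d)) *\<^sub>R ((cut d p * sin \<Delta>) *\<^sub>R grad_cut c p
      + (cut c p * cut d p * (color c)\<^sup>2 * cos \<Delta>) *\<^sub>R (- (2 / A\<^sup>2) *\<^sub>R (b + Ec))))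
    = (1 / 2 * (A\<^sup>2 / (color c * color d)) * (cut d p * sin \<Delta>)) *\<^sub>R grad_cut c p
     + (- (cut c p * cut d p * (color c / color d) * cos \<Delta>)) *\<^sub>R (b + Ec)"
  proof -
    have k: "1 / 2 * (A\<^sup>2 / (color c * color d)) * (cut c p * cut d p * (color c)\<^sup>2 * cos \<Delta>) * - (2 / A\<^sup>2)
        = - (cut c p * cut d p * (color c / color d) * cos \<Delta>)"
      using A_pos color_bounds[of c] by (simp add: power2_eq_square)
    show ?thesis unfolding k[symmetric] by (simp only: scaleR_add_right scaleR_scaleR mult.assoc)
  qed
  have dT: "(color c)\<^sup>2 *\<^sub>R grad_phase c p - (color d)\<^sup>2 *\<^sub>R grad_phase d p
      = - (2 / A\<^sup>2) *\<^sub>R (D *\<^sub>R b + ((color c)\<^sup>2 *\<^sub>R Ec - (color d)\<^sup>2 *\<^sub>R Ed))"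
    unfolding Tc Td D_def by (simp add: algebra_simps)
  have k1: "coupling c d * (cut c p * cut d p * cos \<Delta>) * - (2 / A\<^sup>2) = cut c p * cut d p * cos \<Delta> * (color c / color d / D)"
    unfolding coupling_def D_def[symmetric] using A_pos by simp
  have k2: "cut c p * cut d p * cos \<Delta> * (color c / color d / D) * D = cut c p * cut d p * (color c / color d) * cos \<Delta>"
    using D by simp
  have w: "grad_w c d p = (coupling c d * sin \<Delta>) *\<^sub>R (cut d p *\<^sub>R grad_cut c p + cut c p *\<^sub>R grad_cut d p)
     + ((cut c p * cut d p * (color c / color d) * cos \<Delta>) *\<^sub>R b
     + (cut c p * cut d p * cos \<Delta> * (color c / color d / D)) *\<^sub>R ((color c)\<^sup>2 *\<^sub>R Ec - (color d)\<^sup>2 *\<^sub>R Ed))"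
  proof -
    have "grad_w c d p = (coupling c d * sin \<Delta>) *\<^sub>R (cut d p *\<^sub>R grad_cut c p + cut c p *\<^sub>R grad_cut d p)
     + (coupling c d * (cut c p * cut d p * cos \<Delta>) * - (2 / A\<^sup>2)) *\<^sub>R (D *\<^sub>R b + ((color c)\<^sup>2 *\<^sub>R Ec - (color d)\<^sup>2 *\<^sub>R Ed))"
      unfolding grad_w_def dT \<Delta>_def[symmetric] by (simp only: scaleR_add_right scaleR_scaleR mult.assoc)
    then show ?thesis unfolding k1 scaleR_add_right[of _ "D *\<^sub>R b"] scaleR_scaleR k2 .
  qed
  show ?thesis
    unfolding pair_defect_def rotation_pair \<Delta>_def[symmetric] w Tc main using cd
    by (simp add: scaleR_add_right)
qed

lemma norm_pair_defect:
  assumes c: "c \<in> near p" and d: "d \<in> near p" and \<epsilon>: "\<And>c. c \<in> near p \<Longrightarrow> norm (\<beta> c - b) \<le> \<epsilon>"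
  shows "norm (pair_defect b p c d) \<le> 400 * (A\<^sup>2 * m + (\<epsilon> + A\<^sup>2 * R / m))"
proof -
  define \<eta> where "\<eta> = \<epsilon> + A\<^sup>2 * R / m"
  have \<epsilon>0: "0 \<le> \<epsilon>" using \<epsilon>[OF c] norm_ge_zero order_trans by blast
  have E: "norm (\<beta> c - b + (0, xc (incr c p) * zc (\<beta> c), 0)) \<le> \<eta>" if c: "c \<in> near p" for c
  proof -
    have "2 / m * norm (\<beta> c) \<le> 2 / m * (A\<^sup>2 * R / 2)" using \<beta>_le by (intro mult_left_mono) auto
    then have "norm ((0, xc (incr c p) * zc (\<beta> c), 0) :: heis) \<le> A\<^sup>2 * R / m"
      using norm_shift_le(1)[OF c] by simp
    then show ?thesis
      using norm_triangle_ineq[of "\<beta> c - b" "(0, xc (incr c p) * zc (\<beta> c), 0)"] \<epsilon>[OF c] by (simp add: \<eta>_def)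
  qed
  have \<eta>0: "0 \<le> \<eta>" using \<epsilon>0 R_pos by (simp add: \<eta>_def)
  have Am: "0 \<le> A\<^sup>2 * m" by simp
  consider "c = d" | "c \<noteq> d" "color c = color d" | "color c \<noteq> color d" by blast
  then have "norm (pair_defect b p c d) \<le> 400 * (A\<^sup>2 * m + \<eta>)"
  proof cases
    case 1
    have "norm (pair_defect b p c c) \<le> 1 * \<eta>"
      unfolding pair_defect_diagonal norm_scaleR using abs_cut_le[of c p] E[OF c] \<eta>0
      by (intro mult_mono) (auto simp: abs_square_le_1)
    then have "norm (pair_defect b p c d) \<le> \<eta>" using 1 by simp
    then show ?thesis unfolding distrib_left using Am \<eta>0 by linarith
  next
    case 2
    then show ?thesis using pair_defect_same_color[OF near_grid[OF c] near_grid[OF d]] Am \<eta>0 by simp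
  next
    case 3
    define Ec where "Ec = \<beta> c - b + (0, xc (incr c p) * zc (\<beta> c), 0)"
    define Ed where "Ed = \<beta> d - b + (0, xc (incr d p) * zc (\<beta> d), 0)"
    let ?D = "(color c)\<^sup>2 - (color d)\<^sup>2" and ?\<Delta> = "angle c p - angle d p"
    have Ec: "norm Ec \<le> \<eta>" and Ed: "norm Ed \<le> \<eta>" using E[OF c] E[OF d] by (simp_all add: Ec_def Ed_def)
    have r: "\<bar>color c / color d\<bar> \<le> 8"
      using color_bounds[of c] color_bounds[of d] by (simp add: field_simps)
    have cc: "1 \<le> color c * color d"
      using color_bounds[of c] color_bounds[of d] mult_mono[of 1 "color c" 1 "color d"] by simp
    have q: "\<bar>cut c p * cut d p\<bar> \<le> 1 * 1" unfolding abs_mult by (intro mult_mono abs_cut_le) auto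
    have a1: "\<bar>1 / 2 * (A\<^sup>2 / (color c * color d)) * (cut d p * sin ?\<Delta>)\<bar> \<le> 1 / 2 * (A\<^sup>2 / 1) * (1 * 1)"
    proof -
      have "A\<^sup>2 / (color c * color d) \<le> A\<^sup>2 / 1" by (rule divide_left_mono) (use cc in auto)
      moreover have "\<bar>A\<^sup>2 / (color c * color d)\<bar> = A\<^sup>2 / (color c * color d)" using cc by simp
      ultimately show ?thesis unfolding abs_mult by (intro mult_mono abs_cut_le) auto
    qed
    have a2: "\<bar>- (cut c p * cut d p * (color c / color d) * cos ?\<Delta>)\<bar> \<le> (1 * 1) * 8 * 1"
      unfolding abs_minus_cancel abs_mult[of _ "cos ?\<Delta>"] abs_mult[of _ "color c / color d"]
      using q r by (intro mult_mono) auto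
    have a3: "\<bar>coupling c d * sin ?\<Delta>\<bar> \<le> (2 * A\<^sup>2) * 1"
      unfolding abs_mult by (intro mult_mono coupling_le) auto
    have "\<bar>color c / color d / ?D\<bar> \<le> 8 / 3"
      unfolding abs_divide[of _ ?D] using r color_gap[OF 3] by (intro frac_le) auto
    then have r3: "\<bar>color c / color d / ?D\<bar> \<le> 3" by linarith
    have a4: "\<bar>cut c p * cut d p * cos ?\<Delta> * (color c / color d / ?D)\<bar> \<le> ((1 * 1) * 1) * 3"
      unfolding abs_mult[of _ "cos ?\<Delta>"] abs_mult[of _ "color c / color d / ?D"]
      using q by (intro mult_mono r3) auto
    have n1: "norm ((cut d p *\<^sub>R grad_cut c p + cut c p *\<^sub>R grad_cut d p)) \<le> 48 * real m"
    proof -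
      have "norm (cut a p *\<^sub>R grad_cut e p) \<le> 1 * (24 * real m)" if "e \<in> near p" for a e
        unfolding norm_scaleR by (intro mult_mono abs_cut_le norm_grad_cut[OF that, THEN order_trans]) auto
      from this[OF c, of d] this[OF d, of c]
      show ?thesis using norm_triangle_ineq[of "cut d p *\<^sub>R grad_cut c p" "cut c p *\<^sub>R grad_cut d p"] by linarith
    qed
    have n2: "norm ((color c)\<^sup>2 *\<^sub>R Ec - (color d)\<^sup>2 *\<^sub>R Ed) \<le> 128 * \<eta>"
    proof -
      have "norm ((color c)\<^sup>2 *\<^sub>R Ec) \<le> 64 * \<eta>" "norm ((color d)\<^sup>2 *\<^sub>R Ed) \<le> 64 * \<eta>"
        unfolding norm_scaleR using color_sq_bounds[of c] color_sq_bounds[of d] Ec Ed by (auto intro!: mult_mono)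
      then show ?thesis using norm_triangle_ineq4[of "(color c)\<^sup>2 *\<^sub>R Ec" "(color d)\<^sup>2 *\<^sub>R Ed"] by linarith
    qed
    have quad: "norm (x + y + z + w) \<le> norm x + norm y + norm z + norm w" for x y z w :: heis
      using norm_triangle_ineq[of "x + y + z" w] norm_triangle_ineq[of "x + y" z] norm_triangle_ineq[of x y] by linarith
    have n0: "norm (grad_cut c p) \<le> 24 * real m" using norm_grad_cut[OF c] by simp
    have "norm (pair_defect b p c d) \<le> (1 / 2 * (A\<^sup>2 / 1) * (1 * 1)) * (24 * real m) + ((1 * 1) * 8 * 1) * \<eta>
        + ((2 * A\<^sup>2) * 1) * (48 * real m) + (((1 * 1) * 1) * 3) * (128 * \<eta>)"
      unfolding pair_defect_colors[OF 3] Ec_def[symmetric] Ed_def[symmetric]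
      by (rule order_trans[OF quad], unfold norm_scaleR)
         (intro add_mono mult_mono a1 a2 a3 a4 n1 n2 Ec n0; simp)
    also have "\<dots> = 108 * (A\<^sup>2 * m) + 392 * \<eta>" by simp
    also have "\<dots> \<le> 400 * (A\<^sup>2 * m + \<eta>)" using Am \<eta>0 by simp
    finally show ?thesis .
  qed
  then show ?thesis by (simp add: \<eta>_def)
qed

text \<open>
  \<open>- u dv + d(uv/2)\<close> is \<open>(v du - u dv)/2\<close>, hence the vector on the left is \<open>b\<close> plus the rotation plus
  the differential of the cross waves, that is, the sum of all pair defects.  The three terms of the bound
  come from the gradients of the cutoffs, from freezing the form, and from the drift of the frame.
\<close>
lemma wave_cancellation:
  assumes \<epsilon>: "\<And>c. c \<in> near p \<Longrightarrow> norm (\<beta> c - b) \<le> \<epsilon>"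
  shows "norm (b - total_u p *\<^sub>R grad_total_v p + grad_total_w p)
     \<le> 4096 * (400 * (A\<^sup>2 * m + (\<epsilon> + A\<^sup>2 * R / m)))"
proof -
  let ?B = "400 * (A\<^sup>2 * m + (\<epsilon> + A\<^sup>2 * R / m))"
  have u: "total_u p = (\<Sum>d\<in>near p. wave_u d p)" and v: "total_v p = (\<Sum>d\<in>near p. wave_v d p)"
    using totals_as_sum_near[of 0 p] \<delta>_pos by simp_all
  have 1: "total_v p *\<^sub>R grad_total_u p - total_u p *\<^sub>R grad_total_v p
      = (\<Sum>c\<in>near p. \<Sum>d\<in>near p. wave_v d p *\<^sub>R grad_u c p - wave_u d p *\<^sub>R grad_v c p)"
    unfolding u v grad_total_u_def grad_total_v_def
    by (simp add: scaleR_sum_left scaleR_sum_right sum_subtractf)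
  have 2: "b = (\<Sum>c\<in>near p. \<Sum>d\<in>near p. if c = d then (cut c p)\<^sup>2 *\<^sub>R b else 0)"
  proof -
    have "(\<Sum>c\<in>near p. \<Sum>d\<in>near p. if c = d then (cut c p)\<^sup>2 *\<^sub>R b else 0) = (\<Sum>c\<in>near p. (cut c p)\<^sup>2 *\<^sub>R b)"
      by (intro sum.cong refl) simp
    also have "\<dots> = (\<Sum>c\<in>near p. (cut c p)\<^sup>2) *\<^sub>R b" by (rule scaleR_sum_left[symmetric])
    finally show ?thesis by (simp add: cut_partition)
  qed
  have half: "(1 / 2) *\<^sub>R (x + y) - y = (1 / 2) *\<^sub>R (x - y)" for x y :: heis
  proof -
    have "y = (1 / 2) *\<^sub>R (y + y)" by (simp only: scaleR_half_double)
    then have "(1 / 2) *\<^sub>R (x + y) - y = (1 / 2) *\<^sub>R (x + y) - (1 / 2) *\<^sub>R (y + y)" by simp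
    then show ?thesis by (simp add: algebra_simps)
  qed
  have "b - total_u p *\<^sub>R grad_total_v p + grad_total_w p
      = (1 / 2) *\<^sub>R (total_v p *\<^sub>R grad_total_u p - total_u p *\<^sub>R grad_total_v p) + grad_total_cross p + b"
    unfolding grad_total_w_def half[symmetric] by simp
  also have "\<dots> = (\<Sum>c\<in>near p. \<Sum>d\<in>near p. pair_defect b p c d)"
    unfolding pair_defect_def sum.distrib 1 grad_total_cross_def scaleR_sum_right 2[symmetric] ..
  finally have eq: "b - total_u p *\<^sub>R grad_total_v p + grad_total_w p = (\<Sum>c\<in>near p. \<Sum>d\<in>near p. pair_defect b p c d)" .
  have B: "norm (pair_defect b p c d) \<le> ?B" if "c \<in> near p" "d \<in> near p" for c d
    by (rule norm_pair_defect[OF that \<epsilon>])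
  have B0: "0 \<le> ?B"
  proof -
    have "near p \<noteq> {}" using cut_partition[of p] by auto
    then show ?thesis using B norm_ge_zero order_trans by blast
  qed
  have "norm (\<Sum>c\<in>near p. \<Sum>d\<in>near p. pair_defect b p c d) \<le> (\<Sum>c\<in>near p. \<Sum>d\<in>near p. ?B)"
    using B by (intro order_trans[OF norm_sum] sum_mono) auto
  also have "\<dots> = real (card (near p)) * (real (card (near p)) * ?B)" by simp
  also have "\<dots> \<le> 64 * (64 * ?B)"
    using B0 card_near_real[of p] by (intro mult_mono) auto
  finally show ?thesis unfolding eq by simp
qed

section \<open>Invariance under the lattice\<close>

lemma lattice_Ints:
  assumes "h \<in> \<H>\<^sub>\<int>" shows "xc h \<in> \<int>" "yc h \<in> \<int>" "zc h \<in> \<int>"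
  using assms by (auto simp: heis_lattice_def)

lemma translate_index:
  assumes "h \<in> \<H>\<^sub>\<int>"
  obtains i j k :: int where "xc h = i" "yc h = j" "zc h = k"
  using lattice_Ints[OF assms] by (auto elim!: Ints_cases)

lemma translate_coords:
  "real m * xc (h \<odot> c) = real m * xc h + real m * xc c"
  "real m * yc (h \<odot> c) = real m * yc h + real m * yc c"
  "2 * real m * (zc (h \<odot> c) - xc (h \<odot> c) * yc (h \<odot> c)) = 2 * (real m * (zc h - xc h * yc h) - real m * xc c * yc h)
     + 2 * real m * (zc c - xc c * yc c)"
  by (simp_all add: algebra_simps)

lemma translate_grid:
  assumes h: "h \<in> \<H>\<^sub>\<int>"
  shows "h \<odot> c \<in> grid \<longleftrightarrow> c \<in> grid"
proof -
  obtain i j k :: int where hc: "xc h = i" "yc h = j" "zc h = k" by (rule translate_index[OF h])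
  have int: "of_int a + t \<in> \<int> \<longleftrightarrow> t \<in> \<int>" for a :: int and t :: real
    by (metis Ints_add Ints_diff Ints_of_int add_diff_cancel_left')
  have 1: "real m * xc (h \<odot> c) \<in> \<int> \<longleftrightarrow> real m * xc c \<in> \<int>"
    unfolding translate_coords hc using int[of "int m * i"] by simp
  have 2: "real m * yc (h \<odot> c) \<in> \<int> \<longleftrightarrow> real m * yc c \<in> \<int>"
    unfolding translate_coords hc using int[of "int m * j"] by simp
  have 3: "2 * real m * (zc (h \<odot> c) - xc (h \<odot> c) * yc (h \<odot> c)) \<in> \<int> \<longleftrightarrow> 2 * real m * (zc c - xc c * yc c) \<in> \<int>"
    if x: "real m * xc c \<in> \<int>"
  proof -
    obtain n where n: "real m * xc c = of_int n" using x by (rule Ints_cases)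
    show ?thesis unfolding translate_coords hc n
      using int[of "2 * (int m * (k - i * j) - n * j)"] by simp
  qed
  show ?thesis unfolding grid_def using 1 2 3 by blast
qed

text \<open>
  Translation changes the horizontal indices by multiples of \<open>m\<close>, which is even, and the vertical
  index by an even number.
\<close>
lemma translate_color:
  assumes h: "h \<in> \<H>\<^sub>\<int>" and c: "c \<in> grid"
  shows "color (h \<odot> c) = color c"
proof -
  obtain i j k :: int where hc: "xc h = i" "yc h = j" "zc h = k" by (rule translate_index[OF h])
  have hg: "h \<odot> c \<in> grid" using translate_grid[OF h] c by simp
  have x: "index_x (h \<odot> c) = int m * i + index_x c"
  proof -
    have "real_of_int (index_x (h \<odot> c)) = of_int (int m * i + index_x c)"
      using translate_coords(1)[of h c] grid_index(1)[OF hg] grid_index(1)[OF c] hc by simp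
    then show ?thesis by linarith
  qed
  have y: "index_y (h \<odot> c) = int m * j + index_y c"
  proof -
    have "real_of_int (index_y (h \<odot> c)) = of_int (int m * j + index_y c)"
      using translate_coords(2)[of h c] grid_index(2)[OF hg] grid_index(2)[OF c] hc by simp
    then show ?thesis by linarith
  qed
  have z: "index_z (h \<odot> c) = 2 * (int m * (k - i * j) - index_x c * j) + index_z c"
  proof -
    have "real_of_int (index_z (h \<odot> c)) = of_int (2 * (int m * (k - i * j) - index_x c * j) + index_z c)"
      using translate_coords(3)[of h c] unfolding grid_index(3)[OF hg] grid_index(3)[OF c] grid_index(1)[OF c] hc by simp
    then show ?thesis by linarith
  qed
  obtain n where n: "int m = 2 * n" using m_even by (metis dvdE even_of_nat)
  have par: "(2 * a + r) mod 2 = r mod 2" for a r :: int by simp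
  have "index_x (h \<odot> c) mod 2 = index_x c mod 2" "index_y (h \<odot> c) mod 2 = index_y c mod 2"
    "index_z (h \<odot> c) mod 2 = index_z c mod 2"
    unfolding x y z n mult.assoc by (rule par)+
  then show ?thesis by (simp add: color_def color_nat_def)
qed

lemma translate_active:
  assumes h: "h \<in> \<H>\<^sub>\<int>"
  shows "active (h \<odot> x) = (\<odot>) h ` active x"
proof -
  have pos: "pos_x (h \<odot> c) (h \<odot> x) = pos_x c x" "pos_y (h \<odot> c) (h \<odot> x) = pos_y c x" "pos_z (h \<odot> c) (h \<odot> x) = pos_z c x" for c
    unfolding pos_x_def pos_y_def pos_z_def incr_left_invariant by simp_all
  have iff: "h \<odot> c \<in> active (h \<odot> x) \<longleftrightarrow> c \<in> active x" for c
    unfolding active_def mem_Collect_eq pos translate_grid[OF h] by simp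
  show ?thesis
  proof (intro equalityI subsetI)
    fix c assume c: "c \<in> active (h \<odot> x)"
    then have "incr h c \<in> active x" using iff[of "incr h c"] by simp
    then show "c \<in> (\<odot>) h ` active x" by (rule rev_image_eqI) simp
  qed (use iff in auto)
qed

lemma sum_active_translate:
  assumes h: "h \<in> \<H>\<^sub>\<int>"
  shows "(\<Sum>c\<in>active (h \<odot> x). f c) = (\<Sum>c\<in>active x. f (h \<odot> c))"
proof -
  have "inj_on ((\<odot>) h) (active x)" by (rule inj_on_inverseI[where g = "incr h"]) simp
  then show ?thesis unfolding translate_active[OF h] by (simp add: sum.reindex)
qed

lemma totals_translate:
  assumes h: "h \<in> \<H>\<^sub>\<int>" and inv: "\<And>c. \<beta> (h \<odot> c) = \<beta> c"
  shows "total_u (h \<odot> x) = total_u x" "total_v (h \<odot> x) = total_v x" "total_w (h \<odot> x) = total_w x"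
proof -
  have ct: "cut (h \<odot> c) (h \<odot> x) = cut c x" for c
    unfolding cut_def pos_x_def pos_y_def pos_z_def incr_left_invariant ..
  have an: "angle (h \<odot> c) (h \<odot> x) = angle c x" if "c \<in> active x" for c
    using that translate_color[OF h] unfolding angle_def phase_def incr_left_invariant inv
    by (simp add: active_def)
  have co: "color (h \<odot> c) = color c" if "c \<in> active x" for c
    using that translate_color[OF h] by (simp add: active_def)
  show 1: "total_u (h \<odot> x) = total_u x" "total_v (h \<odot> x) = total_v x"
    unfolding total_u_def total_v_def sum_active_translate[OF h] wave_u_def wave_v_def
    by (auto intro!: sum.cong simp: ct an co)
  have "total_cross (h \<odot> x) = total_cross x"
    unfolding total_cross_def sum_active_translate[OF h] wave_w_def coupling_def
    by (intro sum.cong refl) (simp only: ct an co)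
  then show "total_w (h \<odot> x) = total_w x" unfolding total_w_def 1 by simp
qed

end

section \<open>Almost horizontal maps\<close>

text \<open>
  \<open>a1\<close>, \<open>a2\<close> and \<open>b\<close> are the values at \<open>p\<close> of \<open>df\<^sub>1\<close>, \<open>df\<^sub>2\<close> and \<open>df\<^sub>3 - f\<^sub>1 df\<^sub>2\<close> in
  left-invariant coordinates.  All of them vary at frequency at most \<open>l\<close>, and the horizontal derivative is
  tied to the error \<open>e\<close> so that over a distance \<open>t \<le> 1/l\<close> horizontal and vertical motion both have
  homogeneous norm of order at most \<open>sqrt (e t)\<close>.
\<close>

definition linearized :: "(heis \<Rightarrow> heis) \<Rightarrow> real \<Rightarrow> real \<Rightarrow> heis \<Rightarrow> heis \<Rightarrow> heis \<Rightarrow> heis \<Rightarrow> bool" where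
  "linearized F e l p a1 a2 b \<longleftrightarrow> norm a1 \<le> sqrt (e * l) \<and> norm a2 \<le> sqrt (e * l) \<and> norm b \<le> e \<and>
    (\<forall>u. norm u \<le> 1 / l \<longrightarrow>
       \<bar>xc (incr (F p) (F (p \<odot> u))) - a1 \<bullet> u\<bar> \<le> sqrt (e * l) * l * (norm u)\<^sup>2 \<and>
       \<bar>yc (incr (F p) (F (p \<odot> u))) - a2 \<bullet> u\<bar> \<le> sqrt (e * l) * l * (norm u)\<^sup>2 \<and>
       \<bar>zc (incr (F p) (F (p \<odot> u))) - b \<bullet> u\<bar> \<le> e * l * (norm u)\<^sup>2)"

definition almost_horizontal :: "(heis \<Rightarrow> heis) \<Rightarrow> real \<Rightarrow> real \<Rightarrow> bool" where
  "almost_horizontal F e l \<longleftrightarrow> lattice_equivariant F \<and> (\<forall>p. \<exists>a1 a2 b. linearized F e l p a1 a2 b)"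

lemma linearized_horizontal_le:
  assumes "linearized F e l p a1 a2 b" "0 < e" "0 < l" "norm u \<le> 1 / l"
  shows "\<bar>xc (incr (F p) (F (p \<odot> u)))\<bar> \<le> 2 * sqrt (e * l) * norm u"
    "\<bar>yc (incr (F p) (F (p \<odot> u)))\<bar> \<le> 2 * sqrt (e * l) * norm u"
proof -
  have lu: "l * norm u \<le> 1" using assms by (simp add: field_simps)
  have "(sqrt (e * l) * norm u) * (l * norm u) \<le> (sqrt (e * l) * norm u) * 1"
    using lu assms by (intro mult_left_mono) auto
  then have q: "sqrt (e * l) * l * (norm u)\<^sup>2 \<le> sqrt (e * l) * norm u" by (simp add: power2_eq_square algebra_simps)
  have lin: "\<bar>a \<bullet> u\<bar> \<le> sqrt (e * l) * norm u" if "norm a \<le> sqrt (e * l)" for a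
    using Cauchy_Schwarz_ineq2[of a u] mult_right_mono[OF that norm_ge_zero[of u]] by linarith
  show "\<bar>xc (incr (F p) (F (p \<odot> u)))\<bar> \<le> 2 * sqrt (e * l) * norm u"
    "\<bar>yc (incr (F p) (F (p \<odot> u)))\<bar> \<le> 2 * sqrt (e * l) * norm u"
    using assms(1)[unfolded linearized_def, THEN conjunct1, THEN lin]
      assms(1)[unfolded linearized_def, THEN conjunct2, THEN conjunct1, THEN lin]
      assms(1)[unfolded linearized_def, THEN conjunct2, THEN conjunct2, THEN conjunct2, rule_format, OF assms(4)] q
    by linarith+
qed

lemma norm_mult_le: "norm (w \<odot> u) \<le> norm w + norm u + norm w * norm u"
proof -
  have "w \<odot> u = w + u + (0, 0, xc w * yc u)" by (rule heis_eqI) simp_all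
  moreover have "norm ((0::real, 0::real, xc w * yc u)) \<le> norm w * norm u"
    by (simp add: norm_Pair abs_mult) (intro mult_mono coord_le_norm; simp)
  ultimately show ?thesis
    using norm_triangle_ineq[of "w + u" "(0, 0, xc w * yc u)"] norm_triangle_ineq[of w u] by simp
qed

text \<open>
  Compare the vertical increment over \<open>w\<close> followed by \<open>u\<close> with the two separate ones.  They differ by
  the product of the horizontal increments, which is quadratic.  Hence \<open>(b' - b) \<bullet> u\<close> is
  quadratic in the common length of \<open>u\<close> and \<open>w\<close>, and the direction of \<open>u\<close> is free.
\<close>
lemma linearized_defect_lipschitz:
  assumes ap: "linearized F e l p a1 a2 b" and aw: "linearized F e l (p \<odot> w) a1' a2' b'"
    and e: "0 < e" and l: "1 \<le> l" and w: "w \<noteq> 0" "norm w \<le> 1 / (4 * l)"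
  shows "norm (b' - b) \<le> 16 * (e * l) * norm w"
proof (cases "b' = b")
  case True
  then show ?thesis using e l by simp
next
  case False
  define t where "t = norm w"
  have t: "0 < t" "t \<le> 1 / (4 * l)" using w by (auto simp: t_def)
  have t1: "t \<le> 1" "l * t \<le> 1 / 4" "t \<le> 1 / l"
  proof -
    show lt: "l * t \<le> 1 / 4" using t l by (simp add: field_simps)
    then show "t \<le> 1 / l" using l by (simp add: field_simps)
    have "1 * t \<le> l * t" using l t by (intro mult_right_mono) auto
    then show "t \<le> 1" using lt by linarith
  qed
  \<comment> \<open>the direction in which \<open>b\<close> and \<open>b'\<close> differ most, at the length of \<open>w\<close>\<close>
  define u where "u = t *\<^sub>R sgn (b' - b)"
  have nu: "norm u = t" using False t by (simp add: u_def norm_sgn)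
  have du: "(b' - b) \<bullet> u = t * norm (b' - b)"
    using False by (simp add: u_def sgn_div_norm dot_square_norm power2_eq_square)
  have wu: "norm (w \<odot> u) \<le> 3 * t"
  proof -
    have "t * t \<le> t" using t t1 by (intro mult_left_le) auto
    then show ?thesis using norm_mult_le[of w u] nu by (simp add: t_def)
  qed
  have wul: "norm (w \<odot> u) \<le> 1 / l"
  proof -
    have "3 * t \<le> 1 / l" using t l by (simp add: field_simps)
    then show ?thesis using wu by linarith
  qed
  let ?N = "e * l * t\<^sup>2"
  have N0: "0 \<le> ?N" using e l by simp
  have eN: "e * t\<^sup>2 \<le> ?N" using e l by (intro mult_right_mono) auto
  let ?z = "\<lambda>p q. zc (incr (F p) (F q))"
  have A: "\<bar>?z p (p \<odot> (w \<odot> u)) - b \<bullet> (w \<odot> u)\<bar> \<le> 9 * ?N"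
  proof -
    have "(norm (w \<odot> u))\<^sup>2 \<le> (3 * t)\<^sup>2" using wu by (intro power_mono) auto
    then have "e * l * (norm (w \<odot> u))\<^sup>2 \<le> e * l * (3 * t)\<^sup>2" using e l by (intro mult_left_mono) auto
    moreover have "e * l * (3 * t)\<^sup>2 = 9 * ?N" by (simp add: power2_eq_square)
    moreover have "\<bar>?z p (p \<odot> (w \<odot> u)) - b \<bullet> (w \<odot> u)\<bar> \<le> e * l * (norm (w \<odot> u))\<^sup>2"
      using ap wul unfolding linearized_def by blast
    ultimately show ?thesis by linarith
  qed
  have B: "\<bar>?z p (p \<odot> w) - b \<bullet> w\<bar> \<le> ?N"
    using ap t1(3) unfolding linearized_def t_def by blast
  have C: "\<bar>?z (p \<odot> w) ((p \<odot> w) \<odot> u) - b' \<bullet> u\<bar> \<le> ?N"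
    using aw t1(3) nu unfolding linearized_def by metis
  have X: "\<bar>xc (incr (F p) (F (p \<odot> w)))\<bar> \<le> 2 * sqrt (e * l) * t"
    using linearized_horizontal_le(1)[OF ap e, of w] l t1(3) by (simp add: t_def)
  have Y: "\<bar>yc (incr (F (p \<odot> w)) (F ((p \<odot> w) \<odot> u)))\<bar> \<le> 2 * sqrt (e * l) * t"
    using linearized_horizontal_le(2)[OF aw e, of u] l t1(3) nu by simp
  have XY: "\<bar>xc (incr (F p) (F (p \<odot> w))) * yc (incr (F (p \<odot> w)) (F ((p \<odot> w) \<odot> u)))\<bar> \<le> 4 * ?N"
  proof -
    have "\<bar>xc (incr (F p) (F (p \<odot> w))) * yc (incr (F (p \<odot> w)) (F ((p \<odot> w) \<odot> u)))\<bar>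
        \<le> (2 * sqrt (e * l) * t) * (2 * sqrt (e * l) * t)"
      unfolding abs_mult using X Y e l t by (intro mult_mono) auto
    also have "\<dots> = 4 * (sqrt (e * l) * sqrt (e * l)) * t\<^sup>2" by (simp add: power2_eq_square)
    also have "\<dots> = 4 * ?N" using e l by simp
    finally show ?thesis .
  qed
  have Z: "?z p (p \<odot> (w \<odot> u)) = ?z p (p \<odot> w) + ?z (p \<odot> w) ((p \<odot> w) \<odot> u)
      + xc (incr (F p) (F (p \<odot> w))) * yc (incr (F (p \<odot> w)) (F ((p \<odot> w) \<odot> u)))"
    unfolding mult_assoc[symmetric] using incr_trans[of "F p" "F ((p \<odot> w) \<odot> u)" "F (p \<odot> w)"] mult_coords(3) by metis
  have bwu: "b \<bullet> (w \<odot> u) = b \<bullet> w + b \<bullet> u + zc b * (xc w * yc u)"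
    by (simp add: heis_inner algebra_simps)
  have "\<bar>zc b * (xc w * yc u)\<bar> \<le> e * (t * t)"
  proof -
    have "\<bar>zc b\<bar> \<le> e" using ap coord_le_norm(3)[of b] unfolding linearized_def by linarith
    moreover have "\<bar>xc w\<bar> \<le> t" "\<bar>yc u\<bar> \<le> t" using coord_le_norm[of w] coord_le_norm[of u] nu by (auto simp: t_def)
    ultimately show ?thesis unfolding abs_mult using e t by (intro mult_mono) auto
  qed
  then have W: "\<bar>zc b * (xc w * yc u)\<bar> \<le> ?N" using eN by (simp add: power2_eq_square)
  have "(b' - b) \<bullet> u = b' \<bullet> u - b \<bullet> u" by (rule inner_diff_left)
  then have "\<bar>(b' - b) \<bullet> u\<bar> \<le> 16 * ?N" using A B C XY Z bwu W by linarith
  then have "t * norm (b' - b) \<le> t * (16 * (e * l) * t)"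
    unfolding du using t by (simp add: power2_eq_square abs_mult algebra_simps)
  then show ?thesis using t by (simp add: t_def)
qed

lemma almost_horizontal_id: "almost_horizontal id 1 1"
  unfolding almost_horizontal_def
proof (intro conjI allI)
  show "lattice_equivariant id" by (simp add: lattice_equivariant_def)
  fix p :: heis
  have "linearized id 1 1 p (1, 0, 0) (0, 1, 0) (0, 0, 1)"
    unfolding linearized_def id_apply incr_mult heis_inner by (simp add: norm_Pair)
  then show "\<exists>a1 a2 b. linearized id 1 1 p a1 a2 b" by blast
qed

lemma linearized_translate:
  assumes "lattice_equivariant F" "h \<in> \<H>\<^sub>\<int>"
  shows "linearized F e l (h \<odot> p) a1 a2 b \<longleftrightarrow> linearized F e l p a1 a2 b"
proof -
  have "F (h \<odot> p) = h \<odot> F p" "F ((h \<odot> p) \<odot> u) = h \<odot> F (p \<odot> u)" for u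
    using assms unfolding lattice_equivariant_def mult_assoc by blast+
  then show ?thesis unfolding linearized_def by (simp only: incr_left_invariant)
qed

section \<open>One stage of the construction\<close>

text \<open>
  The four sources of error in the new form are all of order at most \<open>e/M\<close>: cutoffs contribute
  \<open>A\<^sup>2 m\<close>, freezing contributes the variation \<open>e l / m\<close> of \<open>b\<close> over a cell, the frame drift
  \<open>A\<^sup>2 R / m\<close>, and the interaction with the old map \<open>A sqrt (e l)\<close>.  What matters about the
  numerical constant is that it does not depend on \<open>M\<close>.
\<close>

theorem corrugation_stage:
  fixes F :: "heis \<Rightarrow> heis" and e :: real and L M :: nat
  assumes res: "almost_horizontal F e L" and e: "0 < e" and L: "1 \<le> L" and M: "even M" "32 \<le> M"
  obtains F' where "almost_horizontal F' (10 ^ 40 * e / M) (M ^ 3 * L)"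
    "\<And>p. hom_norm (incr (F p) (F' p)) \<le> 10 ^ 40 * sqrt (e / (M\<^sup>2 * L))"
proof -
  define l where "l = real L"
  define \<mu> where "\<mu> = real M"
  define S where "S = sqrt (e * l)"
  define A where "A = S / (\<mu> * l)"
  define R where "R = 2 * \<mu>\<^sup>2 * l"
  \<comment> \<open>the range of displacements at which the new map has to be tested\<close>
  define \<delta> where "\<delta> = 1 / (\<mu> ^ 3 * l)"
  define m where "m = M * L"
  \<comment> \<open>Selected by a predicate that is itself invariant under the lattice, so the choice is invariant as well.\<close>
  define \<beta> where "\<beta> c = (SOME b. \<exists>a1 a2. linearized F e l c a1 a2 b)" for c
  have l: "1 \<le> l" and \<mu>: "32 \<le> \<mu>" using L M by (simp_all add: l_def \<mu>_def)
  have S: "0 < S" using e l by (simp add: S_def)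
  have S2: "S\<^sup>2 = e * l" using e l by (simp add: S_def)
  have A: "0 < A" using S l \<mu> by (simp add: A_def)
  have A2: "A\<^sup>2 = e / (\<mu>\<^sup>2 * l)"
    unfolding A_def power_divide S2 power_mult_distrib using l by (simp add: power2_eq_square)
  have eqv: "lattice_equivariant F" using res by (simp add: almost_horizontal_def)
  have \<beta>: "\<exists>a1 a2. linearized F e l c a1 a2 (\<beta> c)" for c
  proof -
    have "\<exists>b a1 a2. linearized F e l c a1 a2 b" using res unfolding almost_horizontal_def l_def by blast
    then show ?thesis unfolding \<beta>_def by (rule someI_ex)
  qed
  have \<beta>n: "norm (\<beta> c) \<le> e" for c using \<beta>[of c] by (auto simp: linearized_def)
  have \<beta>inv: "\<beta> (h \<odot> c) = \<beta> c" if "h \<in> \<H>\<^sub>\<int>" for h c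
    unfolding \<beta>_def linearized_translate[OF eqv that] ..
  have AR: "A\<^sup>2 * R = 2 * e" unfolding A2 R_def using l \<mu> by simp
  have mr: "real m = \<mu> * l" by (simp add: m_def \<mu>_def l_def)
  interpret W: wave_cells R \<delta> m A \<beta>
  proof
    show "0 < R" "0 < \<delta>" using l \<mu> by (simp_all add: R_def \<delta>_def)
    have "R * \<delta> = 2 / \<mu>" using l \<mu> by (simp add: R_def \<delta>_def power2_eq_square power3_eq_cube)
    then show "8 * (R * \<delta>) \<le> 1" using \<mu> by simp
    show "even m" "0 < m" using M L by (simp_all add: m_def)
    have "1 * (\<mu> * l) \<le> (2 * \<mu>) * (\<mu> * l)" using \<mu> l by (intro mult_right_mono) auto
    then show "real m \<le> R" unfolding mr R_def by (simp add: power2_eq_square mult.assoc mult.left_commute)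
    show "0 < A" by (rule A)
    show "norm (\<beta> c) \<le> A\<^sup>2 * R / 2" for c using \<beta>n[of c] unfolding AR by simp
  qed
  \<comment> \<open>the corrugation by which the map is multiplied from the right\<close>
  define \<omega> where "\<omega> p = (W.total_u p, W.total_v p, W.total_w p)" for p
  define F' where "F' p = F p \<odot> \<omega> p" for p
  have eqv': "lattice_equivariant F'"
    unfolding lattice_equivariant_def
  proof (intro ballI allI)
    fix h x assume h: "h \<in> \<H>\<^sub>\<int>"
    have "\<omega> (h \<odot> x) = \<omega> x" unfolding \<omega>_def W.totals_translate[OF h \<beta>inv[OF h]] ..
    moreover have "F (h \<odot> x) = h \<odot> F x" using eqv h by (simp add: lattice_equivariant_def)
    ultimately show "F' (h \<odot> x) = h \<odot> F' x" by (simp add: F'_def mult_assoc)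
  qed
  note ju = W.jet_total_u and jv = W.jet_total_v and jw = W.jet_total_w
  let ?k = "10 ^ 16 :: real"
  have dist: "hom_norm (incr (F p) (F' p)) \<le> 10 ^ 40 * A" for p
  proof -
    have "\<bar>W.total_u p\<bar> \<le> 10 ^ 40 * A" "\<bar>W.total_v p\<bar> \<le> 10 ^ 40 * A"
      using W.jetD(1)[OF ju[of p]] W.jetD(1)[OF jv[of p]] A by simp_all
    moreover have "\<bar>W.total_w p\<bar> \<le> (10 ^ 40 * A)\<^sup>2"
      using W.jetD(1)[OF jw[of p]] by (simp add: power_mult_distrib)
    ultimately show ?thesis unfolding F'_def incr_mult using A by (subst hom_norm_le_iff) (simp_all add: \<omega>_def)
  qed
  have AR1: "A * R = 2 * \<mu> * S" unfolding A_def R_def using l \<mu> by (simp add: power2_eq_square)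
  have AS: "A * S = e / \<mu>"
  proof -
    have "A * S = S\<^sup>2 / (\<mu> * l)" by (simp add: A_def power2_eq_square)
    then show ?thesis unfolding S2 using l by simp
  qed
  define e' where "e' = 10 ^ 40 * e / \<mu>"
  define l' where "l' = \<mu> ^ 3 * l"
  have el': "e' * l' = (10 ^ 20 * (\<mu> * S))\<^sup>2"
    unfolding power_mult_distrib S2 using \<mu> by (simp add: e'_def l'_def power2_eq_square power3_eq_cube)
  then have S': "sqrt (e' * l') = 10 ^ 20 * (\<mu> * S)" using \<mu> S by (simp add: real_sqrt_mult)
  have \<delta>l: "\<delta> \<le> 1 / l" "\<delta> = 1 / l'"
  proof -
    have "1 \<le> \<mu> ^ 3" using \<mu> by (simp add: one_le_power)
    then have "1 * l \<le> \<mu> ^ 3 * l" using l by (intro mult_right_mono) auto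
    then show "\<delta> \<le> 1 / l" unfolding \<delta>_def using l by (intro frac_le) auto
    show "\<delta> = 1 / l'" by (simp add: \<delta>_def l'_def)
  qed
  have "\<exists>a1 a2 b. linearized F' e' l' p a1 a2 b" for p
  proof -
    obtain a1 a2 where ap: "linearized F e l p a1 a2 (\<beta> p)" using \<beta> by blast
    define b where "b = \<beta> p"
    let ?u = "W.total_u" and ?v = "W.total_v" and ?w = "W.total_w"
    let ?gu = "W.grad_total_u p" and ?gv = "W.grad_total_v p" and ?gw = "W.grad_total_w p"
    note u = W.jetD[OF ju[of p]] and v = W.jetD[OF jv[of p]] and w = W.jetD[OF jw[of p]]
    define b' where "b' = (b - ?u p *\<^sub>R ?gv + ?gw) + (?v p *\<^sub>R a1 - ?u p *\<^sub>R a2)"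
    have a: "norm a1 \<le> S" "norm a2 \<le> S" using ap by (auto simp: linearized_def S_def)
    have \<mu>S: "S \<le> \<mu> * S" "0 \<le> \<mu> * S" using \<mu> S by simp_all
    have grads: "norm (a1 + ?gu) \<le> sqrt (e' * l')" "norm (a2 + ?gv) \<le> sqrt (e' * l')"
    proof -
      have k: "?k * A * R = 2 * ?k * (\<mu> * S)" unfolding mult.assoc AR1 by simp
      have "norm ?gu \<le> 2 * ?k * (\<mu> * S)" "norm ?gv \<le> 2 * ?k * (\<mu> * S)"
        unfolding k[symmetric] by (rule u(2), rule v(2))
      then show "norm (a1 + ?gu) \<le> sqrt (e' * l')" "norm (a2 + ?gv) \<le> sqrt (e' * l')"
        unfolding S' using norm_triangle_ineq[of a1 ?gu] norm_triangle_ineq[of a2 ?gv] a \<mu>S by simp_all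
    qed
    have nb: "norm b' \<le> e'"
    proof -
      have lip: "norm (\<beta> c - b) \<le> 80 * (e / \<mu>)" if c: "c \<in> W.near p" for c
      proof (cases "c = p")
        case True
        then show ?thesis using e \<mu> by (simp add: b_def)
      next
        case False
        define z where "z = incr c p"
        have z: "z \<noteq> 0"
        proof
          assume "z = 0"
          then have "c \<odot> incr c p = c" by (simp add: z_def)
          then show False using False by simp
        qed
        have nz: "norm z \<le> 5 / (\<mu> * l)" using W.near_incr_norm[OF c] unfolding mr z_def .
        also have "\<dots> \<le> 1 / (4 * l)" using \<mu> l by (simp add: field_simps)
        finally have z4: "norm z \<le> 1 / (4 * l)" .
        obtain c1 c2 where ac: "linearized F e l c c1 c2 (\<beta> c)" using \<beta> by blast
        have "linearized F e l (c \<odot> z) a1 a2 (\<beta> p)" using ap by (simp add: z_def)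
        from linearized_defect_lipschitz[OF ac this e l z z4]
        have "norm (b - \<beta> c) \<le> 16 * (e * l) * norm z" unfolding b_def .
        also have "\<dots> \<le> 16 * (e * l) * (5 / (\<mu> * l))" using e l nz by (intro mult_left_mono) auto
        also have "\<dots> = 80 * (e / \<mu>)" using l by simp
        finally show ?thesis by (simp add: norm_minus_commute)
      qed
      have n1: "A\<^sup>2 * real m \<le> e / \<mu>" unfolding A2 mr using l \<mu> by (simp add: power2_eq_square)
      have n2: "A\<^sup>2 * R / real m \<le> 2 * (e / \<mu>)"
      proof -
        have "2 * e / (\<mu> * l) \<le> 2 * e / (\<mu> * 1)" using e l \<mu> by (intro divide_left_mono mult_left_mono) auto
        then show ?thesis unfolding AR mr by simp
      qed
      have "norm (b - ?u p *\<^sub>R ?gv + ?gw) \<le> 4096 * (400 * (A\<^sup>2 * real m + (80 * (e / \<mu>) + A\<^sup>2 * R / real m)))"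
        by (rule W.wave_cancellation) (rule lip)
      also have "\<dots> \<le> 4096 * (400 * (e / \<mu> + (80 * (e / \<mu>) + 2 * (e / \<mu>))))"
        by (intro mult_left_mono add_mono n1 n2 order_refl) auto
      also have "\<dots> = 4096 * (400 * (83 * (e / \<mu>)))" by simp
      finally have "norm (b - ?u p *\<^sub>R ?gv + ?gw) \<le> 4096 * (400 * (83 * (e / \<mu>)))" .
      moreover have "norm (?v p *\<^sub>R a1) \<le> ?k * (e / \<mu>)" "norm (?u p *\<^sub>R a2) \<le> ?k * (e / \<mu>)"
      proof -
        have "\<bar>?v p\<bar> * norm a1 \<le> (?k * A) * S" "\<bar>?u p\<bar> * norm a2 \<le> (?k * A) * S"
          using u(1) v(1) a A by (auto intro!: mult_mono)
        then show "norm (?v p *\<^sub>R a1) \<le> ?k * (e / \<mu>)" "norm (?u p *\<^sub>R a2) \<le> ?k * (e / \<mu>)"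
          unfolding norm_scaleR mult.assoc AS by simp_all
      qed
      moreover have "norm b' \<le> norm (b - ?u p *\<^sub>R ?gv + ?gw) + (norm (?v p *\<^sub>R a1) + norm (?u p *\<^sub>R a2))"
        unfolding b'_def by (intro order_trans[OF norm_triangle_ineq] add_left_mono norm_triangle_ineq4)
      moreover have "0 \<le> e / \<mu>" using e \<mu> by simp
      ultimately show ?thesis unfolding e'_def by simp
    qed
    have taylor: "\<bar>xc (incr (F' p) (F' (p \<odot> x))) - (a1 + ?gu) \<bullet> x\<bar> \<le> sqrt (e' * l') * l' * (norm x)\<^sup>2 \<and>
       \<bar>yc (incr (F' p) (F' (p \<odot> x))) - (a2 + ?gv) \<bullet> x\<bar> \<le> sqrt (e' * l') * l' * (norm x)\<^sup>2 \<and>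
       \<bar>zc (incr (F' p) (F' (p \<odot> x))) - b' \<bullet> x\<bar> \<le> e' * l' * (norm x)\<^sup>2" if x: "norm x \<le> 1 / l'" for x
    proof -
      have x\<delta>: "norm x \<le> \<delta>" using x \<delta>l by simp
      have xl: "norm x \<le> 1 / l" using x\<delta> \<delta>l by simp
      define q where "q = p \<odot> x"
      define t where "t = (norm x)\<^sup>2"
      have t: "0 \<le> t" by (simp add: t_def)
      define f1 f2 f3 where "f1 = xc (incr (F p) (F q))" and "f2 = yc (incr (F p) (F q))" and "f3 = zc (incr (F p) (F q))"
      have f: "\<bar>f1 - a1 \<bullet> x\<bar> \<le> S * l * t" "\<bar>f2 - a2 \<bullet> x\<bar> \<le> S * l * t" "\<bar>f3 - b \<bullet> x\<bar> \<le> S\<^sup>2 * t"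
        using ap[unfolded linearized_def, THEN conjunct2, THEN conjunct2, THEN conjunct2, rule_format, OF xl]
        unfolding S2 S_def[symmetric] q_def[symmetric] t_def[symmetric] f1_def[symmetric] f2_def[symmetric]
          f3_def[symmetric] b_def[symmetric] by simp_all
      have f1: "\<bar>f1\<bar> \<le> 2 * S * norm x"
        using linearized_horizontal_le(1)[OF ap e _ xl] l unfolding f1_def q_def S_def by simp
      define du dv dw where "du = ?u q - ?u p" and "dv = ?v q - ?v p" and "dw = ?w q - ?w p"
      have AR2: "?k * A * R\<^sup>2 = ?k * (4 * \<mu> ^ 3 * l * S)"
      proof -
        have "A * R\<^sup>2 = (A * R) * R" by (simp add: power2_eq_square)
        also have "\<dots> = 4 * \<mu> ^ 3 * l * S" unfolding AR1 unfolding R_def by (simp add: power2_eq_square power3_eq_cube)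
        finally show ?thesis unfolding mult.assoc[of ?k A "R\<^sup>2"] by simp
      qed
      have duv: "\<bar>du - ?gu \<bullet> x\<bar> \<le> ?k * (4 * \<mu> ^ 3 * l * S) * t" "\<bar>dv - ?gv \<bullet> x\<bar> \<le> ?k * (4 * \<mu> ^ 3 * l * S) * t"
        using u(3)[OF x\<delta>] v(3)[OF x\<delta>] unfolding AR2 du_def dv_def q_def t_def by simp_all
      have A2R2: "10 ^ 33 * A\<^sup>2 * R\<^sup>2 = 4 * 10 ^ 33 * (\<mu> * S)\<^sup>2"
      proof -
        have "A\<^sup>2 * R\<^sup>2 = (2 * \<mu> * S)\<^sup>2" unfolding AR1[symmetric] by (simp add: power_mult_distrib)
        then show ?thesis unfolding mult.assoc[of "10 ^ 33" "A\<^sup>2" "R\<^sup>2"] by (simp add: power_mult_distrib)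
      qed
      have dw': "\<bar>dw - ?gw \<bullet> x\<bar> \<le> 4 * 10 ^ 33 * (\<mu> * S)\<^sup>2 * t"
        using w(3)[OF x\<delta>] unfolding A2R2 dw_def q_def t_def by simp
      have dv1: "\<bar>dv\<bar> \<le> 4 * ?k * (\<mu> * S) * norm x"
        using W.jet_increment[OF jv x\<delta>] AR1 unfolding dv_def q_def by (simp add: mult.assoc)
      have 1: "xc (incr (F' p) (F' q)) = f1 + du" "yc (incr (F' p) (F' q)) = f2 + dv"
        by (simp_all add: F'_def \<omega>_def f1_def f2_def du_def dv_def)
      have 2: "zc (incr (F' p) (F' q)) = f3 + dw + f1 * ?v q - ?u p * f2 - ?u p * dv"
        by (simp add: F'_def \<omega>_def f1_def f2_def f3_def dv_def dw_def algebra_simps)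
      have l'S: "sqrt (e' * l') * l' = 10 ^ 20 * (\<mu> * (\<mu> ^ 3 * l * S))"
        unfolding S' unfolding l'_def by simp
      define Q where "Q = \<mu> ^ 3 * l * S"
      have Q0: "0 \<le> Q" using \<mu> l S by (simp add: Q_def)
      have Q1: "Q \<le> \<mu> * Q" using mult_right_mono[of 1 \<mu> Q] \<mu> Q0 by simp
      have Q2: "S * l \<le> Q"
        unfolding Q_def using mult_right_mono[OF one_le_power[of \<mu> 3], of "S * l"] \<mu> l S by (simp add: mult_ac)
      have Tu: "S * l * t + ?k * (4 * \<mu> ^ 3 * l * S) * t \<le> sqrt (e' * l') * l' * t"
      proof -
        have "S * l + ?k * (4 * Q) \<le> 10 ^ 20 * (\<mu> * Q)" using Q0 Q1 Q2 by simp
        then have "(S * l + ?k * (4 * Q)) * t \<le> 10 ^ 20 * (\<mu> * Q) * t" using t by (rule mult_right_mono)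
        then show ?thesis unfolding l'S Q_def distrib_right by (simp only: mult.assoc)
      qed
      have "(a1 + ?gu) \<bullet> x = a1 \<bullet> x + ?gu \<bullet> x" "(a2 + ?gv) \<bullet> x = a2 \<bullet> x + ?gv \<bullet> x" by (simp_all add: inner_add_left)
      then have T12: "\<bar>f1 + du - (a1 + ?gu) \<bullet> x\<bar> \<le> sqrt (e' * l') * l' * t"
          "\<bar>f2 + dv - (a2 + ?gv) \<bullet> x\<bar> \<le> sqrt (e' * l') * l' * t"
        using f(1,2) duv Tu by linarith+
      let ?N = "(\<mu> * S)\<^sup>2 * t"
      have \<mu>2: "1 \<le> \<mu>\<^sup>2" using \<mu> by (simp add: one_le_power)
      have N: "S\<^sup>2 * t \<le> ?N" "0 \<le> ?N"
        using t mult_right_mono[OF \<mu>2, of "S\<^sup>2"] by (auto simp: power_mult_distrib intro!: mult_right_mono)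
      have AlS: "A * (S * l) \<le> S\<^sup>2"
      proof -
        have "A * (S * l) = S\<^sup>2 / \<mu>" unfolding A_def using l by (simp add: power2_eq_square)
        also have "\<dots> \<le> S\<^sup>2 / 1" using \<mu> by (intro divide_left_mono) auto
        finally show ?thesis by simp
      qed
      have t1: "\<bar>?v p * (f1 - a1 \<bullet> x)\<bar> \<le> ?k * ?N" "\<bar>?u p * (f2 - a2 \<bullet> x)\<bar> \<le> ?k * ?N"
      proof -
        have "?k * A * (S * l * t) = ?k * (A * (S * l)) * t" by simp
        also have "\<dots> \<le> ?k * S\<^sup>2 * t" using AlS t by (intro mult_right_mono mult_left_mono) auto
        also have "\<dots> \<le> ?k * ?N" using N by simp
        finally have k: "?k * A * (S * l * t) \<le> ?k * ?N" .
        have "\<bar>?v p * (f1 - a1 \<bullet> x)\<bar> \<le> ?k * A * (S * l * t)" "\<bar>?u p * (f2 - a2 \<bullet> x)\<bar> \<le> ?k * A * (S * l * t)"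
          unfolding abs_mult using u(1) v(1) f(1,2) A by (auto intro!: mult_mono)
        with k show "\<bar>?v p * (f1 - a1 \<bullet> x)\<bar> \<le> ?k * ?N" "\<bar>?u p * (f2 - a2 \<bullet> x)\<bar> \<le> ?k * ?N" by linarith+
      qed
      have t2: "\<bar>?u p * (dv - ?gv \<bullet> x)\<bar> \<le> 4 * ?k\<^sup>2 * ?N"
      proof -
        have "\<bar>?u p * (dv - ?gv \<bullet> x)\<bar> \<le> (?k * A) * (?k * (4 * \<mu> ^ 3 * l * S) * t)"
          unfolding abs_mult using A by (intro mult_mono u(1) duv(2)) simp_all
        also have "\<dots> = 4 * ?k\<^sup>2 * (A * (\<mu> * l) * (\<mu>\<^sup>2 * S)) * t" by (simp add: power2_eq_square power3_eq_cube)
        also have "A * (\<mu> * l) = S" using l \<mu> by (simp add: A_def)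
        also have "S * (\<mu>\<^sup>2 * S) = (\<mu> * S)\<^sup>2" by (simp add: power2_eq_square)
        finally show ?thesis by simp
      qed
      have t3: "\<bar>f1 * dv\<bar> \<le> 8 * ?k * ?N"
      proof -
        have "\<bar>f1 * dv\<bar> \<le> (2 * S * norm x) * (4 * ?k * (\<mu> * S) * norm x)"
          unfolding abs_mult using f1 dv1 S by (intro mult_mono) auto
        also have "\<dots> = 8 * ?k * ((S * (\<mu> * S)) * t)" by (simp add: t_def power2_eq_square)
        also have "\<dots> \<le> 8 * ?k * (((\<mu> * S) * (\<mu> * S)) * t)"
          using \<mu>S(1) t S \<mu> by (intro mult_left_mono mult_right_mono) auto
        finally show ?thesis by (simp add: power2_eq_square)
      qed
      have abs6: "\<bar>r1 + r2 + r3 + r4 - r5 - r6\<bar> \<le> s1 + s2 + s3 + s4 + s5 + s6"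
        if "\<bar>r1\<bar> \<le> s1" "\<bar>r2\<bar> \<le> s2" "\<bar>r3\<bar> \<le> s3" "\<bar>r4\<bar> \<le> s4" "\<bar>r5\<bar> \<le> s5" "\<bar>r6\<bar> \<le> s6"
        for r1 r2 r3 r4 r5 r6 s1 s2 s3 s4 s5 s6 :: real
        using that by linarith
      have dw'': "\<bar>dw - ?gw \<bullet> x\<bar> \<le> 4 * 10 ^ 33 * ?N" using dw' by (simp only: mult.assoc)
      have "zc (incr (F' p) (F' q)) - b' \<bullet> x = (f3 - b \<bullet> x) + (dw - ?gw \<bullet> x) + ?v p * (f1 - a1 \<bullet> x)
          + f1 * dv - ?u p * (f2 - a2 \<bullet> x) - ?u p * (dv - ?gv \<bullet> x)"
        unfolding 2 b'_def by (simp add: inner_add_left inner_diff_left algebra_simps dv_def)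
      then have "\<bar>zc (incr (F' p) (F' q)) - b' \<bullet> x\<bar> \<le> S\<^sup>2 * t + 4 * 10 ^ 33 * ?N + ?k * ?N + 8 * ?k * ?N + ?k * ?N + 4 * ?k\<^sup>2 * ?N"
        using abs6[OF f(3) dw'' t1(1) t3 t1(2) t2] by (simp only:)
      also have "\<dots> \<le> 10 ^ 40 * ?N"
      proof -
        have "r + 4 * 10 ^ 33 * n + ?k * n + 8 * ?k * n + ?k * n + 4 * ?k\<^sup>2 * n \<le> 10 ^ 40 * n"
          if "r \<le> n" "0 \<le> n" for r n :: real
          using that by simp
        then show ?thesis using N by blast
      qed
      also have "10 ^ 40 * ?N = e' * l' * t" unfolding el' by (simp add: power_mult_distrib)
      finally show ?thesis using T12 unfolding q_def[symmetric] 1 t_def[symmetric] by blast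
    qed
    show ?thesis
      unfolding linearized_def using grads nb taylor by blast
  qed
  then have "almost_horizontal F' e' l'" using eqv' by (simp add: almost_horizontal_def)
  moreover have "A = sqrt (e / (\<mu>\<^sup>2 * l))" using A A2 by (metis less_imp_le real_sqrt_unique)
  ultimately show thesis
    using that[of F'] dist by (simp add: e'_def l'_def \<mu>_def l_def)
qed

section \<open>The limit map\<close>

lemma real_sequence_converges:
  fixes s c :: "nat \<Rightarrow> real"
  assumes "\<And>k j. \<bar>s (k + j) - s k\<bar> \<le> c k" and "c \<longlonglongrightarrow> 0"
  obtains x where "s \<longlonglongrightarrow> x"
proof -
  have "Cauchy s"
  proof (rule CauchyI)
    fix e :: real assume e: "0 < e"
    then have "\<forall>\<^sub>F k in sequentially. c k < e / 2" using assms(2) by (intro order_tendstoD) auto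
    then obtain k where k: "c k < e / 2" by (meson eventually_happens sequentially_bot)
    show "\<exists>K. \<forall>m\<ge>K. \<forall>n\<ge>K. norm (s m - s n) < e"
    proof (intro exI[of _ k] allI impI)
      fix m n assume "k \<le> m" "k \<le> n"
      then obtain i j where "m = k + i" "n = k + j" using le_Suc_ex by blast
      then show "norm (s m - s n) < e" using assms(1)[of k i] assms(1)[of k j] k by simp
    qed
  qed
  then show thesis using that Cauchy_convergent convergent_def by blast
qed

lemma hom_norm_complete:
  fixes P :: "nat \<Rightarrow> heis"
  assumes P: "\<And>k j. hom_norm (incr (P k) (P (k + j))) \<le> c k" and c: "c \<longlonglongrightarrow> 0"
  obtains q where "\<And>k. hom_norm (incr (P k) q) \<le> c k"
proof -
  have c0: "0 \<le> c k" for k using P[of k 0] hom_norm_nonneg order_trans by blast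
  note b = hom_norm_bounds[of "incr (P k) (P (k + j))" for k j, simplified]
  have x: "\<bar>xc (P (k + j)) - xc (P k)\<bar> \<le> c k" for k j using b(1)[of k j] P[of k j] by linarith
  have y: "\<bar>yc (P (k + j)) - yc (P k)\<bar> \<le> c k" for k j using b(2)[of k j] P[of k j] by linarith
  have z: "\<bar>zc (incr (P k) (P (k + j)))\<bar> \<le> (c k)\<^sup>2" for k j
    using hom_norm_bounds(3)[of "incr (P k) (P (k + j))"] power_mono[OF P[of k j] hom_norm_nonneg, of 2] by linarith
  obtain qx where qx: "(\<lambda>n. xc (P n)) \<longlonglongrightarrow> qx" by (rule real_sequence_converges[OF x c])
  obtain qy where qy: "(\<lambda>n. yc (P n)) \<longlonglongrightarrow> qy" by (rule real_sequence_converges[OF y c])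
  define B where "B = \<bar>xc (P 0)\<bar> + c 0"
  have B: "\<bar>xc (P k)\<bar> \<le> B" for k using x[of 0 k] by (simp add: B_def)
  have "\<bar>zc (P (k + j)) - zc (P k)\<bar> \<le> (c k)\<^sup>2 + B * c k" for k j
  proof -
    have "\<bar>xc (P k) * (yc (P (k + j)) - yc (P k))\<bar> \<le> B * c k"
      unfolding abs_mult using B[of k] y[of k j] by (intro mult_mono) (auto intro: order_trans[OF abs_ge_zero])
    then show ?thesis using z[of k j] by simp
  qed
  moreover have "(\<lambda>k. (c k)\<^sup>2 + B * c k) \<longlonglongrightarrow> 0"
    using c by (auto intro!: tendsto_eq_intros)
  ultimately obtain qz where qz: "(\<lambda>n. zc (P n)) \<longlonglongrightarrow> qz" by (rule real_sequence_converges)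
  have "hom_norm (incr (P k) (qx, qy, qz)) \<le> c k" for k
  proof (subst hom_norm_le_iff[OF c0], intro conjI)
    have shift: "(\<lambda>j. xc (P (k + j))) \<longlonglongrightarrow> qx" "(\<lambda>j. yc (P (k + j))) \<longlonglongrightarrow> qy" "(\<lambda>j. zc (P (k + j))) \<longlonglongrightarrow> qz"
      using LIMSEQ_ignore_initial_segment[OF qx, of k] LIMSEQ_ignore_initial_segment[OF qy, of k]
        LIMSEQ_ignore_initial_segment[OF qz, of k] by (simp_all add: add.commute)
    have "(\<lambda>j. \<bar>xc (P (k + j)) - xc (P k)\<bar>) \<longlonglongrightarrow> \<bar>qx - xc (P k)\<bar>" by (intro tendsto_intros shift)
    then show "\<bar>xc (incr (P k) (qx, qy, qz))\<bar> \<le> c k" using x by (simp add: LIMSEQ_le_const2)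
    have "(\<lambda>j. \<bar>yc (P (k + j)) - yc (P k)\<bar>) \<longlonglongrightarrow> \<bar>qy - yc (P k)\<bar>" by (intro tendsto_intros shift)
    then show "\<bar>yc (incr (P k) (qx, qy, qz))\<bar> \<le> c k" using y by (simp add: LIMSEQ_le_const2)
    have "(\<lambda>j. \<bar>zc (incr (P k) (P (k + j)))\<bar>) \<longlonglongrightarrow> \<bar>zc (incr (P k) (qx, qy, qz))\<bar>"
      unfolding incr_coords fst_conv snd_conv by (intro tendsto_intros shift)
    then show "\<bar>zc (incr (P k) (qx, qy, qz))\<bar> \<le> (c k)\<^sup>2" using z by (intro LIMSEQ_le_const2) auto
  qed
  then show thesis by (rule that)
qed

lemma incr_eq_zero: "hom_norm (incr p q) = 0 \<Longrightarrow> p = q"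
  using hom_norm_bounds[of "incr p q"] by (intro heis_eqI) auto

lemma linearized_hom_norm_le:
  assumes ap: "linearized F e l p a1 a2 b" and e: "0 < e" and l: "0 < l" and u: "norm u \<le> 1 / l"
  shows "hom_norm (incr (F p) (F (p \<odot> u))) \<le> 2 * sqrt (e * norm u)"
proof -
  have lu: "l * norm u \<le> 1" using u l by (simp add: field_simps)
  have "sqrt (e * l) * norm u = sqrt (e * norm u) * sqrt (l * norm u)"
    using e l by (simp add: real_sqrt_mult)
  also have "\<dots> \<le> sqrt (e * norm u) * 1" using lu e by (intro mult_left_mono) auto
  finally have h: "2 * sqrt (e * l) * norm u \<le> 2 * sqrt (e * norm u)" by simp
  have "\<bar>b \<bullet> u\<bar> \<le> e * norm u"
    using Cauchy_Schwarz_ineq2[of b u] mult_right_mono[of "norm b" e "norm u"] ap by (auto simp: linearized_def)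
  moreover have "e * l * (norm u)\<^sup>2 \<le> e * norm u"
  proof -
    have "(e * norm u) * (l * norm u) \<le> (e * norm u) * 1" using lu e by (intro mult_left_mono) auto
    then show ?thesis by (simp add: power2_eq_square algebra_simps)
  qed
  moreover have "\<bar>zc (incr (F p) (F (p \<odot> u))) - b \<bullet> u\<bar> \<le> e * l * (norm u)\<^sup>2"
    using ap u unfolding linearized_def by blast
  ultimately have "\<bar>zc (incr (F p) (F (p \<odot> u)))\<bar> \<le> 2 * (e * norm u)" by linarith
  also have "\<dots> \<le> (2 * sqrt (e * norm u))\<^sup>2" using e by (simp add: power_mult_distrib)
  finally show ?thesis
    using linearized_horizontal_le[OF ap e l u] h e by (subst hom_norm_le_iff) auto
qed

lemma scale_selection:
  fixes a t :: real
  assumes a: "1 < a" and t: "0 < t" "t \<le> 1"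
  obtains k where "t \<le> 1 / a ^ k" "1 / a ^ Suc k < t"
proof -
  define k where "k = (LEAST k. 1 / t < a ^ Suc k)"
  obtain n where "1 / t < a ^ n" using a real_arch_pow by blast
  then have "1 / t < a ^ Suc n" using power_strict_increasing[of n "Suc n" a] a by (meson lessI order_less_trans)
  then have k: "1 / t < a ^ Suc k" unfolding k_def by (rule LeastI)
  have "a ^ k \<le> 1 / t"
  proof (cases k)
    case (Suc j)
    then have "\<not> 1 / t < a ^ Suc j" using not_less_Least[of j "\<lambda>k. 1 / t < a ^ Suc k"] by (simp add: k_def)
    then show ?thesis using Suc by simp
  qed (use t in simp)
  then show thesis using that[of k] k t a by (simp add: field_simps)
qed

text \<open>
  With \<open>s = 2\<alpha> - 1 < 1/3\<close>, the condition \<open>C0/M \<le> M\<^bsup>-3s\<^esup>\<close> makes the errors decay like \<open>l\<^bsup>-s\<^esup>\<close>; it holds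
  for large \<open>M\<close> because \<open>C0\<close> is independent of \<open>M\<close>.  A displacement of length \<open>t\<close> is compared at the
  stage with \<open>1/l\<close> just above \<open>t\<close>: there the stage map moves by \<open>sqrt (e t)\<close>, and the
  distance from the stage map to the limit has the same order because the corrections
  form a geometric series.
\<close>
theorem exists_holder_map_above_half:
  fixes \<alpha> :: real
  assumes \<alpha>: "1 / 2 < \<alpha>" "\<alpha> < 2 / 3"
  obtains g C where "lattice_equivariant g" "0 < C"
    "\<And>p u. norm u \<le> 1 \<Longrightarrow> hom_norm (incr (g p) (g (p \<odot> u))) \<le> C * norm u powr \<alpha>"
proof -
  define s where "s = 2 * \<alpha> - 1"
  have s: "0 < s" "0 < 1 - 3 * s" using \<alpha> by (simp_all add: s_def)
  define C0 :: real where "C0 = 10 ^ 40"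
  have C0: "1 < C0" by (simp add: C0_def)
  define n where "n = nat \<lceil>C0 powr (1 / (1 - 3 * s))\<rceil>"
  define M where "M = 2 * (n + 16)"
  have M: "even M" "32 \<le> M" by (simp_all add: M_def)
  define \<mu> where "\<mu> = real M"
  have \<mu>: "32 \<le> \<mu>" using M by (simp add: \<mu>_def)
  have "C0 powr (1 / (1 - 3 * s)) \<le> \<mu>"
    using real_nat_ceiling_ge[of "C0 powr (1 / (1 - 3 * s))"] by (simp add: \<mu>_def M_def flip: n_def)
  then have "(C0 powr (1 / (1 - 3 * s))) powr (1 - 3 * s) \<le> \<mu> powr (1 - 3 * s)"
    using s by (intro powr_mono2) auto
  then have C\<mu>: "C0 \<le> \<mu> powr (1 - 3 * s)" using s C0 by (simp add: powr_powr)
  also have "\<dots> \<le> \<mu> powr 1" using s \<mu> by (intro powr_mono) auto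
  finally have C\<mu>1: "C0 \<le> \<mu>" using \<mu> by simp
  define e where "e k = (C0 / \<mu>) ^ k" for k
  define L where "L k = (M ^ 3) ^ k" for k
  have e: "0 < e k" for k using C0 \<mu> by (simp add: e_def)
  have L: "1 \<le> L k" for k using M by (simp add: L_def one_le_power)
  define A where "A k = C0 * sqrt (e k / (M\<^sup>2 * L k))" for k
  have "\<exists>F. \<forall>k. almost_horizontal (F k) (e k) (L k) \<and> (\<forall>p. hom_norm (incr (F k p) (F (Suc k) p)) \<le> A k)"
  proof (rule dependent_nat_choice)
    show "\<exists>F. almost_horizontal F (e 0) (L 0)" using almost_horizontal_id by (auto simp: e_def L_def)
    fix F k assume F: "almost_horizontal F (e k) (L k)"
    obtain F' where "almost_horizontal F' (10 ^ 40 * e k / M) (M ^ 3 * L k)"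
      "\<And>p. hom_norm (incr (F p) (F' p)) \<le> 10 ^ 40 * sqrt (e k / (M\<^sup>2 * L k))"
      using corrugation_stage[OF F e L M] by blast
    moreover have "10 ^ 40 * e k / M = e (Suc k)" by (simp add: e_def C0_def \<mu>_def)
    moreover have "M ^ 3 * L k = L (Suc k)" by (simp add: L_def)
    ultimately show "\<exists>F'. almost_horizontal F' (e (Suc k)) (L (Suc k)) \<and> (\<forall>p. hom_norm (incr (F p) (F' p)) \<le> A k)"
      unfolding A_def C0_def by metis
  qed
  then obtain F where F: "\<And>k. almost_horizontal (F k) (e k) (L k)"
    "\<And>k p. hom_norm (incr (F k p) (F (Suc k) p)) \<le> A k" by blast
  have A0: "0 \<le> A k" for k using e[of k] C0 by (simp add: A_def)
  have Ahalf: "A (Suc k) \<le> A k / 2" for k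
  proof -
    have "e (Suc k) / (M\<^sup>2 * L (Suc k)) = (C0 / \<mu> ^ 4) * (e k / (M\<^sup>2 * L k))"
      by (simp add: e_def L_def \<mu>_def power4_eq_xxxx power3_eq_cube)
    also have "\<dots> \<le> (1 / 2)\<^sup>2 * (e k / (M\<^sup>2 * L k))"
    proof (rule mult_right_mono)
      have "C0 / \<mu> ^ 4 \<le> \<mu> / \<mu> ^ 4" using C\<mu>1 \<mu> by (intro divide_right_mono) auto
      also have "\<dots> = 1 / \<mu> ^ 3" using \<mu> by (simp add: power4_eq_xxxx power3_eq_cube)
      also have "\<dots> \<le> 1 / 32 ^ 3" using \<mu> by (intro divide_left_mono power_mono) auto
      also have "\<dots> \<le> (1 / 2)\<^sup>2" by (simp add: power2_eq_square)
      finally show "C0 / \<mu> ^ 4 \<le> (1 / 2)\<^sup>2" .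
    qed (use e[of k] in simp)
    finally have "sqrt (e (Suc k) / (M\<^sup>2 * L (Suc k))) \<le> sqrt ((1 / 2)\<^sup>2 * (e k / (M\<^sup>2 * L k)))" by simp
    also have "\<dots> = 1 / 2 * sqrt (e k / (M\<^sup>2 * L k))" unfolding real_sqrt_mult[of "(1 / 2)\<^sup>2"] by simp
    finally have "C0 * sqrt (e (Suc k) / (M\<^sup>2 * L (Suc k))) \<le> C0 * (1 / 2 * sqrt (e k / (M\<^sup>2 * L k)))"
      using C0 by (intro mult_left_mono) auto
    then show ?thesis by (simp add: A_def)
  qed
  have Apow: "A k \<le> A 0 * (1 / 2) ^ k" for k
  proof (induction k)
    case (Suc k)
    then show ?case using Ahalf[of k] by simp
  qed simp
  have Alim: "A \<longlonglongrightarrow> 0"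
  proof (rule tendsto_sandwich[OF _ _ tendsto_const])
    show "(\<lambda>k. A 0 * (1 / 2) ^ k) \<longlonglongrightarrow> 0"
      using LIMSEQ_realpow_zero[of "1 / 2 :: real"] by (auto intro!: tendsto_mult_right_zero)
  qed (use A0 Apow in auto)
  \<comment> \<open>Subtracting \<open>2 A (k + j)\<close> leaves room for the next correction, which makes the induction go through.\<close>
  have tail: "hom_norm (incr (F k p) (F (k + j) p)) \<le> 2 * A k - 2 * A (k + j)" for k j p
  proof (induction j)
    case (Suc j)
    have "hom_norm (incr (F k p) (F (k + Suc j) p)) \<le> hom_norm (incr (F k p) (F (k + j) p)) + hom_norm (incr (F (k + j) p) (F (k + Suc j) p))"
      by (rule hom_norm_incr_triangle)
    also have "\<dots> \<le> (2 * A k - 2 * A (k + j)) + A (k + j)" using Suc F(2)[of "k + j" p] by simp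
    also have "\<dots> \<le> 2 * A k - 2 * A (k + Suc j)" using Ahalf[of "k + j"] by simp
    finally show ?case .
  qed simp
  have "\<exists>q. \<forall>k. hom_norm (incr (F k p) q) \<le> 2 * A k" for p
  proof -
    have "hom_norm (incr (F k p) (F (k + j) p)) \<le> 2 * A k" for k j
      using tail[of k p j] A0[of "k + j"] by linarith
    moreover have "(\<lambda>k. 2 * A k) \<longlonglongrightarrow> 0" using Alim by (rule tendsto_mult_right_zero)
    ultimately obtain q where "\<And>k. hom_norm (incr (F k p) q) \<le> 2 * A k"
      by (rule hom_norm_complete[where P = "\<lambda>k. F k p"]) blast
    then show ?thesis by blast
  qed
  then obtain g where g: "\<And>p k. hom_norm (incr (F k p) (g p)) \<le> 2 * A k" by metis
  have g': "hom_norm (incr (g p) (F k p)) \<le> 4 * A k" for p k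
    using hom_norm_incr_swap[of "g p" "F k p"] g[of k p] by linarith
  have equi: "lattice_equivariant g"
    unfolding lattice_equivariant_def
  proof (intro ballI allI)
    fix h x assume h: "h \<in> \<H>\<^sub>\<int>"
    have "hom_norm (incr (g (h \<odot> x)) (h \<odot> g x)) \<le> 6 * A k" for k
    proof -
      have "F k (h \<odot> x) = h \<odot> F k x" using F(1)[of k] h by (simp add: almost_horizontal_def lattice_equivariant_def)
      then have "hom_norm (incr (F k (h \<odot> x)) (h \<odot> g x)) \<le> 2 * A k" using g[of k x] by simp
      then show ?thesis
        using hom_norm_incr_triangle[of "g (h \<odot> x)" "h \<odot> g x" "F k (h \<odot> x)"] g'[of "h \<odot> x" k] by linarith
    qed
    note le = this
    have "(\<lambda>k. 6 * A k) \<longlonglongrightarrow> 0" using Alim by (rule tendsto_mult_right_zero)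
    then have "hom_norm (incr (g (h \<odot> x)) (h \<odot> g x)) \<le> 0"
      by (rule LIMSEQ_le_const) (use le in blast)
    then show "g (h \<odot> x) = h \<odot> g x" using hom_norm_nonneg by (intro incr_eq_zero) (simp add: antisym)
  qed
  define C where "C = (6 * C0 * sqrt \<mu> + 2) * sqrt (\<mu> powr (3 * s))"
  have C: "0 < C" using C0 \<mu> by (simp add: C_def add_nonneg_pos)
  have "hom_norm (incr (g p) (g (p \<odot> u))) \<le> C * norm u powr \<alpha>" if u: "norm u \<le> 1" for p u
  proof (cases "u = 0")
    case False
    define t where "t = norm u"
    have t: "0 < t" "t \<le> 1" using False u by (simp_all add: t_def)
    have "1 < \<mu> ^ 3" using \<mu> by (simp add: one_less_power)
    then obtain k where "t \<le> 1 / (\<mu> ^ 3) ^ k" "1 / (\<mu> ^ 3) ^ Suc k < t" by (rule scale_selection[OF _ t])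
    then have k: "t \<le> 1 / L k" "1 / (\<mu> ^ 3 * L k) < t" by (simp_all add: L_def \<mu>_def)
    have Lk: "0 < real (L k)" using L[of k] by linarith
    have inv: "1 / L k \<le> \<mu> ^ 3 * t" using k(2) Lk \<mu> by (simp add: field_simps)
    obtain a1 a2 b where ap: "linearized (F k) (e k) (L k) p a1 a2 b" using F(1)[of k] unfolding almost_horizontal_def by blast
    have mid: "hom_norm (incr (F k p) (F k (p \<odot> u))) \<le> 2 * sqrt (e k * t)"
      using linearized_hom_norm_le[OF ap e Lk, of u] k(1) unfolding t_def by blast
    have Ak: "A k \<le> C0 * sqrt \<mu> * sqrt (e k * t)"
    proof -
      have "e k / (M\<^sup>2 * L k) = e k / \<mu>\<^sup>2 * (1 / L k)" by (simp add: \<mu>_def)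
      also have "\<dots> \<le> e k / \<mu>\<^sup>2 * (\<mu> ^ 3 * t)" using inv e[of k] by (intro mult_left_mono) auto
      also have "\<dots> = \<mu> * (e k * t)" using \<mu> by (simp add: power2_eq_square power3_eq_cube)
      finally have "sqrt (e k / (M\<^sup>2 * L k)) \<le> sqrt (\<mu> * (e k * t))" by simp
      then show ?thesis unfolding A_def real_sqrt_mult mult.assoc using C0 by (intro mult_left_mono) auto
    qed
    have "hom_norm (incr (g p) (g (p \<odot> u))) \<le> 4 * A k + 2 * sqrt (e k * t) + 2 * A k"
      using hom_norm_incr_triangle[of "g p" "g (p \<odot> u)" "F k p"]
        hom_norm_incr_triangle[of "F k p" "g (p \<odot> u)" "F k (p \<odot> u)"] g'[of p k] mid g[of k "p \<odot> u"] by linarith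
    also have "\<dots> \<le> 6 * (C0 * sqrt \<mu> * sqrt (e k * t)) + 2 * sqrt (e k * t)" using Ak by simp
    also have "\<dots> = (6 * C0 * sqrt \<mu> + 2) * sqrt (e k * t)" by (simp add: algebra_simps)
    also have "\<dots> \<le> (6 * C0 * sqrt \<mu> + 2) * (sqrt (\<mu> powr (3 * s)) * t powr \<alpha>)"
    proof (rule mult_left_mono)
      have "C0 / \<mu> \<le> \<mu> powr (1 - 3 * s) / \<mu>" using C\<mu> \<mu> by (intro divide_right_mono) auto
      also have "\<dots> = \<mu> powr (- 3 * s)" using \<mu> by (simp add: powr_diff powr_minus_divide)
      finally have "e k \<le> (\<mu> powr (- 3 * s)) ^ k" unfolding e_def using C0 \<mu> by (intro power_mono) auto
      also have "\<dots> = (1 / L k) powr s"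
      proof -
        have "1 / L k = \<mu> powr (- 3 * real k)"
          using \<mu> by (simp add: L_def \<mu>_def powr_minus_divide power_mult[symmetric] flip: powr_realpow)
        then have "(1 / L k) powr s = \<mu> powr (- 3 * real k * s)" by (simp add: powr_powr)
        then show ?thesis using \<mu> by (simp add: powr_powr mult_ac flip: powr_realpow)
      qed
      also have "\<dots> \<le> (\<mu> ^ 3 * t) powr s" using inv s Lk by (intro powr_mono2) auto
      also have "\<dots> = \<mu> powr (3 * s) * t powr s"
      proof -
        have m3: "\<mu> ^ 3 = \<mu> powr 3" using \<mu> by simp
        have "(\<mu> ^ 3) powr s = \<mu> powr (3 * s)" unfolding m3 powr_powr ..
        then show ?thesis using \<mu> t by (simp add: powr_mult)
      qed
      finally have "e k * t \<le> \<mu> powr (3 * s) * t powr s * t" using t by (intro mult_right_mono) auto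
      also have "\<dots> = \<mu> powr (3 * s) * (t powr \<alpha>)\<^sup>2"
      proof -
        have "(t powr \<alpha>)\<^sup>2 = t powr (s + 1)" by (simp add: s_def power2_eq_square flip: powr_add)
        then show ?thesis using t by (simp add: powr_add)
      qed
      finally have "sqrt (e k * t) \<le> sqrt (\<mu> powr (3 * s) * (t powr \<alpha>)\<^sup>2)" by simp
      then show "sqrt (e k * t) \<le> sqrt (\<mu> powr (3 * s)) * t powr \<alpha>" by (simp add: real_sqrt_mult)
    qed (use C0 \<mu> in simp)
    finally show ?thesis by (simp add: C_def t_def mult.assoc)
  qed (use C in simp)
  with equi C show thesis by (rule that)
qed

text \<open>
  A larger exponent is a stronger condition on displacements of length at most one, so exponents
  up to one half are covered by any fixed exponent above it.
\<close>
lemma exists_holder_map: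
  fixes \<alpha> :: real
  assumes \<alpha>: "0 < \<alpha>" "\<alpha> < 2 / 3"
  obtains g C where "lattice_equivariant g" "0 < C"
    "\<And>p u. norm u \<le> 1 \<Longrightarrow> hom_norm (incr (g p) (g (p \<odot> u))) \<le> C * norm u powr \<alpha>"
proof -
  define \<alpha>' where "\<alpha>' = max \<alpha> (7 / 12)"
  have "1 / 2 < \<alpha>'" "\<alpha>' < 2 / 3" "\<alpha> \<le> \<alpha>'" using \<alpha> by (auto simp: \<alpha>'_def)
  then obtain g C where g: "lattice_equivariant g" "0 < C"
    "\<And>p u. norm u \<le> 1 \<Longrightarrow> hom_norm (incr (g p) (g (p \<odot> u))) \<le> C * norm u powr \<alpha>'"
    using exists_holder_map_above_half[of \<alpha>'] by metis
  have "hom_norm (incr (g p) (g (p \<odot> u))) \<le> C * norm u powr \<alpha>" if u: "norm u \<le> 1" for p u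
  proof -
    have "norm u powr \<alpha>' \<le> norm u powr \<alpha>" using u \<open>\<alpha> \<le> \<alpha>'\<close> by (intro powr_mono') auto
    then have "C * norm u powr \<alpha>' \<le> C * norm u powr \<alpha>" using g(2) by simp
    then show ?thesis using g(3)[OF u, of p] by linarith
  qed
  with g(1,2) show thesis by (rule that)
qed

lemma holder_imp_continuous:
  assumes C: "0 < C" and \<alpha>: "0 < \<alpha>"
    and g: "\<And>p u. norm u \<le> 1 \<Longrightarrow> hom_norm (incr (g p) (g (p \<odot> u))) \<le> C * norm u powr \<alpha>"
  shows "continuous_on UNIV g"
proof (rule continuous_at_imp_continuous_on, rule ballI)
  fix p :: heis
  have inc: "((\<lambda>q. norm (incr p q)) \<longlongrightarrow> 0) (at p)"
  proof -
    have "continuous_on UNIV (\<lambda>q. norm (incr p q))" unfolding incr_def by (intro continuous_intros)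
    then have "isCont (\<lambda>q. norm (incr p q)) p" by (simp add: continuous_on_eq_continuous_at)
    then show ?thesis by (simp add: isCont_def)
  qed
  then have "((\<lambda>q. C * norm (incr p q) powr \<alpha>) \<longlongrightarrow> C * 0) (at p)"
    using \<alpha> by (intro tendsto_mult tendsto_const tendsto_zero_powrI[where b = \<alpha>]) auto
  moreover have "\<forall>\<^sub>F q in at p. norm (incr p q) < 1" using inc by (intro order_tendstoD) auto
  then have "\<forall>\<^sub>F q in at p. norm (hom_norm (incr (g p) (g q))) \<le> C * norm (incr p q) powr \<alpha>"
  proof eventually_elim
    case (elim q)
    then show ?case using g[of "incr p q" p] by simp
  qed
  ultimately have lim: "((\<lambda>q. hom_norm (incr (g p) (g q))) \<longlongrightarrow> 0) (at p)"
    unfolding mult_zero_right by (rule Lim_null_comparison[rotated])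
  have x: "((\<lambda>q. xc (g q) - xc (g p)) \<longlongrightarrow> 0) (at p)" and y: "((\<lambda>q. yc (g q) - yc (g p)) \<longlongrightarrow> 0) (at p)"
    by (rule Lim_null_comparison[OF always_eventually[OF allI] lim],
        use hom_norm_bounds(1,2)[of "incr (g p) (g q)" for q] in simp)+
  have z: "((\<lambda>q. zc (incr (g p) (g q))) \<longlongrightarrow> 0) (at p)"
  proof (rule Lim_null_comparison)
    show "\<forall>\<^sub>F q in at p. norm (zc (incr (g p) (g q))) \<le> (hom_norm (incr (g p) (g q)))\<^sup>2"
      using hom_norm_bounds(3)[of "incr (g p) (g q)" for q] by (intro always_eventually allI) (simp only: real_norm_def)
    show "((\<lambda>q. (hom_norm (incr (g p) (g q)))\<^sup>2) \<longlongrightarrow> 0) (at p)" using lim by (auto intro!: tendsto_eq_intros)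
  qed
  have "((\<lambda>q. zc (incr (g p) (g q)) + xc (g p) * (yc (g q) - yc (g p))) \<longlongrightarrow> 0) (at p)"
    using tendsto_add[OF z tendsto_mult_right_zero[OF y, of "xc (g p)"]] by (simp only: add_0_left)
  moreover have "zc (incr (g p) (g q)) + xc (g p) * (yc (g q) - yc (g p)) = zc (g q) - zc (g p)" for q by simp
  ultimately have z': "((\<lambda>q. zc (g q) - zc (g p)) \<longlongrightarrow> 0) (at p)" by (simp only:)
  have "((\<lambda>q. (xc (g q), yc (g q), zc (g q))) \<longlongrightarrow> (xc (g p), yc (g p), zc (g p))) (at p)"
    by (intro tendsto_Pair LIM_zero_cancel[OF x] LIM_zero_cancel[OF y] LIM_zero_cancel[OF z'])
  then show "isCont g p" by (simp add: isCont_def)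
qed

text \<open>
  The homotopy is \<open>x \<mapsto> x \<odot> (1 - t) (x\<inverse> g(x))\<close>.  For equivariant \<open>g\<close> the vector
  \<open>x\<inverse> g(x)\<close> is invariant under the lattice, hence so is any multiple of it.
\<close>
lemma equivariant_homotopic_id:
  assumes eq: "lattice_equivariant g" and cont: "continuous_on UNIV g"
  shows "homotopic_with_canon lattice_equivariant UNIV UNIV g id"
proof -
  define h where "h = (\<lambda>(t::real, x). x \<odot> ((1 - t) *\<^sub>R incr x (g x)))"
  have "continuous_on ({0..1} \<times> UNIV) h"
  proof -
    have g: "continuous_on ({0..1} \<times> UNIV) (\<lambda>z. g (snd z))"
      by (rule continuous_on_compose2[OF cont]) (auto intro: continuous_intros)
    have heq: "h = (\<lambda>z. let x = snd z; v = (1 - fst z) *\<^sub>R (xc (g x) - xc x, yc (g x) - yc x, zc (g x) - zc x - xc x * (yc (g x) - yc x))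
        in (xc x + xc v, yc x + yc v, zc x + zc v + xc x * yc v))"
      unfolding h_def Let_def by (auto simp: fun_eq_iff incr_def intro!: heis_eqI)
    show ?thesis unfolding heq Let_def fst_scaleR snd_scaleR fst_conv snd_conv by (intro continuous_intros g)
  qed
  moreover have "lattice_equivariant (\<lambda>x. h (t, x))" for t
    unfolding lattice_equivariant_def
  proof (intro ballI allI)
    fix y x assume "y \<in> \<H>\<^sub>\<int>"
    then have "g (y \<odot> x) = y \<odot> g x" using eq by (simp add: lattice_equivariant_def)
    then show "h (t, y \<odot> x) = y \<odot> h (t, x)" by (simp add: h_def mult_assoc)
  qed
  moreover have "h (0, x) = g x" "h (1, x) = id x" for x by (simp_all add: h_def)
  ultimately show ?thesis
    unfolding homotopic_with_def prod_topology_subtopology_eu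
    by (intro exI[of _ h]) simp
qed

lemma norm_incr_le_of_small:
  assumes "norm a \<le> 1 / 8" "norm b \<le> 1 / 8"
  shows "norm (incr a b) \<le> 1"
proof -
  have a: "\<bar>xc a\<bar> \<le> 1 / 8" "\<bar>yc a\<bar> \<le> 1 / 8" "\<bar>zc a\<bar> \<le> 1 / 8"
    using coord_le_norm[of a] assms(1) by linarith+
  have b: "\<bar>xc b\<bar> \<le> 1 / 8" "\<bar>yc b\<bar> \<le> 1 / 8" "\<bar>zc b\<bar> \<le> 1 / 8"
    using coord_le_norm[of b] assms(2) by linarith+
  have "\<bar>xc a * (yc b - yc a)\<bar> \<le> 1 / 8 * 1"
    unfolding abs_mult using a b by (intro mult_mono) auto
  then have "\<bar>zc (incr a b)\<bar> \<le> 3 / 8"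
    using a(3) b(3) unfolding incr_coords by linarith
  moreover have "\<bar>xc (incr a b)\<bar> \<le> 1 / 4" "\<bar>yc (incr a b)\<bar> \<le> 1 / 4"
    using a b unfolding incr_coords by linarith+
  ultimately show ?thesis using norm_heis_le[of "incr a b"] by linarith
qed

theorem theorem1p2:
  fixes G :: "heis \<Rightarrow> heis \<Rightarrow> heis \<Rightarrow> real" and \<alpha> :: real
  assumes "left_invariant_riemannian G"
    and "strata_orthogonal G"
    and "0 < \<alpha>" and "\<alpha> < 2 / 3"
  shows "\<exists>g :: heis \<Rightarrow> heis.
           locally_holder (riemannian_dist G) (carnot_dist G) \<alpha> g \<and>
           lattice_equivariant g \<and>
           homotopic_with_canon lattice_equivariant UNIV UNIV g id"
proof -
  interpret riemannian G using assms(1) by unfold_locales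
  obtain g C where g: "lattice_equivariant g" "0 < C"
    "\<And>p u. norm u \<le> 1 \<Longrightarrow> hom_norm (incr (g p) (g (p \<odot> u))) \<le> C * norm u powr \<alpha>"
    using exists_holder_map[OF assms(3,4)] by metis
  obtain C1 where C1: "0 < C1" "\<And>p q. norm (incr p q) \<le> C1 * (riemannian_dist G p q + (riemannian_dist G p q)\<^sup>2)"
    by (rule incr_le_riemannian_dist) blast
  obtain C2 where C2: "0 < C2" "\<And>p q. hom_norm (incr p q) \<le> C \<Longrightarrow> carnot_dist G p q \<le> C2 * hom_norm (incr p q)"
    using carnot_dist_le[of C] g(2) by (metis less_imp_le)
  have lin: "norm (incr p q) \<le> 2 * C1 * riemannian_dist G p q" if "riemannian_dist G p q \<le> 1" for p q
  proof -
    have "(riemannian_dist G p q)\<^sup>2 \<le> riemannian_dist G p q"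
      unfolding power2_eq_square using that riemannian_dist_nonneg by (intro mult_left_le) auto
    then have "C1 * (riemannian_dist G p q + (riemannian_dist G p q)\<^sup>2) \<le> C1 * (2 * riemannian_dist G p q)"
      using C1(1) by (intro mult_left_mono) auto
    then show ?thesis using C1(2)[of p q] by simp
  qed
  \<comment> \<open>In a ball of this radius all increments from the centre have norm at most \<open>1/8\<close>, so those between its points have norm at most \<open>1\<close>.\<close>
  define r where "r = min 1 (1 / (16 * C1))"
  have r: "0 < r" "r \<le> 1" "2 * C1 * r \<le> 1 / 8" using C1(1) by (auto simp: r_def min_def field_simps)
  have "locally_holder (riemannian_dist G) (carnot_dist G) \<alpha> g"
    unfolding locally_holder_def
  proof (intro allI exI[of _ r] conjI)
    fix z
    show "holder_on {w. riemannian_dist G z w < r} (riemannian_dist G) (carnot_dist G) \<alpha> g"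
      unfolding holder_on_def
    proof (intro exI[of _ "C2 * C * (2 * C1 + 1) powr \<alpha>"] conjI ballI)
      show "0 < C2 * C * (2 * C1 + 1) powr \<alpha>" using C1(1) C2(1) g(2) by simp
      fix w w' assume w: "w \<in> {w. riemannian_dist G z w < r}" and w': "w' \<in> {w. riemannian_dist G z w < r}"
      let ?d = "riemannian_dist G w w'"
      have small: "norm (incr z v) \<le> 1 / 8" if "v \<in> {w. riemannian_dist G z w < r}" for v
      proof -
        have "2 * C1 * riemannian_dist G z v \<le> 2 * C1 * r" using that C1(1) by simp
        then show ?thesis using lin[of z v] that r by simp
      qed
      define u where "u = incr w w'"
      have "incr (incr z w) (incr z w') = u"
        using incr_left_invariant[of z "incr z w" "incr z w'"] by (simp add: u_def)
      then have u: "norm u \<le> 1" using norm_incr_le_of_small[OF small[OF w] small[OF w']] by simp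
      have ud: "norm u \<le> (2 * C1 + 1) * ?d"
      proof (cases "?d \<le> 1")
        case True
        then show ?thesis using lin[OF True] riemannian_dist_nonneg[of w w'] by (simp add: u_def distrib_right)
      next
        case False
        have "1 * 1 \<le> (2 * C1 + 1) * ?d" using False C1(1) by (intro mult_mono) auto
        then show ?thesis using u by simp
      qed
      have N: "hom_norm (incr (g w) (g w')) \<le> C * norm u powr \<alpha>" using g(3)[OF u, of w] by (simp add: u_def)
      also have "\<dots> \<le> C * 1" using u assms(3) g(2) by (intro mult_left_mono) (auto simp: powr_le1)
      finally have "carnot_dist G (g w) (g w') \<le> C2 * hom_norm (incr (g w) (g w'))" by (intro C2) simp
      also have "\<dots> \<le> C2 * (C * norm u powr \<alpha>)" using N C2(1) by (intro mult_left_mono) auto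
      also have "\<dots> \<le> C2 * (C * ((2 * C1 + 1) * ?d) powr \<alpha>)"
        using C2(1) g(2) ud assms(3) by (intro mult_left_mono powr_mono2) auto
      also have "\<dots> = C2 * C * (2 * C1 + 1) powr \<alpha> * ?d powr \<alpha>"
        using C1(1) riemannian_dist_nonneg by (simp add: powr_mult)
      finally show "carnot_dist G (g w) (g w') \<le> C2 * C * (2 * C1 + 1) powr \<alpha> * ?d powr \<alpha>" .
    qed
  qed (rule r(1))
  moreover have "homotopic_with_canon lattice_equivariant UNIV UNIV g id"
    by (rule equivariant_homotopic_id[OF g(1) holder_imp_continuous[OF g(2) assms(3) g(3)]])
  ultimately show ?thesis using g(1) by blast
qed

end
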